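(* Let $n\ge1$ and let $\Gamma\subset SU(n,1)$ be a discrete subgroup acting freely on the unit ball $\mathbb{B}^n$ such that $M=\Gamma\backslash\mathbb{B}^n$ is smooth and compact. Let $\gamma\in\Gamma$ be a hyperbolic element which is not a power of any other element of $\Gamma$, whose invariant geodesic $\tilde C$ has endpoints $X,Y\in\partial\mathbb{B}^n$ with real coordinates, with $(X,1)^T$ and $(Y,1)^T$ eigenvectors of $\gamma$ for eigenvalues $\lambda$ and $1/\lambda$ respectively, where $\lambda\in\mathbb{R}$ and $\lambda^2>1$. Let $C=\tilde C/\langle\gamma\rangle$ be the corresponding closed geodesic in $M$ and $l(C)$ its hyperbolic length. For integers $k\ge2$ let $\Theta_C^{(k)}$ be the function defined in the context. Then, as $k\to\infty$, $$(\Theta_C^{(k)},\Theta_C^{(k)})\sim k^{n-\frac12}\,\frac{(n+1)^{n-\frac12}}{\pi^{\frac{3n-1}{2n+2}}\,(n!)^{\frac{n-1}{n+1}}}\,\frac{l(C)}{\sqrt2}.$$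
   Context: Notation. $SU(n,1)$ acts on $\mathbb{B}^n\cup\partial\mathbb{B}^n$ by fractional-linear transformations: for $A=(a_{jk})_{j,k=1}^{n+1}$, $z\mapsto\big(\frac{a_{j1}z_1+\dots+a_{jn}z_n+a_{j,n+1}}{a_{n+1,1}z_1+\dots+a_{n+1,n}z_n+a_{n+1,n+1}}\big)_{j=1}^n$, with complex Jacobian determinant $J(A,z)=(a_{n+1,1}z_1+\dots+a_{n+1,n}z_n+a_{n+1,n+1})^{-(n+1)}$. For $z,w\in\mathbb{B}^n$, $\langle z,w\rangle=z_1\bar w_1+\dots+z_n\bar w_n-1$; for $u,v\in\mathbb{C}^{n+1}$, $\langle\langle u,v\rangle\rangle=u_1\bar v_1+\dots+u_n\bar v_n-u_{n+1}\bar v_{n+1}$. The Bergman kernel is $\mathcal{K}(z,w)=\frac{n!}{\pi^n}(-\langle z,w\rangle)^{-(n+1)}$, $dV_e$ is Euclidean volume and $dV(z)=\mathcal{K}(z,z)dV_e(z)$. The complex hyperbolic distance $\rho$ satisfies $\cosh^2\frac{\rho(z,w)}{2}=\frac{\langle z,w\rangle\langle w,z\rangle}{\langle z,z\rangle\langle w,w\rangle}$, and $l(C)=\rho(w,\gamma w)$ for any $w\in\tilde C$. An element of $SU(n,1)$ is loxodromic if it has exactly two fixed points in $\mathbb{B}^n\cup\partial\mathbb{B}^n$ (these lie on $\partial\mathbb{B}^n$) and hyperbolic if moreover all its eigenvalues are real; the remaining eigenvalues of $\gamma$ are then $\pm1$. The matrix $A_\gamma$: let $v_1,\dots,v_{n-1}$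 be eigenvectors of $\gamma$ for its eigenvalues other than $\lambda,1/\lambda$ (each $\pm1$), ordered with those for $-1$ first, such that the eigenvectors for $-1$ form a $\langle\langle\cdot,\cdot\rangle\rangle$-orthonormal basis of their span and likewise those for $1$. Set $$A_\gamma=\Big(v_1\ \cdots\ v_{n-1}\ \ \tfrac{1}{\langle X,Y\rangle}\tbinom{X}{1}+\tfrac12\tbinom{Y}{1}\ \ \tfrac{1}{\langle X,Y\rangle}\tbinom{X}{1}-\tfrac12\tbinom{Y}{1}\Big)\in SU(n,1);$$ it maps $(0,\dots,0,1)\mapsto X$, $(0,\dots,0,-1)\mapsto Y$ and the geodesic $\tilde C_0=\{z: z_1=\dots=z_{n-1}=0,\ z_n\in(-1,1)\}$ onto $\tilde C$. Let $\varphi(z)=\mathcal{K}(z,z)^{1/(n+1)}dz_n$ (a 1-form on $\mathbb{B}^n$). Sections. For an integer $k\ge2$ and $w\in\mathbb{B}^n$ let $c(\mathbb{B}^n,k)=\binom{(n+1)(k-1)+n}{n}$ and $$\Theta_w^{(k)}(z)=c(\mathbb{B}^n,k)\sum_{A\in\Gamma}\mathcal{K}(Az,w)^kJ(A,z)^k,$$ and define $$\Theta_C^{(k)}(z)=\int_{C}\Theta_w^{(k)}(z)\,\mathcal{K}(w,w)^{-k/2}\,\big((A_\gamma^{-1})^*\varphi\big)(w),$$ where the integral over $C$ (in the variable $w$) is the line integral along the segment of $\tilde C$ from $A_\gamma(0)$ to $\gamma(A_\gamma(0))$. For holomorphic $f,g$ on $\mathbb{B}^n$ satisfying $f(Az)J(A,z)^k=f(z)$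 for all $A\in\Gamma$ (these correspond to holomorphic sections of $K_M^{\otimes k}$, $K_M$ the canonical bundle), the inner product is $(f,g)=\int_M f(z)\overline{g(z)}\mathcal{K}(z,z)^{-k}dV(z)$, the integral taken over a fundamental domain of $\Gamma$. Asymptotic equivalence $a_k\sim b_k$ means $a_k/b_k\to1$. *)

theory Defs
  imports "HOL-Analysis.Analysis" "Jordan_Normal_Form.Matrix" "Jordan_Normal_Form.Char_Poly"
    "Jordan_Normal_Form.Gauss_Jordan_Elimination"
begin

text \<open>Conventions. n is the complex dimension. Points of C^n are extensional functions
  nat => complex on the index set {..<n}: index j (0-based) is the paper's coordinate z_(j+1),
  so the paper's z_n is index n-1.  Matrices are Jordan_Normal_Form matrices of size (n+1)x(n+1)
  with 0-based indices; the paper's a_(n+1,j) is row index n.\<close>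

definition cpts :: "nat \<Rightarrow> (nat \<Rightarrow> complex) set" where
  "cpts n = PiE {..<n} (\<lambda>_. UNIV)"

definition ball_n :: "nat \<Rightarrow> (nat \<Rightarrow> complex) set" where
  "ball_n n = {z \<in> cpts n. (\<Sum>j<n. (cmod (z j))\<^sup>2) < 1}"

definition sphere_n :: "nat \<Rightarrow> (nat \<Rightarrow> complex) set" where
  "sphere_n n = {z \<in> cpts n. (\<Sum>j<n. (cmod (z j))\<^sup>2) = 1}"

definition vol_e :: "nat \<Rightarrow> (nat \<Rightarrow> complex) measure" where
  "vol_e n = PiM {..<n} (\<lambda>_. lborel)"

definition bip :: "nat \<Rightarrow> (nat \<Rightarrow> complex) \<Rightarrow> (nat \<Rightarrow> complex) \<Rightarrow> complex" where
  "bip n z w = (\<Sum>j<n. z j * cnj (w j)) - 1"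

definition hform :: "nat \<Rightarrow> complex vec \<Rightarrow> complex vec \<Rightarrow> complex" where
  "hform n u v = (\<Sum>j<n. u $ j * cnj (v $ j)) - u $ n * cnj (v $ n)"

definition SU_n1 :: "nat \<Rightarrow> complex mat set" where
  "SU_n1 n = {A \<in> carrier_mat (n+1) (n+1). det A = 1 \<and>
      (\<forall>u \<in> carrier_vec (n+1). \<forall>v \<in> carrier_vec (n+1). hform n (A *\<^sub>v u) (A *\<^sub>v v) = hform n u v)}"

definition denom :: "nat \<Rightarrow> complex mat \<Rightarrow> (nat \<Rightarrow> complex) \<Rightarrow> complex" where
  "denom n A z = (\<Sum>l<n. A $$ (n, l) * z l) + A $$ (n, n)"

definition mob :: "nat \<Rightarrow> complex mat \<Rightarrow> (nat \<Rightarrow> complex) \<Rightarrow> (nat \<Rightarrow> complex)" where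
  "mob n A z = (\<lambda>j\<in>{..<n}. ((\<Sum>l<n. A $$ (j, l) * z l) + A $$ (j, n)) / denom n A z)"

definition jac :: "nat \<Rightarrow> complex mat \<Rightarrow> (nat \<Rightarrow> complex) \<Rightarrow> complex" where
  "jac n A z = inverse (denom n A z) ^ (n+1)"

definition bergman :: "nat \<Rightarrow> (nat \<Rightarrow> complex) \<Rightarrow> (nat \<Rightarrow> complex) \<Rightarrow> complex" where
  "bergman n z w = of_real (fact n / pi ^ n) * inverse (- bip n z w) ^ (n+1)"

definition hdist :: "nat \<Rightarrow> (nat \<Rightarrow> complex) \<Rightarrow> (nat \<Rightarrow> complex) \<Rightarrow> real" where
  "hdist n z w = 2 * arcosh (sqrt (Re (bip n z w * bip n w z / (bip n z z * bip n w w))))"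

definition lift :: "nat \<Rightarrow> (nat \<Rightarrow> complex) \<Rightarrow> complex vec" where
  "lift n z = vec (n+1) (\<lambda>i. if i < n then z i else 1)"

definition subgroup_SU :: "nat \<Rightarrow> complex mat set \<Rightarrow> bool" where
  "subgroup_SU n G \<longleftrightarrow> G \<subseteq> SU_n1 n \<and> 1\<^sub>m (n+1) \<in> G \<and> (\<forall>A\<in>G. \<forall>B\<in>G. A * B \<in> G)
     \<and> (\<forall>A\<in>G. \<exists>B\<in>G. B * A = 1\<^sub>m (n+1))"

definition discrete_mat :: "nat \<Rightarrow> complex mat set \<Rightarrow> bool" where
  "discrete_mat n G \<longleftrightarrow> (\<forall>A\<in>G. \<exists>e>0. \<forall>B\<in>G. B \<noteq> A \<longrightarrow>
       (\<exists>i\<le>n. \<exists>j\<le>n. e \<le> cmod (B $$ (i,j) - A $$ (i,j))))"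

definition acts_freely :: "nat \<Rightarrow> complex mat set \<Rightarrow> bool" where
  "acts_freely n G \<longleftrightarrow> (\<forall>A\<in>G. A \<noteq> 1\<^sub>m (n+1) \<longrightarrow> (\<forall>z\<in>ball_n n. mob n A z \<noteq> z))"

definition cocompact :: "nat \<Rightarrow> complex mat set \<Rightarrow> bool" where
  "cocompact n G \<longleftrightarrow> (\<exists>K. compact K \<and> K \<subseteq> ball_n n \<and> ball_n n \<subseteq> (\<Union>A\<in>G. mob n A ` K))"

definition fund_domain :: "nat \<Rightarrow> complex mat set \<Rightarrow> (nat \<Rightarrow> complex) set \<Rightarrow> bool" where
  "fund_domain n G F \<longleftrightarrow> F \<in> sets (vol_e n) \<and> F \<subseteq> ball_n n \<and>
     ball_n n = (\<Union>A\<in>G. mob n A ` F) \<and>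
     (\<forall>A\<in>G. \<forall>B\<in>G. A \<noteq> B \<longrightarrow>
        (\<exists>N. N \<in> null_sets (vol_e n) \<and> mob n A ` F \<inter> mob n B ` F \<subseteq> N))"

definition loxodromic :: "nat \<Rightarrow> complex mat \<Rightarrow> bool" where
  "loxodromic n A \<longleftrightarrow> card {z \<in> ball_n n \<union> sphere_n n. mob n A z = z} = 2"

definition hyperbolic_el :: "nat \<Rightarrow> complex mat \<Rightarrow> bool" where
  "hyperbolic_el n A \<longleftrightarrow> loxodromic n A \<and> (\<forall>\<mu>. eigenvalue A \<mu> \<longrightarrow> \<mu> \<in> \<real>)"

definition primitive_in :: "complex mat set \<Rightarrow> complex mat \<Rightarrow> bool" where
  "primitive_in G A \<longleftrightarrow> \<not> (\<exists>D\<in>G. \<exists>m::nat. m \<ge> 2 \<and> A = D ^\<^sub>m m)"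

definition A_gamma :: "nat \<Rightarrow> (nat \<Rightarrow> complex vec) \<Rightarrow> (nat \<Rightarrow> complex) \<Rightarrow> (nat \<Rightarrow> complex) \<Rightarrow> complex mat" where
  "A_gamma n v X Y = mat (n+1) (n+1) (\<lambda>(i,j).
     if j < n - 1 then v j $ i
     else if j = n - 1 then (lift n X $ i) / bip n X Y + (lift n Y $ i) / 2
     else (lift n X $ i) / bip n X Y - (lift n Y $ i) / 2)"

definition c0pt :: "nat \<Rightarrow> real \<Rightarrow> (nat \<Rightarrow> complex)" where
  "c0pt n t = (\<lambda>j\<in>{..<n}. if j = n - 1 then complex_of_real t else 0)"

text \<open>The 1-form phi = K(z,z)^(1/(n+1)) dz_n, recorded by its coefficient function.\<close>
definition phi_coeff :: "nat \<Rightarrow> (nat \<Rightarrow> complex) \<Rightarrow> complex" where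
  "phi_coeff n z = of_real (Re (bergman n z z) powr (1 / real (n+1)))"

text \<open>Line integral of  h(w) * (F^* (g dz_n))(w)  along the path c from parameter a to b:
  the pullback of g dz_n by F evaluated on c'(t) is g(F(c t)) * d/dt (F(c t))_n.\<close>
definition line_int_pullback :: "nat \<Rightarrow> ((nat \<Rightarrow> complex) \<Rightarrow> complex) \<Rightarrow> ((nat \<Rightarrow> complex) \<Rightarrow> complex)
     \<Rightarrow> ((nat \<Rightarrow> complex) \<Rightarrow> (nat \<Rightarrow> complex)) \<Rightarrow> (real \<Rightarrow> (nat \<Rightarrow> complex)) \<Rightarrow> real \<Rightarrow> real \<Rightarrow> complex" where
  "line_int_pullback n h g F c a b =
     interval_lebesgue_integral lborel (ereal a) (ereal b)
       (\<lambda>t. h (c t) * g (F (c t)) * vector_derivative (\<lambda>s. F (c s) (n - 1)) (at t))"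

definition Theta_w :: "nat \<Rightarrow> complex mat set \<Rightarrow> nat \<Rightarrow> (nat \<Rightarrow> complex) \<Rightarrow> (nat \<Rightarrow> complex) \<Rightarrow> complex" where
  "Theta_w n G k w z = of_nat ((n+1)*(k-1) + n choose n) *
     infsum (\<lambda>A. bergman n (mob n A z) w ^ k * jac n A z ^ k) G"

text \<open>Theta_C^(k): integral over the segment of the geodesic from A_gamma(0) to gamma(A_gamma(0)),
  parametrised as t |-> A_gamma(0,...,0,t), t from 0 to t1 where A_gamma(0,..,0,t1) = gamma(A_gamma 0).\<close>
definition seg_end :: "nat \<Rightarrow> complex mat \<Rightarrow> complex mat \<Rightarrow> real" where
  "seg_end n Ag g = (THE t. -1 < t \<and> t < 1 \<and> mob n Ag (c0pt n t) = mob n g (mob n Ag (c0pt n 0)))"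

definition Theta_C :: "nat \<Rightarrow> complex mat set \<Rightarrow> complex mat \<Rightarrow> complex mat \<Rightarrow> nat \<Rightarrow> (nat \<Rightarrow> complex) \<Rightarrow> complex" where
  "Theta_C n G g Ag k z =
     line_int_pullback n
       (\<lambda>w. Theta_w n G k w z * of_real (Re (bergman n w w) powr (- real k / 2)))
       (phi_coeff n)
       (mob n (the (mat_inverse Ag)))
       (\<lambda>t. mob n Ag (c0pt n t)) 0 (seg_end n Ag g)"

definition pet_ip :: "nat \<Rightarrow> nat \<Rightarrow> (nat \<Rightarrow> complex) set \<Rightarrow> ((nat \<Rightarrow> complex) \<Rightarrow> complex)
     \<Rightarrow> ((nat \<Rightarrow> complex) \<Rightarrow> complex) \<Rightarrow> complex" where
  "pet_ip n k F f g = set_lebesgue_integral (vol_e n) F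
     (\<lambda>z. f z * cnj (g z) * (bergman n z z) powi (- int k) * bergman n z z)"

end

theory Submission
  imports Defs "HOL-Probability.Probability"
begin

text \<open>
  Write \<open>\<langle>Z, W\<rangle>\<close> for the Hermitian form of signature \<open>(n,1)\<close>, \<open>N = (n+1)k\<close>, and let \<open>u(s)\<close> be the
  unit negative vectors over the geodesic, parametrised by arc length, so that
  \<open>\<langle>u(s), u(s')\<rangle> = - cosh ((s - s')/2)\<close>. Up to constants \<open>\<Theta>\<close> is the sum over \<open>A \<in> \<Gamma>\<close> of the integrals
  of \<open>(- \<langle>A Z, u(s)\<rangle>)^(-N)\<close> over a period \<open>[0, L]\<close>. Unfolding the integral over the fundamental domain
  and the reproducing property of \<open>(- \<langle>Z, U\<rangle>)^(-N)\<close> turn the square norm into the sum over \<open>A\<close> of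
  the double integrals of \<open>(- \<langle>A u(s), u(s')\<rangle>)^(-N)\<close>. The term \<open>A = 1\<close> is the integral of
  \<open>cosh ((s - s')/2)^(-N)\<close>, a Gaussian integral of size \<open>L sqrt (8 pi / N) / 4\<close>. For \<open>A \<noteq> 1\<close> the absolute value
  of the base is at least 1, with equality in at most one point of the square \<open>[0, L]\<^sup>2\<close> (two
  coincidences would make \<open>A\<close> preserve the geodesic, against freeness and primitivity), so these
  terms are of smaller order; convergence of the sum of \<open>|A\<^sub>n\<^sub>n|^(-2(n+2))\<close> makes this uniform.
\<close>

section \<open>Lebesgue measure on complex coordinate space under linear maps\<close>

text \<open>It is replaced by a bound uniform in A: along the geodesic the squared modulus of <A
  u(s), u(s')> is a positive multiple of a hyperbolic cosine plus a constant, and being at least 1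
  it must grow at least like 1 + (s - s0)^2 / 4. Hence sqrt N times the inner integral stays below 2
  pi, and dominated convergence applies.

  Homogeneous vectors absorb J(A, z)^k and K(w, w)^(-k/2), which only rescale the arguments of the
  Hermitian form. Invariance of the hyperbolic measure is read off from linear maps of C^(n+1), so
  that no fractional-linear map is differentiated.

  Constants: with t = tanh (s/2) the pulled-back form kap dt / (1 - t^2) becomes kap ds / 2, hence
  integration against half the arc length. Of the two factors c(B^n, k) in the square norm, one
  cancels against the reproducing constant and the other grows like N^n / n!.\<close>

lemma lborel_complex_eq_distr:
  "(lborel :: complex measure) = distr (lborel \<Otimes>\<^sub>M lborel) borel (\<lambda>(x, y). Complex x y)"
proof (rule lborel_eqI)
  fix l u :: complex
  assume le: "\<And>b. b \<in> Basis \<Longrightarrow> l \<bullet> b \<le> u \<bullet> b"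
  have l1: "Re l \<le> Re u" using le[of 1] by (simp add: Basis_complex_def inner_complex_def)
  have l2: "Im l \<le> Im u" using le[of \<i>] by (simp add: Basis_complex_def inner_complex_def)
  have [measurable]: "(\<lambda>(x, y). Complex x y) \<in> borel_measurable (lborel \<Otimes>\<^sub>M lborel)"
  proof -
    have "(\<lambda>p::real\<times>real. of_real (fst p) + \<i> * of_real (snd p)) \<in> borel_measurable (lborel \<Otimes>\<^sub>M lborel)"
      by measurable
    then show ?thesis by (simp add: case_prod_beta' Complex_eq)
  qed
  have pre: "(\<lambda>(x, y). Complex x y) -` box l u \<inter> space (lborel \<Otimes>\<^sub>M lborel)
     = {Re l<..<Re u} \<times> {Im l<..<Im u}"
    by (auto simp: box_def Basis_complex_def inner_complex_def space_pair_measure)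
  have "emeasure (distr (lborel \<Otimes>\<^sub>M lborel) borel (\<lambda>(x, y). Complex x y)) (box l u)
     = emeasure (lborel \<Otimes>\<^sub>M lborel) ({Re l<..<Re u} \<times> {Im l<..<Im u})"
    by (subst emeasure_distr) (auto simp: pre)
  also have "\<dots> = ennreal (Re u - Re l) * ennreal (Im u - Im l)"
    by (subst lborel.emeasure_pair_measure_Times) (use l1 l2 in auto)
  also have "\<dots> = ennreal ((Re u - Re l) * (Im u - Im l))"
    using l1 l2 by (simp add: ennreal_mult)
  also have "(Re u - Re l) * (Im u - Im l) = prod ((\<bullet>) (u - l)) Basis"
    by (simp add: Basis_complex_def inner_complex_def)
  finally show "emeasure (distr (lborel \<Otimes>\<^sub>M lborel) borel (\<lambda>(x, y). Complex x y)) (box l u)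
     = ennreal (prod ((\<bullet>) (u - l)) Basis)" .
qed simp

lemma borel_measurable_Complex [measurable (raw)]:
  assumes [measurable]: "f \<in> borel_measurable M" "g \<in> borel_measurable M"
  shows "(\<lambda>x. Complex (f x) (g x)) \<in> borel_measurable M"
  by (simp add: Complex_eq)

lemma nn_integral_complex_iterated:
  assumes [measurable]: "f \<in> borel_measurable borel"
  shows "(\<integral>\<^sup>+z. f z \<partial>lborel) = (\<integral>\<^sup>+x. \<integral>\<^sup>+y. f (Complex x y) \<partial>lborel \<partial>lborel)"
proof -
  have "(\<integral>\<^sup>+z. f z \<partial>lborel) = (\<integral>\<^sup>+p. f (Complex (fst p) (snd p)) \<partial>(lborel \<Otimes>\<^sub>M lborel))"
    by (subst lborel_complex_eq_distr, subst nn_integral_distr) (auto simp: case_prod_beta')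
  also have "\<dots> = (\<integral>\<^sup>+x. \<integral>\<^sup>+y. f (Complex x y) \<partial>lborel \<partial>lborel)"
    by (subst lborel.nn_integral_fst[symmetric]) auto
  finally show ?thesis .
qed

text \<open>With c = a + ib, multiplication by c splits into two real affine substitutions, one in
  each coordinate, with Jacobians d = |c|^2 / a and a. Their product is |c|^2. The splitting divides
  by a.\<close>

lemma nn_integral_complex_scale_Re:
  assumes [measurable]: "f \<in> borel_measurable borel" and a0: "Re c \<noteq> 0"
  shows "(\<integral>\<^sup>+z. f z \<partial>lborel) = ennreal ((cmod c)\<^sup>2) * (\<integral>\<^sup>+z. f (c * z) \<partial>lborel)"
proof -
  define a b d where "a = Re c" and "b = Im c" and "d = (cmod c)\<^sup>2 / a"
  have a: "a \<noteq> 0" and d: "d \<noteq> 0" using a0 by (auto simp: a_def d_def)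
  have c2: "(cmod c)\<^sup>2 = a\<^sup>2 + b\<^sup>2" by (simp add: cmod_power2 a_def b_def)
  \<comment> \<open>The substitution u = a x - b y makes u the real part of c z. In the second slot
    the choice of d turns -b^2 y / a + d y into a y, which leaves the imaginary part b x + a
    y.\<close>
  have inner: "(\<integral>\<^sup>+u. f (Complex u ((b * u) / a + d * y)) \<partial>lborel)
      = ennreal \<bar>a\<bar> * (\<integral>\<^sup>+x. f (c * Complex x y) \<partial>lborel)" for y
  proof -
    have d': "d = (a * a + b * b) / a" unfolding d_def c2 by (simp add: power2_eq_square)
    have *: "Complex (- b * y + a * x) (b * (- b * y + a * x) / a + d * y) = c * Complex x y" for x
      using a by (simp add: complex_eq_iff a_def[symmetric] b_def[symmetric] d' field_simps)
    show ?thesis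
      using nn_integral_real_affine[of "\<lambda>u. f (Complex u ((b * u) / a + d * y))" a "- b * y"] a
      unfolding * by simp
  qed
  have "(\<integral>\<^sup>+z. f z \<partial>lborel) = (\<integral>\<^sup>+u. \<integral>\<^sup>+v. f (Complex u v) \<partial>lborel \<partial>lborel)"
    by (rule nn_integral_complex_iterated) simp
  also have "\<dots> = (\<integral>\<^sup>+u. ennreal \<bar>d\<bar> * (\<integral>\<^sup>+y. f (Complex u (b * u / a + d * y)) \<partial>lborel) \<partial>lborel)"
    by (intro nn_integral_cong nn_integral_real_affine d) simp
  also have "\<dots> = ennreal \<bar>d\<bar> * (\<integral>\<^sup>+u. \<integral>\<^sup>+y. f (Complex u (b * u / a + d * y)) \<partial>lborel \<partial>lborel)"
    by (rule nn_integral_cmult) measurable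
  also have "\<dots> = ennreal \<bar>d\<bar> * (\<integral>\<^sup>+y. \<integral>\<^sup>+u. f (Complex u (b * u / a + d * y)) \<partial>lborel \<partial>lborel)"
    by (intro arg_cong2[where f="(*)"] refl lborel_pair.Fubini'[symmetric]) measurable
  also have "\<dots> = ennreal \<bar>d\<bar> * (ennreal \<bar>a\<bar> * (\<integral>\<^sup>+y. \<integral>\<^sup>+x. f (c * Complex x y) \<partial>lborel \<partial>lborel))"
    unfolding inner by (intro arg_cong2[where f="(*)"] refl nn_integral_cmult) measurable
  also have "(\<integral>\<^sup>+y. \<integral>\<^sup>+x. f (c * Complex x y) \<partial>lborel \<partial>lborel) = (\<integral>\<^sup>+x. \<integral>\<^sup>+y. f (c * Complex x y) \<partial>lborel \<partial>lborel)"
    by (rule lborel_pair.Fubini') measurable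
  also have "\<dots> = (\<integral>\<^sup>+z. f (c * z) \<partial>lborel)"
    by (rule nn_integral_complex_iterated[symmetric]) simp
  also have "ennreal \<bar>d\<bar> * (ennreal \<bar>a\<bar> * (\<integral>\<^sup>+z. f (c * z) \<partial>lborel)) = ennreal ((cmod c)\<^sup>2) * (\<integral>\<^sup>+z. f (c * z) \<partial>lborel)"
    using a by (simp add: mult.assoc[symmetric] ennreal_mult'[symmetric] d_def abs_mult[symmetric])
  finally show ?thesis .
qed

lemma nn_integral_complex_scale:
  assumes [measurable]: "f \<in> borel_measurable borel" and c: "c \<noteq> 0"
  shows "(\<integral>\<^sup>+z. f z \<partial>lborel) = ennreal ((cmod c)\<^sup>2) * (\<integral>\<^sup>+z. f (c * z) \<partial>lborel)"
proof (cases "Re c = 0")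
  case False
  then show ?thesis by (intro nn_integral_complex_scale_Re assms)
next
  case True
  \<comment> \<open>A purely imaginary c is the product of c (1 - i) and (1 + i) / 2, both with
    nonzero real part, so the previous case is applied twice.\<close>
  define e where "e = c * (1 - \<i>)"
  define e' where "e' = (1 + \<i>) / 2"
  have "(1 - \<i>) * (1 + \<i>) = 2" by (simp add: algebra_simps)
  then have ce: "c = e * e'" by (simp add: e_def e'_def mult.assoc)
  have "Im c \<noteq> 0" using True c by (simp add: complex_eq_iff)
  then have e: "Re e \<noteq> 0" "Re e' \<noteq> 0" using True by (auto simp: e_def e'_def)
  have "(\<integral>\<^sup>+z. f z \<partial>lborel) = ennreal ((cmod e)\<^sup>2) * (\<integral>\<^sup>+z. f (e * z) \<partial>lborel)"
    by (rule nn_integral_complex_scale_Re) (use e in auto)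
  also have "(\<integral>\<^sup>+z. f (e * z) \<partial>lborel) = ennreal ((cmod e')\<^sup>2) * (\<integral>\<^sup>+z. f (e * (e' * z)) \<partial>lborel)"
    by (rule nn_integral_complex_scale_Re) (use e in auto)
  finally show ?thesis
    by (simp add: ce mult.assoc[symmetric] ennreal_mult'[symmetric] norm_mult power_mult_distrib)
qed

lemma nn_integral_complex_translate:
  assumes [measurable]: "f \<in> borel_measurable borel"
  shows "(\<integral>\<^sup>+z. f (z + t) \<partial>lborel) = (\<integral>\<^sup>+z. f (z::complex) \<partial>lborel)"
  by (subst (2) lborel_distr_plus[symmetric, of t], subst nn_integral_distr) (auto simp: add.commute)

interpretation cprod: product_sigma_finite "\<lambda>_::nat. lborel :: complex measure"
  by standard

lemma vol_e_insert:
  assumes "k < m" and f: "f \<in> borel_measurable (vol_e m)"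
  shows "(\<integral>\<^sup>+z. f z \<partial>vol_e m)
    = (\<integral>\<^sup>+x. \<integral>\<^sup>+y. f (x(k := y)) \<partial>lborel \<partial>PiM ({..<m} - {k}) (\<lambda>_. lborel))"
proof -
  have "{..<m} = insert k ({..<m} - {k})" using assms by auto
  then show ?thesis
    using cprod.product_nn_integral_insert[of "{..<m} - {k}" k f] f by (simp add: vol_e_def)
qed

lemma measurable_upd_vol_e:
  assumes "k < m" and f: "f \<in> borel_measurable (vol_e m)"
    and x: "x \<in> space (PiM ({..<m} - {k}) (\<lambda>_. lborel))"
  shows "(\<lambda>y. f (x(k := y))) \<in> borel_measurable borel"
proof -
  have ins: "{..<m} = insert k ({..<m} - {k})" using assms by auto
  have "(\<lambda>y. x(k := y)) \<in> lborel \<rightarrow>\<^sub>M PiM (insert k ({..<m} - {k})) (\<lambda>_. lborel)"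
    by (rule measurable_component_update) (use x in auto)
  then have "(\<lambda>y. x(k := y)) \<in> lborel \<rightarrow>\<^sub>M vol_e m" using ins by (simp add: vol_e_def)
  from measurable_compose[OF this f] show ?thesis by simp
qed

section \<open>Jacobian of a complex linear map by row operations\<close>

definition lin_map :: "nat \<Rightarrow> complex mat \<Rightarrow> (nat \<Rightarrow> complex) \<Rightarrow> nat \<Rightarrow> complex" where
  "lin_map m A z = (\<lambda>i\<in>{..<m}. \<Sum>l<m. A $$ (i, l) * z l)"

lemma lin_map_measurable [measurable]: "lin_map m A \<in> vol_e m \<rightarrow>\<^sub>M vol_e m"
  unfolding lin_map_def vol_e_def by measurable

text \<open>A predicate on matrices, so that closure under products can carry it through an
  elimination. The factor is the squared modulus because a complex linear map has real determinant
  |det|^2.\<close>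

definition scales_volume :: "nat \<Rightarrow> complex mat \<Rightarrow> bool" where
  "scales_volume m A \<longleftrightarrow> (\<forall>f \<in> borel_measurable (vol_e m).
     (\<integral>\<^sup>+z. f z \<partial>vol_e m) = ennreal ((cmod (Determinant.det A))\<^sup>2) * (\<integral>\<^sup>+z. f (lin_map m A z) \<partial>vol_e m))"

lemma lin_map_mult:
  assumes "A \<in> carrier_mat m m" "B \<in> carrier_mat m m"
  shows "lin_map m (A * B) z = lin_map m A (lin_map m B z)"
proof
  fix i
  show "lin_map m (A * B) z i = lin_map m A (lin_map m B z) i"
  proof (cases "i < m")
    case True
    have "(\<Sum>l<m. (A * B) $$ (i, l) * z l) = (\<Sum>l<m. \<Sum>j<m. A $$ (i, j) * B $$ (j, l) * z l)"
      using assms True by (intro sum.cong refl)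
        (auto simp: scalar_prod_def sum_distrib_right atLeast0LessThan)
    also have "\<dots> = (\<Sum>j<m. \<Sum>l<m. A $$ (i, j) * B $$ (j, l) * z l)" by (rule sum.swap)
    also have "\<dots> = (\<Sum>j<m. A $$ (i, j) * (\<Sum>l<m. B $$ (j, l) * z l))"
      by (simp add: sum_distrib_left mult.assoc)
    finally show ?thesis using True by (simp add: lin_map_def)
  qed (simp add: lin_map_def)
qed

lemma scales_volume_mult:
  assumes "A \<in> carrier_mat m m" "B \<in> carrier_mat m m" "scales_volume m A" "scales_volume m B"
  shows "scales_volume m (A * B)"
  unfolding scales_volume_def
proof
  fix f :: "(nat \<Rightarrow> complex) \<Rightarrow> ennreal" assume f[measurable]: "f \<in> borel_measurable (vol_e m)"
  have "(\<integral>\<^sup>+z. f z \<partial>vol_e m) = ennreal ((cmod (Determinant.det A))\<^sup>2) * (\<integral>\<^sup>+z. f (lin_map m A z) \<partial>vol_e m)"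
    using assms(3) f unfolding scales_volume_def by blast
  also have "(\<integral>\<^sup>+z. f (lin_map m A z) \<partial>vol_e m)
     = ennreal ((cmod (Determinant.det B))\<^sup>2) * (\<integral>\<^sup>+z. f (lin_map m A (lin_map m B z)) \<partial>vol_e m)"
  proof -
    have "(\<lambda>z. f (lin_map m A z)) \<in> borel_measurable (vol_e m)" by measurable
    with assms(4) show ?thesis unfolding scales_volume_def by blast
  qed
  finally show "(\<integral>\<^sup>+z. f z \<partial>vol_e m) = ennreal ((cmod (Determinant.det (A * B)))\<^sup>2)
      * (\<integral>\<^sup>+z. f (lin_map m (A * B) z) \<partial>vol_e m)"
    using assms(1,2) by (simp add: lin_map_mult det_mult norm_mult power_mult_distrib ennreal_mult' mult.assoc)
qed

text \<open>With all other coordinates fixed, the shear only translates coordinate k, so translation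
  invariance in that coordinate suffices. The determinant is 1.\<close>

lemma scales_volume_addrow_mat:
  assumes "k < m" "l < m" "k \<noteq> l"
  shows "scales_volume m (addrow_mat m a k l)"
  unfolding scales_volume_def
proof
  fix f :: "(nat \<Rightarrow> complex) \<Rightarrow> ennreal" assume f[measurable]: "f \<in> borel_measurable (vol_e m)"
  have eq: "lin_map m (addrow_mat m a k l) (x(k := y)) = x(k := y + a * x l)"
    if x: "x \<in> space (PiM ({..<m} - {k}) (\<lambda>_. lborel))" for x y
  proof
    fix i
    have ext: "x i = undefined" if "\<not> i < m" using x that by (auto simp: space_PiM PiE_def extensional_def)
    show "lin_map m (addrow_mat m a k l) (x(k := y)) i = (x(k := y + a * x l)) i"
    proof (cases "i < m")
      case True
      have "(\<Sum>j<m. addrow_mat m a k l $$ (i, j) * (x(k := y)) j)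
         = (\<Sum>j<m. (if j = i then (x(k := y)) j else 0) + (if j = l then (if i = k then a * (x(k:=y)) j else 0) else 0))"
        using True assms by (intro sum.cong refl) (auto simp: addrow_mat_def algebra_simps)
      also have "\<dots> = (x(k := y)) i + (if i = k then a * x l else 0)"
        using True assms by (simp add: sum.distrib)
      finally show ?thesis using True by (simp add: lin_map_def)
    qed (use assms ext in \<open>auto simp: lin_map_def\<close>)
  qed
  have "(\<integral>\<^sup>+z. f (lin_map m (addrow_mat m a k l) z) \<partial>vol_e m)
     = (\<integral>\<^sup>+x. \<integral>\<^sup>+y. f (lin_map m (addrow_mat m a k l) (x(k := y))) \<partial>lborel \<partial>PiM ({..<m} - {k}) (\<lambda>_. lborel))"
    by (rule vol_e_insert) (use assms in auto)
  also have "\<dots> = (\<integral>\<^sup>+x. \<integral>\<^sup>+y. f (x(k := y)) \<partial>lborel \<partial>PiM ({..<m} - {k}) (\<lambda>_. lborel))"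
  proof (rule nn_integral_cong)
    fix x assume x: "x \<in> space (PiM ({..<m} - {k}) (\<lambda>_. lborel :: complex measure))"
    show "(\<integral>\<^sup>+y. f (lin_map m (addrow_mat m a k l) (x(k := y))) \<partial>lborel) = (\<integral>\<^sup>+y. f (x(k := y)) \<partial>lborel)"
      using nn_integral_complex_translate[OF measurable_upd_vol_e[OF assms(1) f x], of "a * x l"]
      by (simp add: eq[OF x])
  qed
  also have "\<dots> = (\<integral>\<^sup>+z. f z \<partial>vol_e m)"
    by (rule vol_e_insert[symmetric]) (use assms in auto)
  finally show "(\<integral>\<^sup>+z. f z \<partial>vol_e m) = ennreal ((cmod (Determinant.det (addrow_mat m a k l)))\<^sup>2)
      * (\<integral>\<^sup>+z. f (lin_map m (addrow_mat m a k l) z) \<partial>vol_e m)"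
    using assms by (simp add: det_addrow_mat)
qed

lemma addrow_addrow_uminus:
  assumes "A \<in> carrier_mat m m" "k < m" "l < m" "k \<noteq> l"
  shows "addrow_mat m (- a) k l * addrow a k l A = (A :: complex mat)"
  using assms
  by (subst addrow_mat[symmetric, of _ m m]) (auto intro!: eq_matI simp: algebra_simps)

text \<open>A row addition is undone by the opposite one, itself a product with a shear matrix. It
  is therefore enough to treat the matrix after the operation.\<close>

lemma scales_volume_from_addrow:
  assumes "A \<in> carrier_mat m m" "k < m" "l < m" "k \<noteq> l" "scales_volume m (addrow a k l A)"
  shows "scales_volume m A"
  using scales_volume_mult[of "addrow_mat m (- a) k l" m "addrow a k l A"] assms
  by (auto simp: addrow_addrow_uminus intro: scales_volume_addrow_mat)

text \<open>The end state of the elimination: row additions preserve the determinant, so one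
  diagonal entry has to carry all of it.\<close>

lemma scales_volume_diag_last:
  assumes A: "A \<in> carrier_mat m m" and k: "k < m" and d: "d \<noteq> 0" and det: "Determinant.det A = d"
    and ent: "\<And>i j. i < m \<Longrightarrow> j < m \<Longrightarrow> A $$ (i, j) = (if i = j then (if i = k then d else 1) else 0)"
  shows "scales_volume m A"
  unfolding scales_volume_def
proof
  fix f :: "(nat \<Rightarrow> complex) \<Rightarrow> ennreal" assume f[measurable]: "f \<in> borel_measurable (vol_e m)"
  have eq: "lin_map m A (x(k := y)) = x(k := d * y)"
    if x: "x \<in> space (PiM ({..<m} - {k}) (\<lambda>_. lborel))" for x y
  proof
    fix i
    have ext: "x i = undefined" if "\<not> i < m" using x that by (auto simp: space_PiM PiE_def extensional_def)
    show "lin_map m A (x(k := y)) i = (x(k := d * y)) i"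
    proof (cases "i < m")
      case True
      have "(\<Sum>j<m. A $$ (i, j) * (x(k := y)) j)
         = (\<Sum>j<m. if j = i then (if i = k then d * y else x i) else 0)"
        using True by (intro sum.cong refl) (auto simp: ent)
      then show ?thesis using True by (simp add: lin_map_def)
    qed (use k ext in \<open>auto simp: lin_map_def\<close>)
  qed
  let ?P = "PiM ({..<m} - {k}) (\<lambda>_. lborel :: complex measure)"
  have ins: "insert k ({..<m} - {k}) = {..<m}" using k by auto
  have up: "(\<lambda>p. (fst p)(k := c * snd p)) \<in> ?P \<Otimes>\<^sub>M lborel \<rightarrow>\<^sub>M vol_e m" for c :: complex
  proof -
    have "(\<lambda>p. (fst p)(k := c * snd p)) \<in> ?P \<Otimes>\<^sub>M lborel \<rightarrow>\<^sub>M PiM (insert k ({..<m} - {k})) (\<lambda>_. lborel)"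
      by (rule measurable_fun_upd[where J="{..<m} - {k}"]) auto
    then show ?thesis unfolding ins vol_e_def .
  qed
  have [measurable]: "(\<lambda>x. \<integral>\<^sup>+y. f (x(k := d * y)) \<partial>lborel) \<in> borel_measurable ?P"
    by (rule lborel.borel_measurable_nn_integral)
      (use measurable_compose[OF up[of d] f] in \<open>simp add: case_prod_beta'\<close>)
  have "(\<integral>\<^sup>+z. f z \<partial>vol_e m) = (\<integral>\<^sup>+x. \<integral>\<^sup>+y. f (x(k := y)) \<partial>lborel \<partial>?P)"
    by (rule vol_e_insert) (use k in auto)
  also have "\<dots> = (\<integral>\<^sup>+x. ennreal ((cmod d)\<^sup>2) * (\<integral>\<^sup>+y. f (x(k := d * y)) \<partial>lborel) \<partial>?P)"
    by (intro nn_integral_cong nn_integral_complex_scale measurable_upd_vol_e[OF k f] d)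
  also have "\<dots> = ennreal ((cmod d)\<^sup>2) * (\<integral>\<^sup>+x. \<integral>\<^sup>+y. f (x(k := d * y)) \<partial>lborel \<partial>?P)"
    by (rule nn_integral_cmult) measurable
  also have "(\<integral>\<^sup>+x. \<integral>\<^sup>+y. f (x(k := d * y)) \<partial>lborel \<partial>?P) = (\<integral>\<^sup>+x. \<integral>\<^sup>+y. f (lin_map m A (x(k := y))) \<partial>lborel \<partial>?P)"
    by (intro nn_integral_cong) (simp add: eq)
  also have "\<dots> = (\<integral>\<^sup>+z. f (lin_map m A z) \<partial>vol_e m)"
    by (rule vol_e_insert[symmetric]) (use k in auto)
  finally show "(\<integral>\<^sup>+z. f z \<partial>vol_e m) = ennreal ((cmod (Determinant.det A))\<^sup>2)
      * (\<integral>\<^sup>+z. f (lin_map m A z) \<partial>vol_e m)"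
    by (simp add: det)
qed

text \<open>The invariant of the elimination: the first j columns are already those of the identity,
  and the matrix is still invertible.\<close>

definition unit_cols :: "nat \<Rightarrow> nat \<Rightarrow> complex mat \<Rightarrow> bool" where
  "unit_cols m j A \<longleftrightarrow> A \<in> carrier_mat m m \<and> Determinant.det A \<noteq> 0 \<and>
     (\<forall>c<j. \<forall>i<m. A $$ (i, c) = (if i = c then 1 else 0))"

lemma unit_cols_addrow:
  assumes "unit_cols m j A" "k < m" "l < m" "k \<noteq> l" "j \<le> l"
  shows "unit_cols m j (addrow a k l A)"
  using assms by (auto simp: unit_cols_def det_addrow)

text \<open>Otherwise column j would be a combination of the preceding unit columns, and the vector
  \<open>v\<close> recording this relation would lie in the kernel.\<close>

lemma unit_cols_pivot_exists:
  assumes A: "unit_cols m j A" and j: "j < m"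
  shows "\<exists>i<m. j \<le> i \<and> A $$ (i, j) \<noteq> 0"
proof (rule ccontr)
  assume "\<not> ?thesis"
  then have z: "A $$ (i, j) = 0" if "i < m" "j \<le> i" for i using that by auto
  have c: "A \<in> carrier_mat m m" and d: "Determinant.det A \<noteq> 0"
    and u: "\<And>c i. c < j \<Longrightarrow> i < m \<Longrightarrow> A $$ (i, c) = (if i = c then 1 else 0)"
    using A by (auto simp: unit_cols_def)
  define v where "v = vec m (\<lambda>l. if l < j then - A $$ (l, j) else if l = j then 1 else 0)"
  have v0: "v \<noteq> 0\<^sub>v m"
  proof
    assume "v = 0\<^sub>v m"
    then have "v $ j = 0\<^sub>v m $ j" by simp
    then show False using j by (simp add: v_def)
  qed
  have "A *\<^sub>v v = 0\<^sub>v m"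
  proof (rule eq_vecI)
    fix i assume "i < dim_vec (0\<^sub>v m :: complex vec)"
    then have i: "i < m" by simp
    have "(A *\<^sub>v v) $ i = (\<Sum>l<m. A $$ (i, l) * v $ l)"
      using c i by (auto simp: mult_mat_vec_def scalar_prod_def atLeast0LessThan v_def)
    also have "\<dots> = (\<Sum>l<m. (if l = j then A $$ (i, j) else 0) + (if l = i then (if i < j then - A $$ (i, j) else 0) else 0))"
      using i j by (intro sum.cong refl) (auto simp: v_def u)
    also have "\<dots> = 0" using i j z[of i] by (auto simp: sum.distrib)
    finally show "(A *\<^sub>v v) $ i = 0\<^sub>v m $ i" using i by simp
  qed (use c in auto)
  moreover have "v \<in> carrier_vec m" by (simp add: v_def)
  ultimately show False using d v0 det_0_iff_vec_prod_zero[OF c] by blast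
qed

text \<open>Downward induction on the number of finished columns, using row additions only. Rows
  cannot be rescaled, so each pivot before the last is made equal to 1 by adding a multiple of a
  lower row; the last pivot keeps its value.\<close>

lemma scales_volume_unit_cols:
  assumes "unit_cols m j A" "j \<le> m"
  shows "scales_volume m A"
  using assms(2,1)
proof (induction j arbitrary: A rule: inc_induct)
  case base
  then have c: "A \<in> carrier_mat m m" and
    u: "\<And>c i. c < m \<Longrightarrow> i < m \<Longrightarrow> A $$ (i, c) = (if i = c then 1 else 0)"
    by (auto simp: unit_cols_def)
  have A1: "A = 1\<^sub>m m" using c by (intro eq_matI) (auto simp: u)
  have "lin_map m A z = z" if "z \<in> space (vol_e m)" for z
  proof
    fix i show "lin_map m A z i = z i"
      using that by (cases "i < m") (auto simp: A1 lin_map_def vol_e_def space_PiM PiE_def extensional_def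
        if_distrib[of "\<lambda>x. x * _"] cong: if_cong)
  qed
  then have "(\<integral>\<^sup>+z. f (lin_map m A z) \<partial>vol_e m) = (\<integral>\<^sup>+z. f z \<partial>vol_e m)" for f :: "_ \<Rightarrow> ennreal"
    by (intro nn_integral_cong) simp
  then show ?case by (simp add: scales_volume_def A1)
next
  case (step j)
  \<comment> \<open>Once the pivot is usable, the other entries of column j are cleared one at a
    time, by induction on how many of them are nonzero.\<close>
  have pivot: "scales_volume m B" if "unit_cols m j B" "B $$ (j, j) \<noteq> 0" "Suc j = m \<or> B $$ (j, j) = 1" for B
    using that
  proof (induction "card {i. i < m \<and> i \<noteq> j \<and> B $$ (i, j) \<noteq> 0}" arbitrary: B)
    case 0
    then have z: "B $$ (i, j) = 0" if "i < m" "i \<noteq> j" for i using that by auto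
    have c: "B \<in> carrier_mat m m" and d: "Determinant.det B \<noteq> 0"
      and u: "\<And>c i. c < j \<Longrightarrow> i < m \<Longrightarrow> B $$ (i, c) = (if i = c then 1 else 0)"
      using 0(2) by (auto simp: unit_cols_def)
    show ?case
    proof (cases "B $$ (j, j) = 1")
      case True
      then have "unit_cols m (Suc j) B" using c d u z by (auto simp: unit_cols_def less_Suc_eq)
      then show ?thesis by (rule step.IH)
    next
      case False
      then have m: "m = Suc j" using 0 by auto
      have ent: "B $$ (i, l) = (if i = l then (if i = j then B $$ (j, j) else 1) else 0)" if "i < m" "l < m" for i l
        using that u[of l i] z[of i] m by (auto simp: less_Suc_eq)
      have "upper_triangular B" using c by (auto simp: upper_triangular_def ent)
      then have "Determinant.det B = prod_list (diag_mat B)" using c by (rule det_upper_triangular)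
      also have "\<dots> = (\<Prod>i<m. B $$ (i, i))" using c by (simp add: prod_list_diag_prod atLeast0LessThan)
      also have "\<dots> = (\<Prod>i<m. if i = j then B $$ (j, j) else 1)" by (intro prod.cong) (auto simp: ent)
      also have "\<dots> = B $$ (j, j)" using m by simp
      finally have det: "Determinant.det B = B $$ (j, j)" .
      show ?thesis by (rule scales_volume_diag_last[OF c _ 0(3) det ent]) (use m in simp)
    qed
  next
    case (Suc x)
    have "{i. i < m \<and> i \<noteq> j \<and> B $$ (i, j) \<noteq> 0} \<noteq> {}" (is "?S \<noteq> _")
    proof
      assume "?S = {}"
      then have "card ?S = 0" by (simp only: card.empty)
      with Suc(2) show False by linarith
    qed
    then obtain i where i: "i < m" "i \<noteq> j" "B $$ (i, j) \<noteq> 0" by blast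
    define a where "a = - (B $$ (i, j) / B $$ (j, j))"
    let ?B = "addrow a i j B"
    have c: "B \<in> carrier_mat m m" using Suc(3) by (auto simp: unit_cols_def)
    have jm: "j < m" using step.hyps by simp
    have uB: "unit_cols m j ?B" using Suc(3) i jm by (intro unit_cols_addrow) auto
    have e: "?B $$ (p, j) = (if p = i then 0 else B $$ (p, j))" if "p < m" for p
      using that c i jm Suc(4) by (auto simp: a_def)
    have "{p. p < m \<and> p \<noteq> j \<and> ?B $$ (p, j) \<noteq> 0} = {p. p < m \<and> p \<noteq> j \<and> B $$ (p, j) \<noteq> 0} - {i}"
      using e by (auto split: if_splits)
    then have "x = card {p. p < m \<and> p \<noteq> j \<and> ?B $$ (p, j) \<noteq> 0}"
      using Suc(2) i by simp
    then have "scales_volume m ?B"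
      by (rule Suc(1)) (use uB e[OF jm] i Suc(4,5) in \<open>simp_all del: index_mat_addrow\<close>)
    then show ?case by (rule scales_volume_from_addrow[rotated -1]) (use c i jm in auto)
  qed
  \<comment> \<open>A nonzero entry below the diagonal supplies the multiplier (1 - B_jj) / B_ij
    that turns the pivot into 1.\<close>
  have pivot1: "scales_volume m B" if B: "unit_cols m j B" and i: "i < m" "j < i" "B $$ (i, j) \<noteq> 0" for B i
  proof -
    define a where "a = (1 - B $$ (j, j)) / B $$ (i, j)"
    have c: "B \<in> carrier_mat m m" using B by (auto simp: unit_cols_def)
    have jm: "j < m" using step.hyps by simp
    have "addrow a j i B $$ (j, j) = 1" using c jm i by (auto simp: a_def)
    then have "scales_volume m (addrow a j i B)"
      using B i jm by (intro pivot unit_cols_addrow) auto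
    then show ?thesis by (rule scales_volume_from_addrow[rotated -1]) (use c i jm in auto)
  qed
  show ?case
  proof (cases "\<exists>i<m. j < i \<and> A $$ (i, j) \<noteq> 0")
    case True
    then show ?thesis using pivot1 step.prems by blast
  next
    case False
    then have jj: "A $$ (j, j) \<noteq> 0"
      using unit_cols_pivot_exists[OF step.prems step.hyps(2)] by (metis le_neq_implies_less)
    show ?thesis
    proof (cases "Suc j = m")
      case True
      then show ?thesis using pivot step.prems jj by blast
    next
      case False
      then have jm: "Suc j < m" "j < m" using step.hyps by auto
      have c: "A \<in> carrier_mat m m" using step.prems by (auto simp: unit_cols_def)
      have "A $$ (Suc j, j) = 0" using \<open>\<not> (\<exists>i<m. j < i \<and> A $$ (i, j) \<noteq> 0)\<close> jm by auto
      \<comment> \<open>If everything below the diagonal vanishes, adding row j to the next row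
        creates the nonzero entry that \<open>pivot1\<close> asks for.\<close>
      then have "addrow 1 (Suc j) j A $$ (Suc j, j) \<noteq> 0" using c jm jj by auto
      then have "scales_volume m (addrow 1 (Suc j) j A)"
        using step.prems jm by (intro pivot1[where i="Suc j"] unit_cols_addrow) auto
      then show ?thesis by (rule scales_volume_from_addrow[rotated -1]) (use c jm in auto)
    qed
  qed
qed

theorem scales_volume:
  assumes "A \<in> carrier_mat m m" "Determinant.det A \<noteq> 0"
  shows "scales_volume m A"
  by (rule scales_volume_unit_cols[of m 0]) (use assms in \<open>auto simp: unit_cols_def\<close>)

section \<open>The invariant measure of the ball\<close>

lemma nn_integral_lin_map:
  assumes "A \<in> carrier_mat m m" "Determinant.det A \<noteq> 0" "f \<in> borel_measurable (vol_e m)"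
  shows "(\<integral>\<^sup>+z. f z \<partial>vol_e m) = ennreal ((cmod (Determinant.det A))\<^sup>2) * (\<integral>\<^sup>+z. f (lin_map m A z) \<partial>vol_e m)"
  using scales_volume[OF assms(1,2)] assms(3) unfolding scales_volume_def by blast

definition nsq :: "nat \<Rightarrow> (nat \<Rightarrow> complex) \<Rightarrow> real" where
  "nsq n z = (\<Sum>j<n. (cmod (z j))\<^sup>2)"

lemma nsq_nonneg [simp]: "0 \<le> nsq n z"
  by (simp add: nsq_def sum_nonneg)

lemma nsq_measurable [measurable]: "nsq n \<in> borel_measurable (vol_e n)"
  unfolding nsq_def vol_e_def by measurable

lemma space_vol_e: "space (vol_e n) = cpts n"
  by (simp add: vol_e_def space_PiM cpts_def)

lemma ball_n_alt: "ball_n n = {z \<in> space (vol_e n). nsq n z < 1}"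
  by (simp add: ball_n_def space_vol_e nsq_def)

lemma ball_n_measurable [measurable]: "ball_n n \<in> sets (vol_e n)"
  unfolding ball_n_alt by measurable

lemma sigma_finite_vol_e: "sigma_finite_measure (vol_e n)"
  unfolding vol_e_def by (rule cprod.sigma_finite) simp

lemma nn_integral_vol_e_scale:
  assumes f: "f \<in> borel_measurable (vol_e n)" and c: "c \<noteq> 0"
  shows "(\<integral>\<^sup>+z. f z \<partial>vol_e n) = ennreal ((cmod c) ^ (2 * n)) * (\<integral>\<^sup>+z. f (\<lambda>i\<in>{..<n}. c * z i) \<partial>vol_e n)"
proof -
  let ?A = "c \<cdot>\<^sub>m 1\<^sub>m n"
  have d: "Determinant.det ?A = c ^ n" by (simp add: det_smult)
  have l: "lin_map n ?A z = (\<lambda>i\<in>{..<n}. c * z i)" for z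
    unfolding lin_map_def by (rule restrict_ext) (auto simp: if_distrib[of "\<lambda>x. c * x * _"] cong: if_cong)
  have "(\<integral>\<^sup>+z. f z \<partial>vol_e n) = ennreal ((cmod (c ^ n))\<^sup>2) * (\<integral>\<^sup>+z. f (\<lambda>i\<in>{..<n}. c * z i) \<partial>vol_e n)"
    using nn_integral_lin_map[of ?A n f] f c unfolding l d by simp
  also have "(cmod (c ^ n))\<^sup>2 = (cmod c) ^ (2 * n)"
    by (simp add: norm_power power_mult[symmetric] mult.commute)
  finally show ?thesis .
qed

text \<open>The invariant volume dV without its constant n! / pi^n. The indicator is needed because
  \<open>vol_e\<close> lives on all of C^n; the constant returns in \<open>pet_ip_eq\<close> as
  \<open>k0\<close>.\<close>

definition hyp_vol :: "nat \<Rightarrow> (nat \<Rightarrow> complex) measure" where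
  "hyp_vol n = density (vol_e n) (\<lambda>z. indicator (ball_n n) z * ennreal (inverse (1 - nsq n z) ^ (n+1)))"

lemma sets_hyp_vol [simp, measurable_cong]: "sets (hyp_vol n) = sets (vol_e n)"
  by (simp add: hyp_vol_def)

lemma space_hyp_vol [simp]: "space (hyp_vol n) = cpts n"
  by (simp add: hyp_vol_def space_vol_e)

lemma nn_integral_hyp_vol:
  assumes [measurable]: "f \<in> borel_measurable (vol_e n)"
  shows "(\<integral>\<^sup>+z. f z \<partial>hyp_vol n)
     = (\<integral>\<^sup>+z. indicator (ball_n n) z * ennreal (inverse (1 - nsq n z) ^ (n+1)) * f z \<partial>vol_e n)"
  unfolding hyp_vol_def by (subst nn_integral_density) auto

section \<open>The negative cone over the ball\<close>

definition cone_proj :: "nat \<Rightarrow> (nat \<Rightarrow> complex) \<Rightarrow> nat \<Rightarrow> complex" where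
  "cone_proj n Z = (\<lambda>i\<in>{..<n}. Z i / Z n)"

definition cone_q :: "nat \<Rightarrow> (nat \<Rightarrow> complex) \<Rightarrow> real" where
  "cone_q n Z = (cmod (Z n))\<^sup>2 - nsq n Z"

lemma cone_proj_measurable [measurable]: "cone_proj n \<in> vol_e (Suc n) \<rightarrow>\<^sub>M vol_e n"
  unfolding cone_proj_def vol_e_def by measurable

lemma cone_q_measurable [measurable]: "cone_q n \<in> borel_measurable (vol_e (Suc n))"
  unfolding cone_q_def nsq_def vol_e_def by measurable

text \<open>The integral over the fibre above the origin. Only its lying strictly between 0 and
  infinity matters, since it is cancelled in \<open>hyp_vol_mob\<close>.\<close>

definition cone_const :: "nat \<Rightarrow> ennreal" where
  "cone_const n = (\<integral>\<^sup>+\<zeta>. ennreal ((cmod \<zeta>) ^ (2 * n)) * indicator {1..4} ((cmod \<zeta>)\<^sup>2) \<partial>lborel)"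

lemma cone_const_pos: "cone_const n \<noteq> 0"
proof
  assume 0: "cone_const n = 0"
  \<comment> \<open>The disc of radius 1/2 about 3/2 lies in the annulus between the radii 1 and 2,
    where the integrand is at least 1.\<close>
  have "0 < emeasure lborel (ball (3/2::complex) (1/2))"
    by (simp add: emeasure_ball)
  also have "\<dots> = (\<integral>\<^sup>+\<zeta>. indicator (ball (3/2::complex) (1/2)) \<zeta> \<partial>lborel)" by simp
  also have "\<dots> \<le> cone_const n"
    unfolding cone_const_def
  proof (rule nn_integral_mono)
    fix z :: complex
    show "indicator (ball (3/2) (1/2)) z \<le> ennreal ((cmod z) ^ (2 * n)) * indicator {1..4} ((cmod z)\<^sup>2)"
    proof (cases "z \<in> ball (3/2) (1/2)")
      case True
      then have d: "cmod (3/2 - z) < 1/2" by (simp add: dist_norm)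
      have "cmod (3/2) \<le> cmod (3/2 - z) + cmod z" by (metis diff_add_cancel norm_triangle_ineq)
      then have "1 \<le> cmod z" using d by simp
      moreover have "cmod z \<le> cmod (3/2 - z) + cmod (3/2)"
        by (metis norm_minus_commute norm_triangle_sub add.commute)
      then have "cmod z \<le> 2" using d by simp
      then have "(cmod z)\<^sup>2 \<le> 2\<^sup>2" by (intro power_mono) auto
      ultimately show ?thesis using True
        by (auto simp: indicator_def one_le_power)
    qed simp
  qed
  finally show False using 0 by simp
qed

lemma cone_const_finite: "cone_const n \<noteq> \<infinity>"
proof -
  have "cone_const n \<le> (\<integral>\<^sup>+\<zeta>. ennreal (2 ^ (2 * n)) * indicator (cball (0::complex) 2) \<zeta> \<partial>lborel)"
    unfolding cone_const_def
  proof (rule nn_integral_mono)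
    fix z :: complex
    show "ennreal ((cmod z) ^ (2 * n)) * indicator {1..4} ((cmod z)\<^sup>2) \<le> ennreal (2 ^ (2 * n)) * indicator (cball (0::complex) 2) z"
    proof (cases "(cmod z)\<^sup>2 \<in> {1..4}")
      case True
      then have "(cmod z)\<^sup>2 \<le> 2\<^sup>2" by auto
      then have "cmod z \<le> 2" by (rule power2_le_imp_le) simp
      then show ?thesis by (auto intro!: ennreal_leI power_mono mult_mono simp: indicator_def)
    qed simp
  qed
  also have "\<dots> = ennreal (2 ^ (2 * n)) * emeasure lborel (cball (0::complex) 2)"
    by (subst nn_integral_cmult_indicator) auto
  also have "\<dots> < \<infinity>"
    using emeasure_compact_finite[of "cball (0::complex) 2"] by (simp add: ennreal_mult_less_top)
  finally show ?thesis by simp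
qed

text \<open>Integrating a function of \<open>Z'/Z\<^sub>n\<close> over the shell \<open>1 \<le> |Z\<^sub>n|\<^sup>2 - |Z'|\<^sup>2 \<le> 4\<close> of the negative cone
  yields the hyperbolic integral. Hence invariance of the hyperbolic measure
  under fractional-linear maps follows from the behaviour of Lebesgue measure under linear maps.\<close>

lemma cone_integral:
  assumes f[measurable]: "f \<in> borel_measurable (vol_e n)"
  shows "(\<integral>\<^sup>+Z. indicator {1..4} (cone_q n Z) * f (cone_proj n Z) \<partial>vol_e (Suc n))
    = cone_const n * (\<integral>\<^sup>+z. f z \<partial>hyp_vol n)"
proof -
  interpret sf: sigma_finite_measure "vol_e n" by (rule sigma_finite_vol_e)
  interpret ps: pair_sigma_finite "lborel :: complex measure" "vol_e n" ..
  let ?\<Psi> = "\<lambda>Z. indicator {1..4} (cone_q n Z) * f (cone_proj n Z) :: ennreal"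
  let ?r = "\<lambda>z. 1 - nsq n z"
  have [measurable]: "?\<Psi> \<in> borel_measurable (vol_e (Suc n))" by measurable
  have "(\<integral>\<^sup>+Z. ?\<Psi> Z \<partial>vol_e (Suc n)) = (\<integral>\<^sup>+\<zeta>. \<integral>\<^sup>+x. ?\<Psi> (x(n := \<zeta>)) \<partial>vol_e n \<partial>lborel)"
    using cprod.product_nn_integral_insert_rev[of "{..<n}" n ?\<Psi>] \<open>?\<Psi> \<in> _\<close>
    by (simp add: vol_e_def lessThan_Suc)
  also have "\<dots> = (\<integral>\<^sup>+\<zeta>. \<integral>\<^sup>+z. ennreal ((cmod \<zeta>) ^ (2 * n)) * indicator {1..4} ((cmod \<zeta>)\<^sup>2 * ?r z) * f z \<partial>vol_e n \<partial>lborel)"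
  proof (rule nn_integral_cong)
    fix \<zeta> :: complex
    show "(\<integral>\<^sup>+x. ?\<Psi> (x(n := \<zeta>)) \<partial>vol_e n) = (\<integral>\<^sup>+z. ennreal ((cmod \<zeta>) ^ (2 * n)) * indicator {1..4} ((cmod \<zeta>)\<^sup>2 * ?r z) * f z \<partial>vol_e n)"
    proof (cases "\<zeta> = 0")
      case True
      have "cone_q n (x(n := \<zeta>)) \<le> 0" for x using True nsq_nonneg[of n "x(n := \<zeta>)"] by (simp add: cone_q_def)
      then have z: "indicator {1..4} (cone_q n (x(n := \<zeta>))) = (0::ennreal)" for x
        by (metis (no_types, lifting) atLeastAtMost_iff indicator_simps(2) le_numeral_extra(2) order_trans)
      show ?thesis unfolding z using True by simp
    next
      case False
      have q: "cone_q n (x(n := \<zeta>)) = (cmod \<zeta>)\<^sup>2 - nsq n x" for x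
        by (simp add: cone_q_def nsq_def)
      have p: "cone_proj n (x(n := \<zeta>)) = (\<lambda>i\<in>{..<n}. x i / \<zeta>)" for x
        by (auto simp: cone_proj_def)
      have "(\<integral>\<^sup>+x. ?\<Psi> (x(n := \<zeta>)) \<partial>vol_e n)
          = (\<integral>\<^sup>+x. indicator {1..4} ((cmod \<zeta>)\<^sup>2 - nsq n x) * f (\<lambda>i\<in>{..<n}. x i / \<zeta>) \<partial>vol_e n)"
        by (simp add: q p)
      \<comment> \<open>For fixed nonzero last coordinate the other n coordinates are rescaled to
        affine ones; this is the source of the power 2n.\<close>
      also have "\<dots> = ennreal ((cmod \<zeta>) ^ (2 * n)) * (\<integral>\<^sup>+x. indicator {1..4} ((cmod \<zeta>)\<^sup>2 - nsq n (\<lambda>i\<in>{..<n}. \<zeta> * x i))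
           * f (\<lambda>i\<in>{..<n}. (\<lambda>i\<in>{..<n}. \<zeta> * x i) i / \<zeta>) \<partial>vol_e n)"
      proof (rule nn_integral_vol_e_scale[OF _ False])
        have [measurable]: "(\<lambda>x. \<lambda>i\<in>{..<n}. x i / \<zeta>) \<in> vol_e n \<rightarrow>\<^sub>M vol_e n"
          unfolding vol_e_def by measurable
        show "(\<lambda>x. indicator {1..4} ((cmod \<zeta>)\<^sup>2 - nsq n x) * f (\<lambda>i\<in>{..<n}. x i / \<zeta>)) \<in> borel_measurable (vol_e n)"
          by measurable
      qed
      also have "(\<integral>\<^sup>+x. indicator {1..4} ((cmod \<zeta>)\<^sup>2 - nsq n (\<lambda>i\<in>{..<n}. \<zeta> * x i))
           * f (\<lambda>i\<in>{..<n}. (\<lambda>i\<in>{..<n}. \<zeta> * x i) i / \<zeta>) \<partial>vol_e n)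
          = (\<integral>\<^sup>+x. indicator {1..4} ((cmod \<zeta>)\<^sup>2 * ?r x) * f x \<partial>vol_e n)"
      proof (rule nn_integral_cong)
        fix x assume x: "x \<in> space (vol_e n)"
        have 1: "(cmod \<zeta>)\<^sup>2 - nsq n (\<lambda>i\<in>{..<n}. \<zeta> * x i) = (cmod \<zeta>)\<^sup>2 * ?r x"
          by (simp add: nsq_def norm_mult power_mult_distrib sum_distrib_left algebra_simps)
        have 2: "(\<lambda>i\<in>{..<n}. (\<lambda>i\<in>{..<n}. \<zeta> * x i) i / \<zeta>) = x"
          using x False by (auto simp: space_vol_e cpts_def PiE_def extensional_def)
        show "indicator {1..4} ((cmod \<zeta>)\<^sup>2 - nsq n (\<lambda>i\<in>{..<n}. \<zeta> * x i))
           * f (\<lambda>i\<in>{..<n}. (\<lambda>i\<in>{..<n}. \<zeta> * x i) i / \<zeta>) = indicator {1..4} ((cmod \<zeta>)\<^sup>2 * ?r x) * f x"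
          unfolding 1 2 ..
      qed
      also have "ennreal ((cmod \<zeta>) ^ (2 * n)) * \<dots> = (\<integral>\<^sup>+z. ennreal ((cmod \<zeta>) ^ (2 * n)) * (indicator {1..4} ((cmod \<zeta>)\<^sup>2 * ?r z) * f z) \<partial>vol_e n)"
        by (rule nn_integral_cmult[symmetric]) measurable
      finally show ?thesis by (simp only: mult.assoc)
    qed
  qed
  also have "\<dots> = (\<integral>\<^sup>+z. \<integral>\<^sup>+\<zeta>. ennreal ((cmod \<zeta>) ^ (2 * n)) * indicator {1..4} ((cmod \<zeta>)\<^sup>2 * ?r z) * f z \<partial>lborel \<partial>vol_e n)"
    by (rule ps.Fubini'[symmetric]) measurable
  also have "\<dots> = (\<integral>\<^sup>+z. cone_const n * (indicator (ball_n n) z * ennreal (inverse (?r z) ^ (n+1)) * f z) \<partial>vol_e n)"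
  proof (rule nn_integral_cong)
    fix z assume z: "z \<in> space (vol_e n)"
    have "(\<integral>\<^sup>+\<zeta>. ennreal ((cmod \<zeta>) ^ (2 * n)) * indicator {1..4} ((cmod \<zeta>)\<^sup>2 * ?r z) * f z \<partial>lborel)
       = (\<integral>\<^sup>+\<zeta>. ennreal ((cmod \<zeta>) ^ (2 * n)) * indicator {1..4} ((cmod \<zeta>)\<^sup>2 * ?r z) \<partial>lborel) * f z"
      by (rule nn_integral_multc) measurable
    also have "(\<integral>\<^sup>+\<zeta>. ennreal ((cmod \<zeta>) ^ (2 * n)) * indicator {1..4} ((cmod \<zeta>)\<^sup>2 * ?r z) \<partial>lborel)
       = cone_const n * (indicator (ball_n n) z * ennreal (inverse (?r z) ^ (n+1)))"
    proof (cases "z \<in> ball_n n")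
      case True
      then have r: "0 < ?r z" by (simp add: ball_n_alt)
      \<comment> \<open>Rescaling the fibre by sqrt (1 - |z|^2) carries the shell condition at z to
        the one at the origin. It costs |c|^2 from the measure and |c|^(2n) from the integrand,
        together (1 - |z|^2)^(n+1), the reciprocal of the density.\<close>
      define c where "c = complex_of_real (sqrt (?r z))"
      have c2: "(cmod c)\<^sup>2 = ?r z" and c0: "c \<noteq> 0" using r by (auto simp: c_def)
      let ?I = "(\<integral>\<^sup>+\<zeta>. ennreal ((cmod \<zeta>) ^ (2 * n)) * indicator {1..4} ((cmod \<zeta>)\<^sup>2 * ?r z) \<partial>lborel)"
      have "cone_const n = ennreal ((cmod c)\<^sup>2) * (\<integral>\<^sup>+\<zeta>. ennreal ((cmod (c * \<zeta>)) ^ (2 * n)) * indicator {1..4} ((cmod (c * \<zeta>))\<^sup>2) \<partial>lborel)"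
        unfolding cone_const_def by (rule nn_integral_complex_scale[OF _ c0]) measurable
      also have "(\<integral>\<^sup>+\<zeta>. ennreal ((cmod (c * \<zeta>)) ^ (2 * n)) * indicator {1..4} ((cmod (c * \<zeta>))\<^sup>2) \<partial>lborel)
         = (\<integral>\<^sup>+\<zeta>. ennreal (?r z ^ n) * (ennreal ((cmod \<zeta>) ^ (2 * n)) * indicator {1..4} ((cmod \<zeta>)\<^sup>2 * ?r z)) \<partial>lborel)"
      proof (rule nn_integral_cong)
        fix \<zeta> :: complex
        have 1: "(cmod (c * \<zeta>)) ^ (2 * n) = ?r z ^ n * (cmod \<zeta>) ^ (2 * n)"
          unfolding norm_mult power_mult_distrib power_mult c2 ..
        have 2: "(cmod (c * \<zeta>))\<^sup>2 = (cmod \<zeta>)\<^sup>2 * ?r z"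
          unfolding norm_mult power_mult_distrib c2 by simp
        show "ennreal ((cmod (c * \<zeta>)) ^ (2 * n)) * indicator {1..4} ((cmod (c * \<zeta>))\<^sup>2)
           = ennreal (?r z ^ n) * (ennreal ((cmod \<zeta>) ^ (2 * n)) * indicator {1..4} ((cmod \<zeta>)\<^sup>2 * ?r z))"
          unfolding 1 2 using r by (simp add: ennreal_mult mult.assoc)
      qed
      also have "\<dots> = ennreal (?r z ^ n) * ?I" by (rule nn_integral_cmult) measurable
      finally have "cone_const n = ennreal (?r z ^ (n+1)) * ?I"
        using r by (simp add: c2 mult.assoc[symmetric] ennreal_mult[symmetric])
      then have "cone_const n * ennreal (inverse (?r z) ^ (n+1)) = (ennreal (?r z ^ (n+1)) * ennreal (inverse (?r z) ^ (n+1))) * ?I"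
        by (simp only: ac_simps)
      also have "ennreal (?r z ^ (n+1)) * ennreal (inverse (?r z) ^ (n+1)) = 1"
        using r by (subst ennreal_mult[symmetric]) (auto simp del: power_Suc simp: power_mult_distrib[symmetric] ennreal_1)
      finally show ?thesis using True by simp
    next
      case False
      then have r: "?r z \<le> 0" using z by (simp add: ball_n_alt)
      then have le: "(cmod \<zeta>)\<^sup>2 * ?r z \<le> 0" for \<zeta> by (intro mult_nonneg_nonpos) auto
      have "indicator {1..4} ((cmod \<zeta>)\<^sup>2 * ?r z) = (0::ennreal)" for \<zeta>
        using le[of \<zeta>] by (auto simp: indicator_def)
      then show ?thesis using False by simp
    qed
    finally show "(\<integral>\<^sup>+\<zeta>. ennreal ((cmod \<zeta>) ^ (2 * n)) * indicator {1..4} ((cmod \<zeta>)\<^sup>2 * ?r z) * f z \<partial>lborel)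
      = cone_const n * (indicator (ball_n n) z * ennreal (inverse (?r z) ^ (n+1)) * f z)"
      by (simp add: mult.assoc)
  qed
  also have "\<dots> = cone_const n * (\<integral>\<^sup>+z. f z \<partial>hyp_vol n)"
    unfolding nn_integral_hyp_vol[OF f] by (rule nn_integral_cmult) measurable
  finally show ?thesis .
qed

text \<open>The determinant is only required to have modulus 1, so that the rotations and
  reflections used as auxiliary isometries belong to the group.\<close>

definition U_n1 :: "nat \<Rightarrow> complex mat set" where
  "U_n1 n = {A \<in> carrier_mat (n+1) (n+1). cmod (Determinant.det A) = 1 \<and>
      (\<forall>u \<in> carrier_vec (n+1). \<forall>v \<in> carrier_vec (n+1). hform n (A *\<^sub>v u) (A *\<^sub>v v) = hform n u v)}"

lemma SU_n1_subset_U_n1: "SU_n1 n \<subseteq> U_n1 n"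
  by (auto simp: SU_n1_def U_n1_def)

lemma U_n1_carrier: "A \<in> U_n1 n \<Longrightarrow> A \<in> carrier_mat (n+1) (n+1)"
  by (simp add: U_n1_def)

lemma U_n1_hform:
  "A \<in> U_n1 n \<Longrightarrow> u \<in> carrier_vec (n+1) \<Longrightarrow> v \<in> carrier_vec (n+1) \<Longrightarrow> hform n (A *\<^sub>v u) (A *\<^sub>v v) = hform n u v"
  by (simp add: U_n1_def)

lemma mob_measurable [measurable]: "mob n A \<in> vol_e n \<rightarrow>\<^sub>M vol_e n"
  unfolding mob_def denom_def vol_e_def by measurable

lemma mult_mat_vec_lin_map:
  assumes "A \<in> carrier_mat m m"
  shows "A *\<^sub>v vec m Z = vec m (lin_map m A Z)"
  using assms by (intro eq_vecI) (auto simp: lin_map_def mult_mat_vec_def scalar_prod_def atLeast0LessThan)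

lemma cone_q_hform: "complex_of_real (cone_q n Z) = - hform n (vec (n+1) Z) (vec (n+1) Z)"
  by (simp add: cone_q_def nsq_def hform_def complex_norm_square[symmetric])

lemma cone_q_lin_map:
  assumes "A \<in> U_n1 n"
  shows "cone_q n (lin_map (Suc n) A Z) = cone_q n Z"
proof -
  have "complex_of_real (cone_q n (lin_map (Suc n) A Z)) = complex_of_real (cone_q n Z)"
  proof -
    have "hform n (A *\<^sub>v vec (n+1) Z) (A *\<^sub>v vec (n+1) Z) = hform n (vec (n+1) Z) (vec (n+1) Z)"
      using assms by (rule U_n1_hform) auto
    moreover have "A *\<^sub>v vec (n+1) Z = vec (n+1) (lin_map (Suc n) A Z)"
      using assms by (simp add: mult_mat_vec_lin_map U_n1_def)
    ultimately show ?thesis unfolding cone_q_hform by metis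
  qed
  then show ?thesis by simp
qed

lemma cone_proj_lin_map:
  assumes "Z n \<noteq> 0"
  shows "cone_proj n (lin_map (Suc n) A Z) = mob n A (cone_proj n Z)"
proof
  fix i
  have s: "(\<Sum>l<n. A $$ (j, l) * cone_proj n Z l) + A $$ (j, n) = (\<Sum>l<Suc n. A $$ (j, l) * Z l) / Z n" for j
    using assms by (simp add: cone_proj_def sum_divide_distrib add_divide_distrib)
  show "cone_proj n (lin_map (Suc n) A Z) i = mob n A (cone_proj n Z) i"
    unfolding mob_def denom_def s using assms by (simp add: cone_proj_def lin_map_def)
qed

theorem hyp_vol_mob:
  assumes A: "A \<in> U_n1 n" and f[measurable]: "f \<in> borel_measurable (vol_e n)"
  shows "(\<integral>\<^sup>+z. f (mob n A z) \<partial>hyp_vol n) = (\<integral>\<^sup>+z. f z \<partial>hyp_vol n)"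
proof -
  have c: "A \<in> carrier_mat (Suc n) (Suc n)" and d: "cmod (Determinant.det A) = 1"
    using A by (auto simp: U_n1_def)
  have "(\<integral>\<^sup>+Z. indicator {1..4} (cone_q n Z) * f (cone_proj n Z) \<partial>vol_e (Suc n))
    = (\<integral>\<^sup>+Z. indicator {1..4} (cone_q n (lin_map (Suc n) A Z)) * f (cone_proj n (lin_map (Suc n) A Z)) \<partial>vol_e (Suc n))"
    by (subst nn_integral_lin_map[OF c]) (use d in auto)
  also have "\<dots> = (\<integral>\<^sup>+Z. indicator {1..4} (cone_q n Z) * f (mob n A (cone_proj n Z)) \<partial>vol_e (Suc n))"
  proof (rule nn_integral_cong)
    fix Z
    show "indicator {1..4} (cone_q n (lin_map (Suc n) A Z)) * f (cone_proj n (lin_map (Suc n) A Z))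
       = indicator {1..4} (cone_q n Z) * f (mob n A (cone_proj n Z))"
    proof (cases "Z n = 0")
      \<comment> \<open>On this hyperplane the projection is a division by zero, but it does not
        meet the shell.\<close>
      case True
      then have "cone_q n Z \<le> 0" by (simp add: cone_q_def)
      then have "indicator {1..4} (cone_q n Z) = (0::ennreal)" by (auto simp: indicator_def)
      then show ?thesis by (simp add: cone_q_lin_map[OF A])
    next
      case False
      then show ?thesis by (simp add: cone_q_lin_map[OF A] cone_proj_lin_map)
    qed
  qed
  finally have "cone_const n * (\<integral>\<^sup>+z. f z \<partial>hyp_vol n) = cone_const n * (\<integral>\<^sup>+z. f (mob n A z) \<partial>hyp_vol n)"
    unfolding cone_integral[OF f] cone_integral[OF measurable_compose[OF mob_measurable f]] .
  then show ?thesis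
    using cone_const_pos[of n] cone_const_finite[of n] by (simp add: ennreal_mult_cancel_left)
qed

lemma distr_hyp_vol_mob:
  assumes A: "A \<in> U_n1 n"
  shows "distr (hyp_vol n) (vol_e n) (mob n A) = hyp_vol n"
proof (rule measure_eqI)
  fix S assume "S \<in> sets (distr (hyp_vol n) (vol_e n) (mob n A))"
  then have S[measurable]: "S \<in> sets (vol_e n)" by simp
  have "emeasure (distr (hyp_vol n) (vol_e n) (mob n A)) S = (\<integral>\<^sup>+z. indicator S z \<partial>distr (hyp_vol n) (vol_e n) (mob n A))"
    by simp
  also have "\<dots> = (\<integral>\<^sup>+z. indicator S (mob n A z) \<partial>hyp_vol n)"
    by (rule nn_integral_distr) measurable
  also have "\<dots> = (\<integral>\<^sup>+z. indicator S z \<partial>hyp_vol n)" by (rule hyp_vol_mob[OF A]) measurable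
  finally show "emeasure (distr (hyp_vol n) (vol_e n) (mob n A)) S = emeasure (hyp_vol n) S" by simp
qed simp

section \<open>The Hermitian form and its isometries\<close>

lemma nsq_not_neg [simp]: "\<not> nsq n z < 0"
  by (simp add: not_less)

lemma hform_add_left:
  "u \<in> carrier_vec (n+1) \<Longrightarrow> v \<in> carrier_vec (n+1) \<Longrightarrow> hform n (u + v) w = hform n u w + hform n v w"
  by (simp add: hform_def sum.distrib algebra_simps)

lemma hform_add_right:
  "u \<in> carrier_vec (n+1) \<Longrightarrow> v \<in> carrier_vec (n+1) \<Longrightarrow> hform n w (u + v) = hform n w u + hform n w v"
  by (simp add: hform_def sum.distrib algebra_simps)

lemma hform_smult_left:
  "u \<in> carrier_vec (n+1) \<Longrightarrow> hform n (c \<cdot>\<^sub>v u) w = c * hform n u w"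
  by (simp add: hform_def sum_distrib_left algebra_simps)

lemma hform_smult_right:
  "u \<in> carrier_vec (n+1) \<Longrightarrow> hform n w (c \<cdot>\<^sub>v u) = cnj c * hform n w u"
  by (simp add: hform_def sum_distrib_left algebra_simps)

lemma hform_cnj: "cnj (hform n u v) = hform n v u"
  by (simp add: hform_def mult.commute)

lemmas hform_lin = hform_add_left hform_add_right hform_smult_left hform_smult_right

abbreviation vsq :: "nat \<Rightarrow> complex vec \<Rightarrow> real" where
  "vsq n u \<equiv> nsq n (vec_index u)"

text \<open>The sign is chosen so that vectors over points of the ball have positive value.\<close>

definition hq :: "nat \<Rightarrow> complex vec \<Rightarrow> real" where
  "hq n u = (cmod (u $ n))\<^sup>2 - vsq n u"

lemma hform_self: "hform n u u = - of_real (hq n u)"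
  by (simp add: hform_def hq_def nsq_def complex_norm_square[symmetric])

lemma cmod_sum_mult_cnj_le:
  "cmod (\<Sum>j<n. a j * cnj (b j)) \<le> sqrt (nsq n a) * sqrt (nsq n b)"
proof -
  have "cmod (\<Sum>j<n. a j * cnj (b j)) \<le> (\<Sum>j<n. cmod (a j * cnj (b j)))" by (rule norm_sum)
  also have "\<dots> = (\<Sum>j<n. \<bar>cmod (a j)\<bar> * \<bar>cmod (b j)\<bar>)" by (simp add: norm_mult)
  also have "\<dots> \<le> L2_set (\<lambda>j. cmod (a j)) {..<n} * L2_set (\<lambda>j. cmod (b j)) {..<n}"
    by (rule L2_set_mult_ineq)
  finally show ?thesis by (simp add: L2_set_def nsq_def)
qed

lemma sqrt_vsq_le: "0 \<le> hq n w \<Longrightarrow> sqrt (vsq n w) \<le> cmod (w $ n)"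
  by (rule real_le_lsqrt) (auto simp: hq_def)

text \<open>Cauchy-Schwarz in the first n coordinates, combined with |w'| <= |w_n| for a vector w
  that is not positive.\<close>

lemma hform_lower:
  assumes w: "0 \<le> hq n w"
  shows "cmod (w $ n) * (cmod (z $ n) - sqrt (vsq n z)) \<le> cmod (hform n z w)"
proof -
  have "cmod (\<Sum>j<n. z $ j * cnj (w $ j)) \<le> sqrt (vsq n z) * sqrt (vsq n w)"
    by (rule cmod_sum_mult_cnj_le)
  also have "\<dots> \<le> sqrt (vsq n z) * cmod (w $ n)"
    using sqrt_vsq_le[OF w] by (intro mult_left_mono) auto
  finally have "cmod (\<Sum>j<n. z $ j * cnj (w $ j)) \<le> sqrt (vsq n z) * cmod (w $ n)" .
  moreover have "cmod (z $ n * cnj (w $ n)) - cmod (\<Sum>j<n. z $ j * cnj (w $ j)) \<le> cmod (hform n z w)"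
    unfolding hform_def by (metis norm_minus_commute norm_triangle_ineq2)
  ultimately show ?thesis by (simp add: norm_mult algebra_simps)
qed

lemma hform_upper:
  assumes w: "0 \<le> hq n w" and z: "0 \<le> hq n z"
  shows "cmod (hform n z w) \<le> 2 * cmod (z $ n) * cmod (w $ n)"
proof -
  have "cmod (\<Sum>j<n. z $ j * cnj (w $ j)) \<le> sqrt (vsq n z) * sqrt (vsq n w)"
    by (rule cmod_sum_mult_cnj_le)
  also have "\<dots> \<le> cmod (z $ n) * cmod (w $ n)"
    using sqrt_vsq_le[OF w] sqrt_vsq_le[OF z] by (intro mult_mono) auto
  finally have "cmod (\<Sum>j<n. z $ j * cnj (w $ j)) \<le> cmod (z $ n) * cmod (w $ n)" .
  moreover have "cmod (hform n z w) \<le> cmod (\<Sum>j<n. z $ j * cnj (w $ j)) + cmod (z $ n * cnj (w $ n))"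
    unfolding hform_def by (rule norm_triangle_ineq4)
  ultimately show ?thesis by (simp add: norm_mult)
qed

text \<open>Factor hq z = (|z_n| - |z'|) (|z_n| + |z'|) and bound the second factor by 2 |z_n|. The
  pairing is thus controlled from below by |w_n| alone, which is what the convergence estimates for
  the kernels use.\<close>

lemma hform_lower_hq:
  assumes w: "0 \<le> hq n w" and z: "0 < hq n z"
  shows "cmod (w $ n) * hq n z / (2 * cmod (z $ n)) \<le> cmod (hform n z w)"
proof -
  let ?s = "sqrt (vsq n z)"
  have zn: "0 < cmod (z $ n)" using z nsq_nonneg[of n "vec_index z"] by (auto simp: hq_def)
  have s: "?s \<le> cmod (z $ n)" "0 \<le> ?s" using sqrt_vsq_le[of n z] z by auto
  have "hq n z = (cmod (z $ n) - ?s) * (cmod (z $ n) + ?s)"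
    by (simp add: hq_def algebra_simps power2_eq_square)
  also have "\<dots> \<le> (cmod (z $ n) - ?s) * (2 * cmod (z $ n))"
    using s by (intro mult_left_mono) auto
  finally have "hq n z / (2 * cmod (z $ n)) \<le> cmod (z $ n) - ?s" using zn by (simp add: divide_le_eq)
  then have "cmod (w $ n) * (hq n z / (2 * cmod (z $ n))) \<le> cmod (w $ n) * (cmod (z $ n) - ?s)"
    by (rule mult_left_mono) simp
  then show ?thesis using hform_lower[OF w, of z] by simp
qed

lemma hq_nonneg_imp_nz: "0 < hq n z \<Longrightarrow> z $ n \<noteq> 0"
  using nsq_nonneg[of n "vec_index z"] by (auto simp: hq_def)

section \<open>Lifts of ball points and the fractional-linear action\<close>

lemma lift_carrier [simp]: "lift n z \<in> carrier_vec (n+1)" "lift n z \<in> carrier_vec (Suc n)"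
  by (auto simp: lift_def)

lemma lift_index [simp]: "i < n \<Longrightarrow> lift n z $ i = z i" "lift n z $ n = 1"
  by (auto simp: lift_def)

lemma hq_lift: "hq n (lift n z) = 1 - nsq n z"
  by (simp add: hq_def nsq_def)

lemma ball_hq_lift: "z \<in> ball_n n \<Longrightarrow> 0 < hq n (lift n z)"
  by (simp add: hq_lift ball_n_alt)

lemma mult_lift_index:
  assumes "A \<in> carrier_mat (n+1) (n+1)" "i \<le> n"
  shows "(A *\<^sub>v lift n z) $ i = (\<Sum>l<n. A $$ (i, l) * z l) + A $$ (i, n)"
  using assms by (simp add: scalar_prod_def atLeast0LessThan lift_def)

lemma mult_lift_last:
  assumes "A \<in> carrier_mat (n+1) (n+1)"
  shows "(A *\<^sub>v lift n z) $ n = denom n A z"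
  using mult_lift_index[OF assms, of n z] by (simp add: denom_def)

lemma U_n1_hq:
  assumes "A \<in> U_n1 n" "u \<in> carrier_vec (n+1)"
  shows "hq n (A *\<^sub>v u) = hq n u"
proof -
  have "complex_of_real (hq n (A *\<^sub>v u)) = complex_of_real (hq n u)"
    using U_n1_hform[OF assms assms(2)] by (simp add: hform_self)
  then show ?thesis by simp
qed

lemma denom_nz:
  assumes "A \<in> U_n1 n" "z \<in> ball_n n"
  shows "denom n A z \<noteq> 0"
  using hq_nonneg_imp_nz[of n "A *\<^sub>v lift n z"] U_n1_hq[OF assms(1) lift_carrier(1), of z] ball_hq_lift[OF assms(2)]
    mult_lift_last[OF U_n1_carrier[OF assms(1)], of z] by simp

text \<open>The bridge between the two pictures: the action becomes linear on lifts, and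
  \<open>denom\<close> is the factor by which the image lift is stretched. Cocycle, invariance and
  automorphy identities are consequences.\<close>

lemma mult_lift:
  assumes "A \<in> U_n1 n" "z \<in> ball_n n"
  shows "A *\<^sub>v lift n z = denom n A z \<cdot>\<^sub>v lift n (mob n A z)"
proof (rule eq_vecI)
  note c = U_n1_carrier[OF assms(1)]
  fix i assume "i < dim_vec (denom n A z \<cdot>\<^sub>v lift n (mob n A z))"
  then have "i \<le> n" by (simp add: lift_def)
  then show "(A *\<^sub>v lift n z) $ i = (denom n A z \<cdot>\<^sub>v lift n (mob n A z)) $ i"
    using denom_nz[OF assms] mult_lift_index[OF c, of i z]
    by (cases "i = n") (auto simp: mob_def lift_def denom_def)
qed (use U_n1_carrier[OF assms(1)] in \<open>auto simp: lift_def\<close>)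

lemma hq_smult: "u \<in> carrier_vec (n+1) \<Longrightarrow> hq n (c \<cdot>\<^sub>v u) = (cmod c)\<^sup>2 * hq n u"
  by (simp add: hq_def nsq_def norm_mult power_mult_distrib sum_distrib_left algebra_simps)

lemma one_minus_nsq_mob:
  assumes "A \<in> U_n1 n" "z \<in> ball_n n"
  shows "1 - nsq n z = (cmod (denom n A z))\<^sup>2 * (1 - nsq n (mob n A z))"
proof -
  have "1 - nsq n z = hq n (A *\<^sub>v lift n z)" using U_n1_hq[OF assms(1) lift_carrier(1)] by (simp add: hq_lift)
  also have "\<dots> = (cmod (denom n A z))\<^sup>2 * (1 - nsq n (mob n A z))"
    by (simp add: mult_lift[OF assms] hq_smult hq_lift)
  finally show ?thesis .
qed

lemma mob_in_cpts [simp]: "mob n A z \<in> cpts n"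
  by (simp add: mob_def cpts_def)

lemma mob_in_ball:
  assumes "A \<in> U_n1 n" "z \<in> ball_n n"
  shows "mob n A z \<in> ball_n n"
proof -
  have "0 < (cmod (denom n A z))\<^sup>2 * (1 - nsq n (mob n A z))"
    using one_minus_nsq_mob[OF assms] assms(2) by (simp add: ball_n_alt)
  then have "0 < 1 - nsq n (mob n A z)" by (simp add: zero_less_mult_iff)
  then show ?thesis by (simp add: ball_n_alt space_vol_e)
qed

lemma lift_smult_inj:
  assumes "c \<cdot>\<^sub>v lift n z = d \<cdot>\<^sub>v lift n w" "c \<noteq> 0" "z \<in> cpts n" "w \<in> cpts n"
  shows "z = w"
proof -
  have "(c \<cdot>\<^sub>v lift n z) $ n = (d \<cdot>\<^sub>v lift n w) $ n" using assms(1) by simp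
  then have "c = d" by (simp add: lift_def)
  have "z i = w i" if "i < n" for i
  proof -
    have "(c \<cdot>\<^sub>v lift n z) $ i = (d \<cdot>\<^sub>v lift n w) $ i" using assms(1) by simp
    then show ?thesis using that \<open>c = d\<close> assms(2) by (simp add: lift_def)
  qed
  then show ?thesis using assms(3,4) by (intro PiE_ext[of z "{..<n}" "\<lambda>_. UNIV" w]) (auto simp: cpts_def)
qed

lemma ball_in_cpts: "z \<in> ball_n n \<Longrightarrow> z \<in> cpts n"
  by (simp add: ball_n_def)

lemma U_n1_mult:
  assumes "A \<in> U_n1 n" "B \<in> U_n1 n"
  shows "A * B \<in> U_n1 n"
proof -
  have A: "A \<in> carrier_mat (n+1) (n+1)" and B: "B \<in> carrier_mat (n+1) (n+1)" using assms by (auto simp: U_n1_def)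
  have "hform n (A * B *\<^sub>v u) (A * B *\<^sub>v v) = hform n u v"
    if u: "u \<in> carrier_vec (n+1)" and v: "v \<in> carrier_vec (n+1)" for u v
    using assms A B u v by (simp add: assoc_mult_mat_vec[OF A B] U_n1_hform)
  moreover have "cmod (Determinant.det (A * B)) = 1"
    using assms det_mult[OF A B] by (simp add: norm_mult U_n1_def)
  ultimately show ?thesis using A B by (simp add: U_n1_def)
qed

lemma mob_mult:
  assumes "A \<in> U_n1 n" "B \<in> U_n1 n" "z \<in> ball_n n"
  shows "mob n (A * B) z = mob n A (mob n B z)"
proof -
  note A = U_n1_carrier[OF assms(1)] and B = U_n1_carrier[OF assms(2)]
  have "denom n (A * B) z \<cdot>\<^sub>v lift n (mob n (A * B) z) = A *\<^sub>v (B *\<^sub>v lift n z)"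
    using mult_lift[OF U_n1_mult[OF assms(1,2)] assms(3)] A B by simp
  also have "\<dots> = denom n B z \<cdot>\<^sub>v (A *\<^sub>v lift n (mob n B z))"
    using A by (simp add: mult_lift[OF assms(2,3)] mult_mat_vec)
  also have "\<dots> = (denom n B z * denom n A (mob n B z)) \<cdot>\<^sub>v lift n (mob n A (mob n B z))"
    by (simp add: mult_lift[OF assms(1) mob_in_ball[OF assms(2,3)]] smult_smult_assoc)
  finally show ?thesis
    using denom_nz[OF U_n1_mult[OF assms(1,2)] assms(3)] by (intro lift_smult_inj) auto
qed

lemma mob_one: "z \<in> cpts n \<Longrightarrow> mob n (1\<^sub>m (n+1)) z = z"
  by (intro PiE_ext[of _ "{..<n}" "\<lambda>_. UNIV"])
    (auto simp: mob_def denom_def cpts_def if_distrib[of "\<lambda>x. x * _"] cong: if_cong)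

section \<open>Integrals of powers of 1 - |z|^2 over the ball\<close>

lemma nn_integral_disc_power:
  assumes "0 \<le> R"
  shows "(\<integral>\<^sup>+y. indicator {y. (cmod y)\<^sup>2 \<le> R} y * ennreal ((R - (cmod y)\<^sup>2) ^ a) \<partial>lborel)
     = ennreal (pi * R ^ (a+1) / real (a+1))"
  using assms
proof (induction a arbitrary: R)
  case 0
  have "{y::complex. (cmod y)\<^sup>2 \<le> R} = cball 0 (sqrt R)"
    using 0 by (auto simp: real_le_rsqrt intro: sqrt_ge_absD)
  then show ?case using 0 by (simp add: emeasure_cball unit_ball_vol_2)
next
  \<comment> \<open>The power (R - p)^(a+1) is written as the integral of (a+1) (t - p)^a over t
    from p to R. Exchanging the integrals leaves the induction hypothesis at radius parameter
    t.\<close>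
  case (Suc a)
  have "(\<integral>\<^sup>+y. indicator {y. (cmod y)\<^sup>2 \<le> R} y * ennreal ((R - (cmod y)\<^sup>2) ^ Suc a) \<partial>lborel)
     = (\<integral>\<^sup>+y. \<integral>\<^sup>+t. indicator {0..R} t * (ennreal (real (a+1)) * (indicator {y. (cmod y)\<^sup>2 \<le> t} y * ennreal ((t - (cmod y)\<^sup>2) ^ a))) \<partial>lborel \<partial>(lborel :: complex measure))"
  proof (rule nn_integral_cong)
    fix y :: complex
    let ?p = "(cmod y)\<^sup>2"
    have "(\<integral>\<^sup>+t. indicator {0..R} t * (ennreal (real (a+1)) * (indicator {y. (cmod y)\<^sup>2 \<le> t} y * ennreal ((t - ?p) ^ a))) \<partial>lborel)
        = (\<integral>\<^sup>+t. ennreal (real (a+1) * (t - ?p) ^ a) * indicator {?p..R} t \<partial>lborel)"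
      by (rule nn_integral_cong) (auto simp: indicator_def ennreal_mult' intro: order_trans[of 0 ?p])
    also have "\<dots> = indicator {y. (cmod y)\<^sup>2 \<le> R} y * ennreal ((R - ?p) ^ Suc a)"
    proof (cases "?p \<le> R")
      case True
      have "(\<integral>\<^sup>+t. ennreal (real (a+1) * (t - ?p) ^ a) * indicator {?p..R} t \<partial>lborel)
         = ennreal ((R - ?p) ^ Suc a - (?p - ?p) ^ Suc a)"
      proof (rule nn_integral_FTC_Icc[where F="\<lambda>t. (t - ?p) ^ Suc a"])
        show "((\<lambda>t. (t - ?p) ^ Suc a) has_real_derivative real (a+1) * (x - ?p) ^ a) (at x)" for x
          by (auto intro!: derivative_eq_intros simp del: power_Suc)
      qed (use True in auto)
      then show ?thesis using True by simp
    qed simp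
    finally show "indicator {y. (cmod y)\<^sup>2 \<le> R} y * ennreal ((R - ?p) ^ Suc a)
      = (\<integral>\<^sup>+t. indicator {0..R} t * (ennreal (real (a+1)) * (indicator {y. (cmod y)\<^sup>2 \<le> t} y * ennreal ((t - ?p) ^ a))) \<partial>lborel)" ..
  qed
  also have "\<dots> = (\<integral>\<^sup>+t. \<integral>\<^sup>+y. indicator {0..R} t * (ennreal (real (a+1)) * (indicator {y. (cmod y)\<^sup>2 \<le> t} y * ennreal ((t - (cmod y)\<^sup>2) ^ a))) \<partial>(lborel :: complex measure) \<partial>lborel)"
    by (rule lborel_pair.Fubini') (simp add: indicator_def[of "{y. _ y}"])
  also have "\<dots> = (\<integral>\<^sup>+t. ennreal (pi * t ^ (a+1)) * indicator {0..R} t \<partial>lborel)"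
  proof (rule nn_integral_cong)
    fix t :: real
    have m: "(\<lambda>y::complex. indicator {y. (cmod y)\<^sup>2 \<le> t} y * ennreal ((t - (cmod y)\<^sup>2) ^ a)) \<in> borel_measurable lborel"
      by measurable
    have "(\<integral>\<^sup>+y. indicator {0..R} t * (ennreal (real (a+1)) * (indicator {y. (cmod y)\<^sup>2 \<le> t} y * ennreal ((t - (cmod y)\<^sup>2) ^ a))) \<partial>(lborel :: complex measure))
       = indicator {0..R} t * (ennreal (real (a+1)) * (\<integral>\<^sup>+y. indicator {y. (cmod y)\<^sup>2 \<le> t} y * ennreal ((t - (cmod y)\<^sup>2) ^ a) \<partial>(lborel :: complex measure)))"
      by (subst nn_integral_cmult, rule borel_measurable_times_ennreal, simp, rule m,
          subst nn_integral_cmult, rule m, rule refl)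
    also have "\<dots> = ennreal (pi * t ^ (a+1)) * indicator {0..R} t"
    proof (cases "t \<in> {0..R}")
      case True
      then have "0 \<le> t" by simp
      have "real (a+1) * (pi * t ^ (a+1) / real (a+1)) = pi * t ^ (a+1)" by simp
      then have "ennreal (real (a+1)) * ennreal (pi * t ^ (a+1) / real (a+1)) = ennreal (pi * t ^ (a+1))"
        by (simp only: ennreal_mult'[symmetric] of_nat_0_le_iff)
      then show ?thesis using True unfolding Suc.IH[OF \<open>0 \<le> t\<close>] by simp
    qed simp
    finally show "(\<integral>\<^sup>+y. indicator {0..R} t * (ennreal (real (a+1)) * (indicator {y. (cmod y)\<^sup>2 \<le> t} y * ennreal ((t - (cmod y)\<^sup>2) ^ a))) \<partial>(lborel :: complex measure))
       = ennreal (pi * t ^ (a+1)) * indicator {0..R} t" .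
  qed
  also have "\<dots> = ennreal (pi * R ^ (a+2) / real (a+2) - pi * 0 ^ (a+2) / real (a+2))"
  proof (rule nn_integral_FTC_Icc[where F="\<lambda>t. pi * t ^ (a+2) / real (a+2)"])
    have "((\<lambda>t. t ^ (a+2)) has_real_derivative real (a+2) * x ^ (a+1)) (at x)" for x
      using DERIV_pow[of "a+2" x UNIV] by (simp del: power_Suc)
    from DERIV_cdivide[OF DERIV_cmult[OF this, of pi], of "real (a+2)"]
    show "((\<lambda>t. pi * t ^ (a+2) / real (a+2)) has_real_derivative pi * x ^ (a+1)) (at x)" for x
      by simp
  qed (use Suc.prems in auto)
  finally show ?case by simp
qed

text \<open>Integrating out one coordinate raises the exponent by one at the cost of a factor pi /
  (a+1); the factors telescope to the quotient of factorials.\<close>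

lemma nn_integral_ball_power:
  "(\<integral>\<^sup>+z. indicator {z. nsq n z \<le> 1} z * ennreal ((1 - nsq n z) ^ a) \<partial>vol_e n)
     = ennreal (pi ^ n * fact a / fact (a + n))"
proof (induction n arbitrary: a)
  case 0
  have "(\<integral>\<^sup>+z. indicator {z. nsq 0 z \<le> 1} z * ennreal ((1 - nsq 0 z) ^ a) \<partial>vol_e 0) = emeasure (vol_e 0) (space (vol_e 0))"
    by (simp add: nsq_def)
  then show ?case by (simp add: vol_e_def space_PiM_empty )
next
  case (Suc n)
  have s: "nsq (Suc n) (x(n := y)) = nsq n x + (cmod y)\<^sup>2" for x y
    by (simp add: nsq_def)
  let ?f = "\<lambda>z. indicator {z. nsq (Suc n) z \<le> 1} z * ennreal ((1 - nsq (Suc n) z) ^ a)"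
  have "?f \<in> borel_measurable (vol_e (Suc n))" by (simp add: indicator_def[of "{y. _ y}"])
  then have "(\<integral>\<^sup>+z. ?f z \<partial>vol_e (Suc n)) = (\<integral>\<^sup>+x. \<integral>\<^sup>+y. ?f (x(n := y)) \<partial>lborel \<partial>vol_e n)"
    using cprod.product_nn_integral_insert[of "{..<n}" n ?f] by (simp add: vol_e_def lessThan_Suc)
  also have "\<dots> = (\<integral>\<^sup>+x. ennreal (pi / real (a+1)) * (indicator {z. nsq n z \<le> 1} x * ennreal ((1 - nsq n x) ^ (a+1))) \<partial>vol_e n)"
  proof (rule nn_integral_cong)
    fix x
    show "(\<integral>\<^sup>+y. ?f (x(n := y)) \<partial>lborel) = ennreal (pi / real (a+1)) * (indicator {z. nsq n z \<le> 1} x * ennreal ((1 - nsq n x) ^ (a+1)))"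
    proof (cases "nsq n x \<le> 1")
      case True
      have "(\<integral>\<^sup>+y. ?f (x(n := y)) \<partial>lborel) = (\<integral>\<^sup>+y. indicator {y. (cmod y)\<^sup>2 \<le> 1 - nsq n x} y * ennreal ((1 - nsq n x - (cmod y)\<^sup>2) ^ a) \<partial>lborel)"
        by (rule nn_integral_cong) (auto simp: s indicator_def algebra_simps)
      also have "\<dots> = ennreal (pi * (1 - nsq n x) ^ (a+1) / real (a+1))"
        by (rule nn_integral_disc_power) (use True in simp)
      finally show ?thesis using True by (simp add: ennreal_mult'[symmetric] mult_ac)
    next
      case False
      then have "nsq (Suc n) (x(n := y)) > 1" for y unfolding s by (smt (verit) zero_le_power2)
      then have z: "?f (x(n := y)) = 0" for y by (simp add: indicator_def not_le)
      show ?thesis unfolding z using False by simp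
    qed
  qed
  also have "\<dots> = ennreal (pi / real (a+1)) * (\<integral>\<^sup>+x. indicator {z. nsq n z \<le> 1} x * ennreal ((1 - nsq n x) ^ (a+1)) \<partial>vol_e n)"
    by (rule nn_integral_cmult) (simp add: indicator_def[of "{y. _ y}"])
  also have "\<dots> = ennreal (pi / real (a+1)) * ennreal (pi ^ n * fact (a+1) / fact (a + 1 + n))"
    by (subst Suc.IH) simp
  also have "\<dots> = ennreal (pi ^ Suc n * fact a / fact (a + Suc n))"
  proof -
    have "fact (a + 1) = real (a + 1) * fact a" "a + 1 + n = a + Suc n" by simp_all
    then have "pi / real (a+1) * (pi ^ n * fact (a+1) / fact (a + 1 + n)) = pi ^ Suc n * fact a / fact (a + Suc n)"
      by (simp del: fact_Suc)
    then show ?thesis by (simp only: ennreal_mult'[symmetric] pi_ge_zero divide_nonneg_nonneg of_nat_0_le_iff)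
  qed
  finally show ?case .
qed

section \<open>Mean value and reproducing properties\<close>

lemma AE_hyp_vol_ball: "AE z in hyp_vol n. z \<in> ball_n n"
  unfolding hyp_vol_def by (subst AE_density) (auto simp: indicator_def)

text \<open>The hyperbolic mass of (1 - |z|^2)^N: the density takes n + 1 away from the exponent, so
  the ball integral is evaluated at N - (n+1).\<close>

definition omega :: "nat \<Rightarrow> nat \<Rightarrow> real" where
  "omega n N = pi ^ n * fact (N - (n+1)) / fact (N - 1)"

lemma nn_integral_hyp_vol_power:
  assumes "n + 2 \<le> N"
  shows "(\<integral>\<^sup>+z. ennreal ((1 - nsq n z) ^ N) \<partial>hyp_vol n) = ennreal (omega n N)"
proof -
  define a where "a = N - (n + 1)"
  have a: "N = a + (n+1)" "a \<noteq> 0" using assms by (auto simp: a_def)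
  have "(\<integral>\<^sup>+z. ennreal ((1 - nsq n z) ^ N) \<partial>hyp_vol n)
     = (\<integral>\<^sup>+z. indicator (ball_n n) z * ennreal (inverse (1 - nsq n z) ^ (n+1)) * ennreal ((1 - nsq n z) ^ N) \<partial>vol_e n)"
    by (rule nn_integral_hyp_vol) measurable
  also have "\<dots> = (\<integral>\<^sup>+z. indicator {z. nsq n z \<le> 1} z * ennreal ((1 - nsq n z) ^ a) \<partial>vol_e n)"
  proof (rule nn_integral_cong)
    fix z assume z: "z \<in> space (vol_e n)"
    \<comment> \<open>On the unit sphere the open-ball indicator vanishes and the closed one does
      not; the two sides agree there because the remaining exponent is nonzero.\<close>
    consider "nsq n z < 1" | "nsq n z = 1" | "nsq n z > 1" by linarith
    then show "indicator (ball_n n) z * ennreal (inverse (1 - nsq n z) ^ (n+1)) * ennreal ((1 - nsq n z) ^ N)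
       = indicator {z. nsq n z \<le> 1} z * ennreal ((1 - nsq n z) ^ a)"
    proof cases
      case 1
      then have "inverse (1 - nsq n z) ^ (n+1) * (1 - nsq n z) ^ N = (1 - nsq n z) ^ a"
      proof -
        have "inverse (1 - nsq n z) ^ (n+1) * (1 - nsq n z) ^ (n+1) = 1"
          using 1 by (simp add: power_mult_distrib[symmetric] del: power_Suc)
        then show ?thesis unfolding a(1) power_add[of _ a] by (simp add: mult.left_commute del: power_Suc)
      qed
      then show ?thesis using 1 z by (simp add: ball_n_alt ennreal_mult'[symmetric])
    qed (use z a(2) in \<open>auto simp: ball_n_alt\<close>)
  qed
  also have "\<dots> = ennreal (pi ^ n * fact a / fact (a + n))" by (rule nn_integral_ball_power)
  also have "pi ^ n * fact a / fact (a + n) = omega n N"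
    by (simp add: omega_def a(1))
  finally show ?thesis .
qed

lemma omega_pos: "0 < omega n N"
  by (simp add: omega_def)

lemma has_integral_hyp_vol_power:
  assumes "n + 2 \<le> N"
  shows "integrable (hyp_vol n) (\<lambda>z. (1 - nsq n z) ^ N)" "(\<integral>z. (1 - nsq n z) ^ N \<partial>hyp_vol n) = omega n N"
proof -
  have AE: "AE z in hyp_vol n. 0 \<le> (1 - nsq n z) ^ N"
    using AE_hyp_vol_ball by eventually_elim (simp add: ball_n_alt)
  have "has_bochner_integral (hyp_vol n) (\<lambda>z. (1 - nsq n z) ^ N) (omega n N)"
    by (rule has_bochner_integral_nn_integral[OF _ AE])
      (use nn_integral_hyp_vol_power[OF assms] omega_pos[of n N] in auto)
  then show "integrable (hyp_vol n) (\<lambda>z. (1 - nsq n z) ^ N)" "(\<integral>z. (1 - nsq n z) ^ N \<partial>hyp_vol n) = omega n N"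
    by (auto simp: has_bochner_integral_iff)
qed

section \<open>Rotations and the mean value property\<close>

lemma mult_mat_vec_sum:
  assumes "A \<in> carrier_mat m m" "u \<in> carrier_vec m" "i < m"
  shows "(A *\<^sub>v u) $ i = (\<Sum>j<m. A $$ (i, j) * u $ j)"
  using assms by (simp add: scalar_prod_def atLeast0LessThan)

definition rot :: "nat \<Rightarrow> complex \<Rightarrow> complex mat" where
  "rot n \<eta> = mat (n+1) (n+1) (\<lambda>(i, j). if i = j then (if i < n then \<eta> else 1) else 0)"

lemma rot_U_n1:
  assumes "cmod \<eta> = 1"
  shows "rot n \<eta> \<in> U_n1 n"
proof -
  have c: "rot n \<eta> \<in> carrier_mat (n+1) (n+1)" by (simp add: rot_def)
  have mv: "(rot n \<eta> *\<^sub>v u) $ i = (if i < n then \<eta> * u $ i else u $ i)" if "u \<in> carrier_vec (n+1)" "i \<le> n" for u i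
  proof -
    have i1: "i < n + 1" using that by simp
    have "(rot n \<eta> *\<^sub>v u) $ i = (\<Sum>j<n+1. (if j = i then (if i < n then \<eta> * u $ i else u $ i) else 0))"
      unfolding mult_mat_vec_sum[OF c that(1) i1]
      using that by (intro sum.cong) (auto simp: rot_def)
    then show ?thesis using that by simp
  qed
  have e: "\<eta> * cnj \<eta> = 1" using assms by (simp add: complex_norm_square[symmetric])
  have "hform n (rot n \<eta> *\<^sub>v u) (rot n \<eta> *\<^sub>v v) = hform n u v"
    if "u \<in> carrier_vec (n+1)" "v \<in> carrier_vec (n+1)" for u v
  proof -
    have k: "\<eta> * u $ j * cnj (\<eta> * v $ j) = u $ j * cnj (v $ j)" for j
    proof -
      have "\<eta> * u $ j * cnj (\<eta> * v $ j) = (\<eta> * cnj \<eta>) * (u $ j * cnj (v $ j))" by (simp add: ac_simps)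
      then show ?thesis by (simp add: e)
    qed
    have "(\<Sum>j<n. (rot n \<eta> *\<^sub>v u) $ j * cnj ((rot n \<eta> *\<^sub>v v) $ j)) = (\<Sum>j<n. u $ j * cnj (v $ j))"
      using that by (intro sum.cong refl) (simp add: mv k del: complex_cnj_mult)
    then show ?thesis unfolding hform_def using that by (simp add: mv)
  qed
  moreover have "cmod (Determinant.det (rot n \<eta>)) = 1"
  proof -
    have "upper_triangular (rot n \<eta>)" by (auto simp: upper_triangular_def rot_def)
    then have "Determinant.det (rot n \<eta>) = prod_list (diag_mat (rot n \<eta>))" using c by (rule det_upper_triangular)
    also have "\<dots> = (\<Prod>i<n+1. rot n \<eta> $$ (i, i))" using c by (simp add: prod_list_diag_prod atLeast0LessThan)
    also have "\<dots> = (\<Prod>i<n+1. if i < n then \<eta> else 1)" by (intro prod.cong) (auto simp: rot_def)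
    finally show ?thesis using assms by (simp add: norm_mult prod_norm[symmetric] norm_power)
  qed
  ultimately show ?thesis using c by (simp add: U_n1_def)
qed

lemma mob_rot: "mob n (rot n \<eta>) z = (\<lambda>i\<in>{..<n}. \<eta> * z i)"
proof -
  have "denom n (rot n \<eta>) z = 1" by (simp add: denom_def rot_def)
  moreover have "(\<Sum>l<n. rot n \<eta> $$ (j, l) * z l) + rot n \<eta> $$ (j, n) = \<eta> * z j" if "j < n" for j
  proof -
    have "(\<Sum>l<n. rot n \<eta> $$ (j, l) * z l) = (\<Sum>l<n. if l = j then \<eta> * z j else 0)"
      using that by (intro sum.cong) (auto simp: rot_def)
    then show ?thesis using that by (simp add: rot_def)
  qed
  ultimately show ?thesis by (auto simp: mob_def)
qed

lemma integral_hyp_vol_mob: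
  fixes f :: "(nat \<Rightarrow> complex) \<Rightarrow> complex"
  assumes "A \<in> U_n1 n" "f \<in> borel_measurable (vol_e n)"
  shows "(\<integral>z. f (mob n A z) \<partial>hyp_vol n) = (\<integral>z. f z \<partial>hyp_vol n)"
proof -
  have "(\<integral>z. f z \<partial>hyp_vol n) = (\<integral>z. f z \<partial>distr (hyp_vol n) (vol_e n) (mob n A))"
    by (simp add: distr_hyp_vol_mob[OF assms(1)])
  also have "\<dots> = (\<integral>z. f (mob n A z) \<partial>hyp_vol n)"
    by (rule integral_distr) (use assms in measurable)
  finally show ?thesis ..
qed

lemma linear_form_measurable [measurable]: "(\<lambda>z. \<Sum>j<n. z j * c j) \<in> borel_measurable (vol_e n)"
  unfolding vol_e_def by measurable

lemma borel_measurable_cnj [measurable (raw)]: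
  "f \<in> borel_measurable M \<Longrightarrow> (\<lambda>x. cnj (f x)) \<in> borel_measurable M"
  by (rule borel_measurable_continuous_onI[THEN measurable_compose_rev]) (intro continuous_intros)

lemma hform_lift_measurable [measurable]: "(\<lambda>z. hform n (lift n z) w) \<in> borel_measurable (vol_e n)"
  unfolding hform_def by simp

text \<open>Rotation by an m-th root of -1 preserves the measure and the weight but negates the m-th
  power of a linear form, so the integral equals its own negative.\<close>

lemma integral_power_linear_form_zero:
  assumes "m \<ge> 1"
  shows "(\<integral>z. (\<Sum>j<n. z j * cnj (a j)) ^ m * of_real ((1 - nsq n z) ^ N) \<partial>hyp_vol n) = 0"
proof -
  let ?f = "\<lambda>z. (\<Sum>j<n. z j * cnj (a j)) ^ m * complex_of_real ((1 - nsq n z) ^ N)"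
  define \<eta> where "\<eta> = cis (pi / real m)"
  have e1: "cmod \<eta> = 1" by (simp add: \<eta>_def)
  have em: "\<eta> ^ m = -1"
  proof -
    have "\<eta> ^ m = cis (real m * (pi / real m))" unfolding \<eta>_def by (rule Complex.DeMoivre)
    then show ?thesis using assms by simp
  qed
  have eq: "?f (mob n (rot n \<eta>) z) = - ?f z" for z
  proof -
    have "(\<Sum>j<n. (\<lambda>i\<in>{..<n}. \<eta> * z i) j * cnj (a j)) = \<eta> * (\<Sum>j<n. z j * cnj (a j))"
      by (simp add: sum_distrib_left mult.assoc)
    moreover have "nsq n (\<lambda>i\<in>{..<n}. \<eta> * z i) = nsq n z"
      by (simp add: nsq_def norm_mult e1)
    ultimately show ?thesis by (simp add: mob_rot power_mult_distrib em)
  qed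
  have "(\<integral>z. ?f z \<partial>hyp_vol n) = (\<integral>z. ?f (mob n (rot n \<eta>) z) \<partial>hyp_vol n)"
    by (rule integral_hyp_vol_mob[symmetric, OF rot_U_n1[OF e1]]) measurable
  also have "\<dots> = - (\<integral>z. ?f z \<partial>hyp_vol n)" unfolding eq by simp
  finally have "(\<integral>z. ?f z \<partial>hyp_vol n) + (\<integral>z. ?f z \<partial>hyp_vol n) = 0" by (simp only: eq_neg_iff_add_eq_0)
  then have "2 * (\<integral>z. ?f z \<partial>hyp_vol n) = 0" by (simp only: mult_2)
  then show ?thesis by simp
qed

lemma binomial_series_inverse_power:
  fixes x :: complex
  assumes "cmod x < 1"
  shows "(\<lambda>m. ((- of_nat N) gchoose m) * (- x) ^ m) sums (inverse (1 - x) ^ N)"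
proof -
  have "(\<lambda>m. ((- of_nat N) gchoose m) * (- x) ^ m) sums ((1 + (- x)) powr (- of_nat N))"
    by (rule gen_binomial_complex) (use assms in simp)
  moreover have "1 - x \<noteq> 0" using assms by auto
  then have "(1 + (- x)) powr (- of_nat N) = inverse (1 - x) ^ N"
    by (simp add: powr_minus powr_nat power_inverse)
  ultimately show ?thesis by simp
qed

text \<open>Expand the kernel in powers of the linear form: every term except the constant one
  integrates to zero. Since |a| < 1, the binomial series at |a| times the integrable weight
  justifies termwise integration.\<close>

lemma mean_value_hyp_vol:
  assumes N: "n + 2 \<le> N" and a: "nsq n a < 1"
  shows "(\<integral>z. inverse (1 - (\<Sum>j<n. z j * cnj (a j))) ^ N * of_real ((1 - nsq n z) ^ N) \<partial>hyp_vol n) = of_real (omega n N)"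
proof -
  let ?p = "\<lambda>z. \<Sum>j<n. z j * cnj (a j)"
  let ?w = "\<lambda>z. complex_of_real ((1 - nsq n z) ^ N)"
  define r where "r = sqrt (nsq n a)"
  define c where "c m = ((- of_nat N :: complex) gchoose m)" for m
  define f where "f m z = c m * (- ?p z) ^ m * ?w z" for m z
  have r: "0 \<le> r" "r < 1" using a by (auto simp: r_def)
  have pr: "cmod (?p z) \<le> r" if "z \<in> ball_n n" for z
  proof -
    have "cmod (?p z) \<le> sqrt (nsq n z) * r" unfolding r_def by (rule cmod_sum_mult_cnj_le)
    also have "\<dots> \<le> 1 * r" using that r by (intro mult_right_mono) (auto simp: ball_n_alt)
    finally show ?thesis by simp
  qed
  have sumr: "summable (\<lambda>m. cmod (c m) * r ^ m)"
  proof -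
    \<comment> \<open>Any point strictly between r and 1 will do: convergence of the power series
      there gives absolute convergence at r.\<close>
    define s where "s = complex_of_real ((r + 1) / 2)"
    have s: "cmod s < 1" "r < cmod s" using r by (auto simp: s_def simp del: of_real_divide of_real_add)
    have "summable (\<lambda>m. c m * (- s) ^ m)"
      using binomial_series_inverse_power[OF s(1), of N] by (auto simp: c_def sums_iff)
    from powser_insidea[OF this, of "of_real r"] s r
    show ?thesis by (simp add: norm_mult norm_power)
  qed
  note W = has_integral_hyp_vol_power[OF N]
  have Wc: "integrable (hyp_vol n) ?w" using W(1) by (rule integrable_of_real)
  have fb: "cmod (f m z) \<le> cmod (c m) * r ^ m * (1 - nsq n z) ^ N" if "z \<in> ball_n n" for m z
  proof -
    have w0: "0 \<le> (1 - nsq n z) ^ N" using that by (simp add: ball_n_alt)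
    have "cmod (f m z) = cmod (c m) * cmod (?p z) ^ m * (1 - nsq n z) ^ N"
      using w0 unfolding f_def by (simp only: norm_mult norm_power norm_minus_cancel norm_of_real abs_of_nonneg)
    also have "\<dots> \<le> cmod (c m) * r ^ m * (1 - nsq n z) ^ N"
      using pr[OF that] w0 by (intro mult_right_mono mult_left_mono power_mono) auto
    finally show ?thesis .
  qed
  have fi: "integrable (hyp_vol n) (f m)" for m
  proof (rule Bochner_Integration.integrable_bound)
    show "integrable (hyp_vol n) (\<lambda>z. cmod (c m) * r ^ m * (1 - nsq n z) ^ N)"
      by (rule integrable_mult_right) (rule W(1))
    show "f m \<in> borel_measurable (hyp_vol n)" unfolding f_def by measurable
    show "AE z in hyp_vol n. norm (f m z) \<le> norm (cmod (c m) * r ^ m * (1 - nsq n z) ^ N)"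
      using AE_hyp_vol_ball by eventually_elim (use fb in \<open>force intro: order_trans[OF _ abs_ge_self]\<close>)
  qed
  have nb: "(\<integral>z. norm (f m z) \<partial>hyp_vol n) \<le> cmod (c m) * r ^ m * omega n N" for m
  proof -
    have "(\<integral>z. norm (f m z) \<partial>hyp_vol n) \<le> (\<integral>z. cmod (c m) * r ^ m * (1 - nsq n z) ^ N \<partial>hyp_vol n)"
      by (rule integral_mono_AE)
        (use fi W(1) AE_hyp_vol_ball[of n] fb in \<open>auto elim!: eventually_mono\<close>)
    then show ?thesis using W by simp
  qed
  have S: "(\<lambda>m. integral\<^sup>L (hyp_vol n) (f m)) sums (\<integral>z. (\<Sum>m. f m z) \<partial>hyp_vol n)"
  proof (rule sums_integral[OF fi])
    show "AE z in hyp_vol n. summable (\<lambda>m. norm (f m z))"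
      using AE_hyp_vol_ball
    proof eventually_elim
      case (elim z)
      show ?case
        by (rule summable_comparison_test'[OF summable_mult2[OF sumr, of "(1 - nsq n z) ^ N"], of 0])
          (use fb[OF elim] in auto)
    qed
    show "summable (\<lambda>m. \<integral>z. norm (f m z) \<partial>hyp_vol n)"
      by (rule summable_comparison_test'[OF summable_mult2[OF sumr, of "omega n N"], of 0])
        (use nb in \<open>auto simp: integral_nonneg_AE\<close>)
  qed
  have "integral\<^sup>L (hyp_vol n) (f m) = (if m = 0 then of_real (omega n N) else 0)" for m
  proof (cases "m = 0")
    case True
    then have "f m = ?w" by (auto simp: f_def c_def fun_eq_iff)
    then have "integral\<^sup>L (hyp_vol n) (f m) = (\<integral>z. ?w z \<partial>hyp_vol n)" by (rule arg_cong)
    also have "\<dots> = of_real (omega n N)" using W(2) by (simp only: integral_complex_of_real)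
    finally show ?thesis using True by simp
  next
    case False
    have "f m = (\<lambda>z. (c m * (-1) ^ m) * (?p z ^ m * ?w z))"
      unfolding f_def fun_eq_iff power_minus[of "?p _"] by (simp add: ac_simps)
    then have "integral\<^sup>L (hyp_vol n) (f m) = (c m * (-1) ^ m) * (\<integral>z. ?p z ^ m * ?w z \<partial>hyp_vol n)"
      by (simp only: integral_mult_right_zero)
    also have "\<dots> = 0" using integral_power_linear_form_zero[of m n a N] False by simp
    finally show ?thesis using False by simp
  qed
  then have "(\<lambda>m. if m = 0 then of_real (omega n N) else 0) sums (\<integral>z. (\<Sum>m. f m z) \<partial>hyp_vol n)"
    using S by simp
  moreover have "(\<lambda>m. if m = 0 then of_real (omega n N) else (0::complex)) sums of_real (omega n N)"
    by (rule sums_single[of 0, simplified])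
  ultimately have "(\<integral>z. (\<Sum>m. f m z) \<partial>hyp_vol n) = of_real (omega n N)" by (rule sums_unique2)
  also have "(\<integral>z. (\<Sum>m. f m z) \<partial>hyp_vol n) = (\<integral>z. inverse (1 - ?p z) ^ N * ?w z \<partial>hyp_vol n)"
  proof (rule integral_cong_AE)
    show "(\<lambda>z. \<Sum>m. f m z) \<in> borel_measurable (hyp_vol n)" unfolding f_def by measurable
    show "AE z in hyp_vol n. (\<Sum>m. f m z) = inverse (1 - ?p z) ^ N * ?w z"
      using AE_hyp_vol_ball
    proof eventually_elim
      case (elim z)
      have "cmod (?p z) < 1" using pr[OF elim] r by simp
      from sums_mult2[OF binomial_series_inverse_power[OF this, of N], of "?w z"]
      show ?case by (simp add: f_def c_def sums_iff)
    qed
  qed measurable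
  finally show ?thesis .
qed

section \<open>Hermitian reflections and the reproducing property\<close>

definition refl_mat :: "nat \<Rightarrow> complex vec \<Rightarrow> complex mat" where
  "refl_mat n V = mat (n+1) (n+1) (\<lambda>(i, j). (if i = j then 1 else 0)
     - 2 / hform n V V * V $ i * (if j < n then cnj (V $ j) else - cnj (V $ j)))"

lemma refl_mat_carrier [simp]: "refl_mat n V \<in> carrier_mat (n+1) (n+1)" "refl_mat n V \<in> carrier_mat (Suc n) (Suc n)"
  by (simp_all add: refl_mat_def)

lemma refl_mat_mult_vec:
  assumes V: "V \<in> carrier_vec (n+1)" and u: "u \<in> carrier_vec (n+1)"
  shows "refl_mat n V *\<^sub>v u = u + (- 2 * hform n u V / hform n V V) \<cdot>\<^sub>v V"
proof (rule eq_vecI)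
  fix i assume "i < dim_vec (u + (- 2 * hform n u V / hform n V V) \<cdot>\<^sub>v V)"
  then have i: "i < n + 1" using V by simp
  let ?c = "2 / hform n V V * V $ i"
  have "(refl_mat n V *\<^sub>v u) $ i = (\<Sum>j<n+1. refl_mat n V $$ (i, j) * u $ j)"
    by (rule mult_mat_vec_sum) (use u i in auto)
  also have "\<dots> = (\<Sum>j<n+1. (if j = i then u $ j else 0) - ?c * ((if j < n then cnj (V $ j) else - cnj (V $ j)) * u $ j))"
    using i by (intro sum.cong refl) (auto simp: refl_mat_def algebra_simps)
  also have "\<dots> = u $ i - ?c * (\<Sum>j<n+1. (if j < n then cnj (V $ j) else - cnj (V $ j)) * u $ j)"
    using i by (simp only: sum_subtractf sum_distrib_left sum.delta finite_lessThan lessThan_iff if_True)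
  also have "(\<Sum>j<n+1. (if j < n then cnj (V $ j) else - cnj (V $ j)) * u $ j) = hform n u V"
    by (simp add: hform_def mult.commute)
  finally show "(refl_mat n V *\<^sub>v u) $ i = (u + (- 2 * hform n u V / hform n V V) \<cdot>\<^sub>v V) $ i"
    using i V u by simp
qed (use V u in \<open>auto simp: refl_mat_def\<close>)

lemma refl_mat_involution:
  assumes V: "V \<in> carrier_vec (n+1)" and u: "u \<in> carrier_vec (n+1)" and V0: "hform n V V \<noteq> 0"
  shows "refl_mat n V *\<^sub>v (refl_mat n V *\<^sub>v u) = u"
proof -
  let ?c = "- 2 * hform n u V / hform n V V"
  have "hform n (u + ?c \<cdot>\<^sub>v V) V = - hform n u V"
    using V u V0 by (simp add: hform_lin)
  then have "refl_mat n V *\<^sub>v (u + ?c \<cdot>\<^sub>v V) = u + ?c \<cdot>\<^sub>v V + (- 2 * (- hform n u V) / hform n V V) \<cdot>\<^sub>v V"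
    using V u by (subst refl_mat_mult_vec) auto
  also have "\<dots> = u" using V u by (intro eq_vecI) auto
  finally show ?thesis using V u by (simp add: refl_mat_mult_vec)
qed

lemma mat_eq_one_if_mult_vec:
  assumes A: "A \<in> carrier_mat m m" and "\<And>u. u \<in> carrier_vec m \<Longrightarrow> A *\<^sub>v u = (u :: complex vec)"
  shows "A = 1\<^sub>m m"
proof (rule eq_matI)
  fix i j assume "i < dim_row (1\<^sub>m m :: complex mat)" "j < dim_col (1\<^sub>m m :: complex mat)"
  then have ij: "i < m" "j < m" by auto
  have "(A *\<^sub>v unit_vec m j) $ i = unit_vec m j $ i" using assms(2)[of "unit_vec m j"] by simp
  moreover have "(A *\<^sub>v unit_vec m j) $ i = A $$ (i, j)" using ij A by simp
  moreover have "unit_vec m j $ i = 1\<^sub>m m $$ (i, j)" using ij by simp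
  ultimately show "A $$ (i, j) = 1\<^sub>m m $$ (i, j)" by simp
qed (use A in auto)

text \<open>The change of the form cancels because <V, V> is real. The determinant squares to 1
  since the reflection is an involution.\<close>

lemma refl_mat_U_n1:
  assumes V: "V \<in> carrier_vec (n+1)" and V0: "hform n V V \<noteq> 0"
  shows "refl_mat n V \<in> U_n1 n"
proof -
  let ?R = "refl_mat n V"
  have real: "cnj (hform n V V) = hform n V V" by (rule hform_cnj)
  have "hform n (?R *\<^sub>v u) (?R *\<^sub>v w) = hform n u w"
    if u: "u \<in> carrier_vec (n+1)" and w: "w \<in> carrier_vec (n+1)" for u w
  proof -
    have c: "cnj (hform n w V) = hform n V w" by (rule hform_cnj)
    show ?thesis
      using V u w V0
      by (simp add: refl_mat_mult_vec hform_lin real c divide_simps)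
  qed
  moreover have "cmod (Determinant.det ?R) = 1"
  proof -
    have "?R * ?R = 1\<^sub>m (n+1)"
    proof (rule mat_eq_one_if_mult_vec)
      fix u :: "complex vec" assume u: "u \<in> carrier_vec (n+1)"
      have "(?R * ?R) *\<^sub>v u = ?R *\<^sub>v (?R *\<^sub>v u)" by (rule assoc_mult_mat_vec[OF refl_mat_carrier(1) refl_mat_carrier(1) u])
      then show "(?R * ?R) *\<^sub>v u = u" using refl_mat_involution[OF V u V0] by simp
    qed (rule mult_carrier_mat[OF refl_mat_carrier(1) refl_mat_carrier(1)])
    moreover have "Determinant.det (?R * ?R) = Determinant.det ?R * Determinant.det ?R"
      by (rule det_mult[OF refl_mat_carrier(1) refl_mat_carrier(1)])
    ultimately have "Determinant.det ?R * Determinant.det ?R = 1" by simp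
    then have "cmod (Determinant.det ?R) * cmod (Determinant.det ?R) = 1" by (metis norm_mult norm_one)
    then show ?thesis using norm_ge_zero[of "Determinant.det ?R"]
      by (metis abs_norm_cancel real_sqrt_abs2 real_sqrt_one)
  qed
  ultimately show ?thesis by (simp add: U_n1_def)
qed

definition basept :: "nat \<Rightarrow> complex vec" where
  "basept n = unit_vec (n+1) n"

lemma basept_carrier [simp]: "basept n \<in> carrier_vec (n+1)" "basept n \<in> carrier_vec (Suc n)"
  by (auto simp: basept_def)

lemma basept_index [simp]: "basept n $ n = 1"
  by (simp add: basept_def)

lemma hform_basept_right: "hform n u (basept n) = - u $ n"
  by (simp add: hform_def basept_def)

lemma hform_basept_left: "hform n (basept n) u = - cnj (u $ n)"
  by (simp add: hform_def basept_def)

text \<open>The reflection in \<open>basept n + U\<close> exchanges \<open>basept n\<close> and \<open>-U\<close>; it reduces the reproducing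
  property at \<open>U\<close> to the mean value property at the origin.\<close>

lemma reproducing_hyp_vol:
  fixes U P :: "complex vec"
  assumes N: "n + 2 \<le> N" and U: "U \<in> carrier_vec (n+1)" "hform n U U = -1" "U $ n = of_real t" "0 < t"
    and P: "P \<in> carrier_vec (n+1)" "0 < hq n P"
  shows "(\<integral>z. inverse (- hform n (lift n z) P) ^ N * cnj (inverse (- hform n (lift n z) U) ^ N)
       * of_real ((1 - nsq n z) ^ N) \<partial>hyp_vol n)
     = of_real (omega n N) * inverse (- hform n U P) ^ N"
proof -
  let ?h = "\<lambda>z. inverse (- hform n (lift n z) P) ^ N * cnj (inverse (- hform n (lift n z) U) ^ N) * complex_of_real ((1 - nsq n z) ^ N)"
  \<comment> \<open>The reflection needs <V, V> to be nonzero. With U_n = t this number is -2 - 2t,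
    and t > 0 keeps it negative.\<close>
  define V where "V = basept n + U"
  define R where "R = refl_mat n V"
  define Q where "Q = R *\<^sub>v P"
  have Vc: "V \<in> carrier_vec (n+1)" using U by (simp add: V_def)
  have VV: "hform n V V = - 2 - 2 * of_real t"
    using U by (simp add: V_def hform_lin hform_basept_left hform_basept_right)
  have V0: "hform n V V \<noteq> 0"
  proof
    assume "hform n V V = 0"
    then have "complex_of_real (- 2 - 2 * t) = 0" by (simp add: VV)
    then have "- 2 - 2 * t = 0" by (simp only: of_real_eq_0_iff)
    then show False using U(4) by simp
  qed
  have RU: "R \<in> U_n1 n" unfolding R_def by (rule refl_mat_U_n1[OF Vc V0])
  have Rc: "R \<in> carrier_mat (n+1) (n+1)" by (simp add: R_def)
  have Qc: "Q \<in> carrier_vec (n+1)" using Rc P by (simp add: Q_def)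
  have inv: "hform n (R *\<^sub>v u) w = hform n u (R *\<^sub>v w)" if "u \<in> carrier_vec (n+1)" "w \<in> carrier_vec (n+1)" for u w
  proof -
    have "hform n (R *\<^sub>v u) (R *\<^sub>v (R *\<^sub>v w)) = hform n u (R *\<^sub>v w)"
      by (rule U_n1_hform[OF RU]) (use that Rc in auto)
    then show ?thesis using refl_mat_involution[OF Vc that(2) V0] by (simp add: R_def)
  qed
  have Re: "R *\<^sub>v basept n = - 1 \<cdot>\<^sub>v U"
  proof -
    have eV: "hform n (basept n) V = - 1 - of_real t"
      using U by (simp add: V_def hform_lin hform_basept_left)
    have "- 2 * hform n (basept n) V / hform n V V = - 1" using V0 unfolding eV VV by (simp add: field_simps)
    then have "R *\<^sub>v basept n = basept n + (- 1) \<cdot>\<^sub>v V"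
      unfolding R_def using refl_mat_mult_vec[OF Vc basept_carrier(1)] by simp
    also have "\<dots> = - 1 \<cdot>\<^sub>v U" using U by (intro eq_vecI) (auto simp: V_def basept_def)
    finally show ?thesis .
  qed
  have Qn: "cnj (Q $ n) = hform n U P"
  proof -
    have "- cnj (Q $ n) = hform n (basept n) (R *\<^sub>v P)" by (simp add: hform_basept_left Q_def)
    also have "\<dots> = hform n (R *\<^sub>v basept n) P" by (rule inv[symmetric]) (use P in auto)
    also have "\<dots> = - hform n U P" using U by (simp add: Re hform_lin)
    finally show ?thesis by simp
  qed
  have hQ: "0 < hq n Q" unfolding Q_def using U_n1_hq[OF RU P(1)] P(2) by simp
  have Q0: "Q $ n \<noteq> 0" using hq_nonneg_imp_nz[OF hQ] .
  \<comment> \<open>The affine point below Q. It lies in the ball, so the kernel at Q is a constant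
    times a power of 1 - <z, a>, the shape treated by the mean value lemma.\<close>
  define a where "a j = Q $ j / Q $ n" for j
  have a1: "nsq n a < 1"
  proof -
    have "nsq n a = vsq n Q / (cmod (Q $ n))\<^sup>2"
      by (simp add: nsq_def a_def norm_divide power_divide sum_divide_distrib)
    also have "\<dots> < 1" using hQ Q0 by (simp add: hq_def divide_less_eq)
    finally show ?thesis .
  qed
  have hZQ: "- hform n (lift n z) Q = cnj (Q $ n) * (1 - (\<Sum>j<n. z j * cnj (a j)))" for z
  proof -
    have "(\<Sum>j<n. z j * cnj (a j)) * cnj (Q $ n) = (\<Sum>j<n. z j * cnj (Q $ j))"
      unfolding sum_distrib_right using Q0 by (intro sum.cong) (auto simp: a_def)
    then show ?thesis by (simp add: hform_def algebra_simps)
  qed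
  have meas: "?h \<in> borel_measurable (vol_e n)"
    by measurable
  have "(\<integral>z. ?h z \<partial>hyp_vol n) = (\<integral>z. ?h (mob n R z) \<partial>hyp_vol n)"
    by (rule integral_hyp_vol_mob[OF RU meas, symmetric])
  also have "\<dots> = (\<integral>z. (inverse (- cnj (Q $ n)) ^ N) * (inverse (1 - (\<Sum>j<n. z j * cnj (a j))) ^ N * of_real ((1 - nsq n z) ^ N)) \<partial>hyp_vol n)"
  proof (rule integral_cong_AE)
    show "(\<lambda>z. ?h (mob n R z)) \<in> borel_measurable (hyp_vol n)"
      using measurable_compose[OF mob_measurable meas] by simp
    show "AE z in hyp_vol n. ?h (mob n R z) = (inverse (- cnj (Q $ n)) ^ N) * (inverse (1 - (\<Sum>j<n. z j * cnj (a j))) ^ N * of_real ((1 - nsq n z) ^ N))"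
      using AE_hyp_vol_ball
    proof eventually_elim
      case (elim z)
      define d where "d = denom n R z"
      have d0: "d \<noteq> 0" unfolding d_def by (rule denom_nz[OF RU elim])
      have L: "d * hform n (lift n (mob n R z)) w = hform n (lift n z) (R *\<^sub>v w)" if "w \<in> carrier_vec (n+1)" for w
      proof -
        have "hform n (R *\<^sub>v lift n z) w = d * hform n (lift n (mob n R z)) w"
          unfolding mult_lift[OF RU elim] d_def by (rule hform_smult_left) simp
        then show ?thesis using inv[OF lift_carrier(1) that, of z] by simp
      qed
      have RU': "R *\<^sub>v U = - 1 \<cdot>\<^sub>v basept n"
      proof -
        have "R *\<^sub>v (R *\<^sub>v basept n) = basept n"
          unfolding R_def by (rule refl_mat_involution[OF Vc basept_carrier(1) V0])
        then have "- 1 \<cdot>\<^sub>v (R *\<^sub>v U) = basept n" using Rc U unfolding Re by (simp add: mult_mat_vec)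
        then have "- 1 \<cdot>\<^sub>v (- 1 \<cdot>\<^sub>v (R *\<^sub>v U)) = - 1 \<cdot>\<^sub>v basept n" by simp
        then show ?thesis by (simp add: smult_smult_assoc)
      qed
      \<comment> \<open>Since R sends U to minus the base vector, the factor belonging to U becomes
        a power of -conj d. Together with the power of d coming from P it cancels the |d|^2 in the
        transformed weight, so no antiholomorphic dependence remains.\<close>
      have 1: "d * hform n (lift n (mob n R z)) U = 1"
        unfolding L[OF U(1)] RU' by (simp add: hform_lin hform_basept_right)
      have "1 - nsq n (mob n R z) = (1 - nsq n z) / (cmod d)\<^sup>2"
        using one_minus_nsq_mob[OF RU elim] d0 by (simp add: d_def field_simps)
      then have 2: "complex_of_real (1 - nsq n (mob n R z)) = of_real (1 - nsq n z) * inverse (d * cnj d)"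
        by (simp add: complex_norm_square[symmetric] divide_inverse del: of_real_diff)
      have 3: "inverse (- hform n (lift n (mob n R z)) P) = d * inverse (- hform n (lift n z) Q)"
        unfolding L[OF P(1), folded Q_def, symmetric] using d0 by simp
      have 4: "inverse (- hform n (lift n (mob n R z)) U) = - d"
        using 1 by (metis inverse_unique mult.commute inverse_minus_eq)
      have "?h (mob n R z) = (inverse (- hform n (lift n (mob n R z)) P) * cnj (inverse (- hform n (lift n (mob n R z)) U)) * complex_of_real (1 - nsq n (mob n R z))) ^ N"
        unfolding power_mult_distrib complex_cnj_power of_real_power ..
      also have "\<dots> = (- (inverse (- hform n (lift n z) Q)) * of_real (1 - nsq n z)) ^ N"
      proof -
        have "d * q * cnj (- d) * (x * inverse (d * cnj d)) = - q * x" for q x :: complex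
          using d0 by (simp add: field_simps)
        then show ?thesis unfolding 2 3 4 by (rule arg_cong)
      qed
      also have "\<dots> = (inverse (- cnj (Q $ n)) ^ N) * (inverse (1 - (\<Sum>j<n. z j * cnj (a j))) ^ N * of_real ((1 - nsq n z) ^ N))"
        unfolding hZQ of_real_power power_mult_distrib[symmetric]
        by (rule arg_cong[where f="\<lambda>x. x ^ N"]) simp
      finally show ?case .
    qed
  qed measurable
  also have "\<dots> = inverse (- cnj (Q $ n)) ^ N * of_real (omega n N)"
    using mean_value_hyp_vol[OF N a1] by simp
  finally show ?thesis unfolding Qn by (simp add: mult.commute)
qed

section \<open>Unfolding over a lattice\<close>

lemma sigma_finite_hyp_vol: "sigma_finite_measure (hyp_vol n)"
proof -
  interpret sigma_finite_measure "vol_e n" by (rule sigma_finite_vol_e)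
  show ?thesis unfolding hyp_vol_def
    by (subst sigma_finite_iff_density_finite) (auto simp: indicator_def)
qed

lemma null_sets_hyp_vol: "S \<in> null_sets (vol_e n) \<Longrightarrow> S \<in> null_sets (hyp_vol n)"
  unfolding hyp_vol_def
  by (subst null_sets_density_iff) (auto intro: eventually_mono[OF AE_not_in])

text \<open>Discreteness isolates each matrix in an open set containing no other member of the
  group, and the Lindelof property extracts a countable subfamily. Matrices are sent to functions of
  two indices in order to use the product topology there.\<close>

lemma countable_discrete_mat:
  assumes G: "G \<subseteq> carrier_mat (n+1) (n+1)" and d: "discrete_mat n G"
  shows "countable G"
proof -
  define emb :: "complex mat \<Rightarrow> nat \<Rightarrow> nat \<Rightarrow> complex" where "emb A = (\<lambda>i j. A $$ (i, j))" for A
  have "\<exists>e>0. \<forall>B\<in>G. B \<noteq> A \<longrightarrow> (\<exists>i\<le>n. \<exists>j\<le>n. e \<le> cmod (B $$ (i,j) - A $$ (i,j)))" if "A \<in> G" for A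
    using d that by (auto simp: discrete_mat_def)
  then obtain e where e: "\<And>A. A \<in> G \<Longrightarrow> 0 < e A"
    "\<And>A B. A \<in> G \<Longrightarrow> B \<in> G \<Longrightarrow> B \<noteq> A \<Longrightarrow> \<exists>i\<le>n. \<exists>j\<le>n. e A \<le> cmod (B $$ (i,j) - A $$ (i,j))"
    by metis
  define O' where "O' A = (\<Inter>i\<in>{..n}. \<Inter>j\<in>{..n}. {h :: nat \<Rightarrow> nat \<Rightarrow> complex. cmod (h i j - A $$ (i,j)) < e A})" for A
  have op: "open (O' A)" for A
  proof -
    have c: "continuous_on UNIV (\<lambda>h :: nat \<Rightarrow> nat \<Rightarrow> complex. h i j)" for i j
      using continuous_on_compose2[OF continuous_on_product_coordinates[of j] continuous_on_product_coordinates[of i]]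
      by (simp add: continuous_on_def)
    show ?thesis unfolding O'_def
      by (intro open_INT finite_atMost ballI open_Collect_less continuous_intros c)
  qed
  have self: "emb A \<in> O' A" if "A \<in> G" for A using e(1)[OF that] by (simp add: O'_def emb_def)
  have uniq: "B = A" if AB: "A \<in> G" "B \<in> G" "emb B \<in> O' A" for A B
  proof (rule ccontr)
    assume "B \<noteq> A"
    then obtain i j where "i \<le> n" "j \<le> n" "e A \<le> cmod (B $$ (i,j) - A $$ (i,j))" using e(2)[OF AB(1,2)] by blast
    moreover have "cmod (B $$ (i,j) - A $$ (i,j)) < e A" using AB(3) calculation(1,2) by (auto simp: O'_def emb_def)
    ultimately show False by simp
  qed
  obtain \<F> where F: "\<F> \<subseteq> O' ` G" "countable \<F>" "\<Union>\<F> = \<Union>(O' ` G)"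
    using Lindelof[of "O' ` G"] op by blast
  obtain G' where G': "G' \<subseteq> G" "countable G'" "\<F> = O' ` G'"
    using countable_subset_image[of \<F> O' G] F(1,2) by blast
  have "G \<subseteq> G'"
  proof
    fix A assume A: "A \<in> G"
    then have "emb A \<in> \<Union>(O' ` G')" using self[OF A] F(3) G'(3) by blast
    then obtain B where B: "B \<in> G'" "emb A \<in> O' B" by blast
    then have "A = B" using uniq[of B A] G'(1) A by blast
    then show "A \<in> G'" using B by simp
  qed
  then show ?thesis using G'(2) countable_subset by blast
qed

lemma mat_nn_basept:
  assumes "A \<in> carrier_mat (n+1) (n+1)"
  shows "(A *\<^sub>v basept n) $ n = A $$ (n, n)"
  using assms by (simp add: basept_def)

lemma hq_basept: "hq n (basept n) = 1"
  by (simp add: hq_def nsq_def basept_def)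

lemma U_n1_nn_ge_1:
  assumes "A \<in> U_n1 n"
  shows "1 \<le> cmod (A $$ (n, n))"
proof -
  have "hq n (A *\<^sub>v basept n) = 1" using U_n1_hq[OF assms basept_carrier(1)] by (simp add: hq_basept)
  then have "1 \<le> (cmod (A $$ (n, n)))\<^sup>2"
    using nsq_nonneg[of n "vec_index (A *\<^sub>v basept n)"] unfolding hq_def mat_nn_basept[OF U_n1_carrier[OF assms]] by linarith
  then show ?thesis using power2_le_imp_le[of 1 "cmod (A $$ (n, n))"] by simp
qed

text \<open>Up to sign (A u)_n is <u, B e> with e the base vector and B the inverse of A, and B e
  has last coordinate conj A_nn. Hence |A_nn| measures the size of A on all negative vectors at
  once.\<close>

lemma U_n1_last_bounds:
  assumes A: "A \<in> U_n1 n" and B: "B \<in> U_n1 n" "B * A = 1\<^sub>m (n+1)"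
    and u: "u \<in> carrier_vec (n+1)" "0 < hq n u"
  shows "cmod (A $$ (n,n)) * hq n u / (2 * cmod (u $ n)) \<le> cmod ((A *\<^sub>v u) $ n)"
    and "cmod ((A *\<^sub>v u) $ n) \<le> 2 * cmod (u $ n) * cmod (A $$ (n,n))"
proof -
  note Ac = U_n1_carrier[OF A] and Bc = U_n1_carrier[OF B(1)]
  let ?w = "B *\<^sub>v basept n"
  have BA: "B *\<^sub>v (A *\<^sub>v x) = x" if "x \<in> carrier_vec (n+1)" for x
    using assoc_mult_mat_vec[OF Bc Ac that] B(2) that by simp
  have 1: "- (A *\<^sub>v u) $ n = hform n u ?w"
  proof -
    have "hform n (A *\<^sub>v u) (basept n) = hform n (B *\<^sub>v (A *\<^sub>v u)) (B *\<^sub>v basept n)"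
      by (rule U_n1_hform[OF B(1), symmetric]) (use Ac u in auto)
    then show ?thesis using BA[OF u(1)] by (simp add: hform_basept_right)
  qed
  have 2: "?w $ n = cnj (A $$ (n,n))"
  proof -
    have "- ?w $ n = hform n ?w (basept n)" by (simp add: hform_basept_right)
    also have "\<dots> = hform n ?w (B *\<^sub>v (A *\<^sub>v basept n))" by (simp add: BA)
    also have "\<dots> = hform n (basept n) (A *\<^sub>v basept n)" by (rule U_n1_hform[OF B(1)]) (use Ac in auto)
    also have "\<dots> = - cnj (A $$ (n,n))" by (simp only: hform_basept_left mat_nn_basept[OF Ac])
    finally show ?thesis by simp
  qed
  have 3: "hq n ?w = 1" using U_n1_hq[OF B(1) basept_carrier(1)] by (simp add: hq_basept)
  have 4: "cmod ((A *\<^sub>v u) $ n) = cmod (hform n u ?w)" unfolding 1[symmetric] by simp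
  show "cmod (A $$ (n,n)) * hq n u / (2 * cmod (u $ n)) \<le> cmod ((A *\<^sub>v u) $ n)"
    using hform_lower_hq[of n ?w u] u 3 unfolding 4 2 by simp
  show "cmod ((A *\<^sub>v u) $ n) \<le> 2 * cmod (u $ n) * cmod (A $$ (n,n))"
    using hform_upper[of n ?w u] u 3 unfolding 4 2 by simp
qed

text \<open>The kernel estimates come as products of a bound in the group element or the ball point
  and one in the other variable; this is the form in which Fubini consumes them.\<close>

lemma integrable_pair_bound:
  fixes f :: "'a \<times> 'b \<Rightarrow> complex"
  assumes s: "sigma_finite_measure M2" and f: "f \<in> borel_measurable (M1 \<Otimes>\<^sub>M M2)"
    and a: "integrable M1 a" and b: "integrable M2 b"
    and bound: "\<And>x y. x \<in> space M1 \<Longrightarrow> y \<in> space M2 \<Longrightarrow> cmod (f (x, y)) \<le> a x * b y"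
  shows "integrable (M1 \<Otimes>\<^sub>M M2) f"
proof (rule integrableI_bounded[OF f])
  interpret sigma_finite_measure M2 by (rule s)
  have [measurable]: "a \<in> borel_measurable M1" "b \<in> borel_measurable M2" using a b by auto
  have "(\<integral>\<^sup>+p. ennreal (norm (f p)) \<partial>(M1 \<Otimes>\<^sub>M M2)) \<le> (\<integral>\<^sup>+p. ennreal (norm (a (fst p))) * ennreal (norm (b (snd p))) \<partial>(M1 \<Otimes>\<^sub>M M2))"
  proof (rule nn_integral_mono)
    fix p assume "p \<in> space (M1 \<Otimes>\<^sub>M M2)"
    then have "cmod (f (fst p, snd p)) \<le> a (fst p) * b (snd p)" by (intro bound) (auto simp: space_pair_measure)
    also have "\<dots> \<le> \<bar>a (fst p) * b (snd p)\<bar>" by (rule abs_ge_self)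
    finally show "ennreal (norm (f p)) \<le> ennreal (norm (a (fst p))) * ennreal (norm (b (snd p)))"
      by (simp add: ennreal_mult[symmetric] abs_mult ennreal_leI)
  qed
  also have "\<dots> = (\<integral>\<^sup>+x. \<integral>\<^sup>+y. ennreal (norm (a x)) * ennreal (norm (b y)) \<partial>M2 \<partial>M1)"
    by (subst nn_integral_fst[symmetric]) auto
  also have "\<dots> = (\<integral>\<^sup>+x. ennreal (norm (a x)) \<partial>M1) * (\<integral>\<^sup>+y. ennreal (norm (b y)) \<partial>M2)"
    by (simp add: nn_integral_cmult nn_integral_multc)
  also have "\<dots> < \<infinity>"
    using a b by (auto simp: integrable_iff_bounded ennreal_mult_less_top)
  finally show "(\<integral>\<^sup>+p. ennreal (norm (f p)) \<partial>(M1 \<Otimes>\<^sub>M M2)) < \<infinity>" .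
qed

locale ball_lattice =
  fixes n :: nat and G :: "complex mat set" and F :: "(nat \<Rightarrow> complex) set"
  assumes G: "subgroup_SU n G" "discrete_mat n G" and F: "fund_domain n G F"
begin

lemma G_U_n1: "A \<in> G \<Longrightarrow> A \<in> U_n1 n"
  using G(1) SU_n1_subset_U_n1[of n] by (auto simp: subgroup_SU_def)

lemma G_carrier: "A \<in> G \<Longrightarrow> A \<in> carrier_mat (n+1) (n+1)"
  using G_U_n1 U_n1_carrier by blast

lemma G_mult: "A \<in> G \<Longrightarrow> B \<in> G \<Longrightarrow> A * B \<in> G"
  using G(1) by (auto simp: subgroup_SU_def)

lemma G_one: "1\<^sub>m (n+1) \<in> G"
  using G(1) by (simp add: subgroup_SU_def)

lemma countable_G: "countable G"
  by (rule countable_discrete_mat[OF _ G(2)]) (use G_carrier in blast)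

definition minv :: "complex mat \<Rightarrow> complex mat" where
  "minv A = (SOME B. B \<in> G \<and> B * A = 1\<^sub>m (n+1))"

lemma minv:
  assumes "A \<in> G"
  shows "minv A \<in> G" "minv A * A = 1\<^sub>m (n+1)" "A * minv A = 1\<^sub>m (n+1)"
proof -
  have "\<exists>B. B \<in> G \<and> B * A = 1\<^sub>m (n+1)" using G(1) assms by (auto simp: subgroup_SU_def)
  then have *: "minv A \<in> G \<and> minv A * A = 1\<^sub>m (n+1)" unfolding minv_def by (rule someI_ex)
  then show "minv A \<in> G" "minv A * A = 1\<^sub>m (n+1)" by auto
  then show "A * minv A = 1\<^sub>m (n+1)"
    using mat_mult_left_right_inverse[OF G_carrier G_carrier[OF assms]] by blast
qed

lemma minv_cancel:
  assumes "A \<in> G" "u \<in> carrier_vec (n+1)"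
  shows "minv A *\<^sub>v (A *\<^sub>v u) = u" "A *\<^sub>v (minv A *\<^sub>v u) = u"
  using assoc_mult_mat_vec[OF G_carrier[OF minv(1)[OF assms(1)]] G_carrier[OF assms(1)] assms(2)]
    assoc_mult_mat_vec[OF G_carrier[OF assms(1)] G_carrier[OF minv(1)[OF assms(1)]] assms(2)] minv[OF assms(1)] assms(2)
  by simp_all

lemma mob_minv:
  assumes "A \<in> G" "z \<in> ball_n n"
  shows "mob n (minv A) (mob n A z) = z" "mob n A (mob n (minv A) z) = z"
  using mob_mult[OF G_U_n1[OF minv(1)[OF assms(1)]] G_U_n1[OF assms(1)] assms(2)]
    mob_mult[OF G_U_n1[OF assms(1)] G_U_n1[OF minv(1)[OF assms(1)]] assms(2)]
    mob_one[OF ball_in_cpts[OF assms(2)]] minv[OF assms(1)] by simp_all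

lemma F_sets [measurable]: "F \<in> sets (vol_e n)" and F_ball: "F \<subseteq> ball_n n"
  using F by (auto simp: fund_domain_def)

text \<open>Translates of F overlap only in null sets, and countability of the group keeps the union
  of all overlaps null.\<close>

lemma AE_unique_translate: "AE w in hyp_vol n. \<exists>!A. A \<in> G \<and> mob n (minv A) w \<in> F"
proof -
  have "\<exists>N. N \<in> null_sets (vol_e n) \<and> (A \<noteq> B \<longrightarrow> mob n A ` F \<inter> mob n B ` F \<subseteq> N)" if "A \<in> G" "B \<in> G" for A B
    using F that unfolding fund_domain_def by (cases "A = B") (auto intro: exI[of _ "{}"])
  then obtain N where N: "\<And>A B. A \<in> G \<Longrightarrow> B \<in> G \<Longrightarrow> N A B \<in> null_sets (vol_e n)"
    "\<And>A B. A \<in> G \<Longrightarrow> B \<in> G \<Longrightarrow> A \<noteq> B \<Longrightarrow> mob n A ` F \<inter> mob n B ` F \<subseteq> N A B" by metis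
  have "(\<Union>A\<in>G. \<Union>B\<in>G. N A B) \<in> null_sets (vol_e n)"
    using countable_G N(1) by (intro null_sets_UN') auto
  then have "AE w in hyp_vol n. w \<notin> (\<Union>A\<in>G. \<Union>B\<in>G. N A B)"
    by (intro AE_not_in null_sets_hyp_vol)
  then show ?thesis using AE_hyp_vol_ball
  proof eventually_elim
    case (elim w)
    have iff: "mob n (minv A) w \<in> F \<longleftrightarrow> w \<in> mob n A ` F" if "A \<in> G" for A
    proof
      assume "mob n (minv A) w \<in> F"
      then show "w \<in> mob n A ` F" using mob_minv(2)[OF that elim(2)] by (metis imageI)
    next
      assume "w \<in> mob n A ` F"
      then obtain z where "z \<in> F" "w = mob n A z" by blast
      then show "mob n (minv A) w \<in> F" using mob_minv(1)[OF that] F_ball by auto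
    qed
    obtain A where A: "A \<in> G" "w \<in> mob n A ` F" using F elim(2) by (auto simp: fund_domain_def)
    show ?case
    proof (rule ex1I[of _ A])
      fix B assume B: "B \<in> G \<and> mob n (minv B) w \<in> F"
      show "B = A"
      proof (rule ccontr)
        assume "B \<noteq> A"
        then have "w \<in> N B A" using N(2)[of B A] A B iff by blast
        then show False using elim(1) A B by blast
      qed
    qed (use A iff in auto)
  qed
qed

definition hypF :: "(nat \<Rightarrow> complex) measure" where
  "hypF = density (hyp_vol n) (indicator F)"

lemma sets_hypF [simp, measurable_cong]: "sets hypF = sets (vol_e n)"
  by (simp add: hypF_def)

lemma sigma_finite_hypF: "sigma_finite_measure hypF"
proof -
  interpret sigma_finite_measure "hyp_vol n" by (rule sigma_finite_hyp_vol)
  show ?thesis unfolding hypF_def by (subst sigma_finite_iff_density_finite) (auto simp: indicator_def)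
qed

lemma mob_pair_measurable [measurable]: "(\<lambda>p. mob n (fst p) (snd p)) \<in> count_space G \<Otimes>\<^sub>M hypF \<rightarrow>\<^sub>M vol_e n"
  by (rule measurable_pair_measure_countable1[OF countable_G]) simp

text \<open>By invariance the term of A is the integral of f over the translate A F. Summed over A,
  the indicators of these translates give 1 almost everywhere.\<close>

lemma nn_integral_unfold:
  assumes f[measurable]: "f \<in> borel_measurable (vol_e n)"
  shows "(\<integral>\<^sup>+p. f (mob n (fst p) (snd p)) \<partial>(count_space G \<Otimes>\<^sub>M hypF)) = (\<integral>\<^sup>+w. f w \<partial>hyp_vol n)"
proof -
  interpret sigma_finite_measure hypF by (rule sigma_finite_hypF)
  have "(\<integral>\<^sup>+p. f (mob n (fst p) (snd p)) \<partial>(count_space G \<Otimes>\<^sub>M hypF)) = (\<integral>\<^sup>+A. \<integral>\<^sup>+z. f (mob n A z) \<partial>hypF \<partial>count_space G)"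
    by (subst nn_integral_fst[symmetric]) auto
  also have "\<dots> = (\<integral>\<^sup>+A. \<integral>\<^sup>+w. indicator F (mob n (minv A) w) * f w \<partial>hyp_vol n \<partial>count_space G)"
  proof (rule nn_integral_cong)
    fix A assume "A \<in> space (count_space G)"
    then have A: "A \<in> G" by simp
    have "(\<integral>\<^sup>+z. f (mob n A z) \<partial>hypF) = (\<integral>\<^sup>+z. indicator F z * f (mob n A z) \<partial>hyp_vol n)"
      unfolding hypF_def by (rule nn_integral_density) auto
    also have "\<dots> = (\<integral>\<^sup>+w. indicator F (mob n (minv A) w) * f (mob n A (mob n (minv A) w)) \<partial>hyp_vol n)"
      by (rule hyp_vol_mob[symmetric, OF G_U_n1[OF minv(1)[OF A]]]) measurable
    also have "\<dots> = (\<integral>\<^sup>+w. indicator F (mob n (minv A) w) * f w \<partial>hyp_vol n)"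
      by (rule nn_integral_cong_AE) (use AE_hyp_vol_ball[of n] mob_minv(2)[OF A] in \<open>auto elim!: eventually_mono\<close>)
    finally show "(\<integral>\<^sup>+z. f (mob n A z) \<partial>hypF) = (\<integral>\<^sup>+w. indicator F (mob n (minv A) w) * f w \<partial>hyp_vol n)" .
  qed
  also have "\<dots> = (\<integral>\<^sup>+w. \<integral>\<^sup>+A. indicator F (mob n (minv A) w) * f w \<partial>count_space G \<partial>hyp_vol n)"
    by (rule nn_integral_count_space_nn_integral[OF countable_G, symmetric]) measurable
  also have "\<dots> = (\<integral>\<^sup>+w. f w \<partial>hyp_vol n)"
  proof (rule nn_integral_cong_AE)
    show "AE w in hyp_vol n. (\<integral>\<^sup>+A. indicator F (mob n (minv A) w) * f w \<partial>count_space G) = f w"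
      using AE_unique_translate
    proof eventually_elim
      case (elim w)
      then obtain B where B: "B \<in> G" "mob n (minv B) w \<in> F" "\<And>A. A \<in> G \<Longrightarrow> mob n (minv A) w \<in> F \<Longrightarrow> A = B" by blast
      have "(\<integral>\<^sup>+A. indicator F (mob n (minv A) w) * f w \<partial>count_space G) = (\<integral>\<^sup>+A. f w * indicator {B} A \<partial>count_space G)"
      proof (rule nn_integral_cong)
        fix A assume "A \<in> space (count_space G)"
        then have "A = B \<longleftrightarrow> mob n (minv A) w \<in> F" using B(2) B(3)[of A] by auto
        then show "indicator F (mob n (minv A) w) * f w = f w * indicator {B} A"
          by (simp add: indicator_def)
      qed
      also have "\<dots> = f w * emeasure (count_space G) {B}"
        by (rule nn_integral_cmult_indicator) (use B(1) in auto)
      finally show ?case using B(1) by simp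
    qed
  qed
  finally show ?thesis .
qed

text \<open>Unfolding as an identity of measures, which transfers it to integrability and to complex
  integrands.\<close>

lemma distr_unfold: "distr (count_space G \<Otimes>\<^sub>M hypF) (vol_e n) (\<lambda>p. mob n (fst p) (snd p)) = hyp_vol n"
proof (rule measure_eqI)
  let ?D = "distr (count_space G \<Otimes>\<^sub>M hypF) (vol_e n) (\<lambda>p. mob n (fst p) (snd p))"
  fix S assume "S \<in> sets ?D"
  then have S[measurable]: "S \<in> sets (vol_e n)" by simp
  have "emeasure ?D S = (\<integral>\<^sup>+z. indicator S z \<partial>?D)" by simp
  also have "\<dots> = (\<integral>\<^sup>+p. indicator S (mob n (fst p) (snd p)) \<partial>(count_space G \<Otimes>\<^sub>M hypF))"
    by (rule nn_integral_distr) measurable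
  also have "\<dots> = (\<integral>\<^sup>+z. indicator S z \<partial>hyp_vol n)" by (rule nn_integral_unfold) measurable
  finally show "emeasure ?D S = emeasure (hyp_vol n) S" by simp
qed simp

text \<open>The finite mass of (1 - |z|^2)^(n+2) unfolds into a sum over the group. Since 1 - |A
  z|^2 = (1 - |z|^2) / |denom|^2 and |denom| <= 2 |A_nn|, the term of A is at least I / (4
  |A_nn|^2)^(n+2), where I is the integral over F.\<close>

lemma integrable_inverse_nn:
  "integrable (count_space G) (\<lambda>A. inverse (cmod (A $$ (n,n))) ^ (2 * (n+2)))"
proof (rule integrableI_bounded)
  interpret sigma_finite_measure hypF by (rule sigma_finite_hypF)
  let ?M = "n + 2"
  define I where "I = (\<integral>\<^sup>+z. ennreal ((1 - nsq n z) ^ ?M) \<partial>hypF)"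
  have AEF: "AE z in hypF. z \<in> ball_n n"
    unfolding hypF_def by (subst AE_density) (use F_ball in \<open>auto simp: indicator_def\<close>)
  have om: "(\<integral>\<^sup>+w. ennreal ((1 - nsq n w) ^ ?M) \<partial>hyp_vol n) = ennreal (omega n ?M)"
    by (rule nn_integral_hyp_vol_power) simp
  have unf: "(\<integral>\<^sup>+A. \<integral>\<^sup>+z. ennreal ((1 - nsq n (mob n A z)) ^ ?M) \<partial>hypF \<partial>count_space G) = ennreal (omega n ?M)"
  proof -
    have "(\<integral>\<^sup>+A. \<integral>\<^sup>+z. ennreal ((1 - nsq n (mob n A z)) ^ ?M) \<partial>hypF \<partial>count_space G)
      = (\<integral>\<^sup>+p. ennreal ((1 - nsq n (mob n (fst p) (snd p))) ^ ?M) \<partial>(count_space G \<Otimes>\<^sub>M hypF))"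
      by (subst nn_integral_fst[symmetric]) auto
    also have "\<dots> = (\<integral>\<^sup>+w. ennreal ((1 - nsq n w) ^ ?M) \<partial>hyp_vol n)"
      by (rule nn_integral_unfold) measurable
    finally show ?thesis using om by simp
  qed
  \<comment> \<open>If I were 0, the measure on F would be null and every unfolded term would
    vanish, although the terms add up to the positive number omega.\<close>
  have I0: "I \<noteq> 0"
  proof
    assume "I = 0"
    then have "AE z in hypF. ennreal ((1 - nsq n z) ^ ?M) = 0"
      unfolding I_def by (subst (asm) nn_integral_0_iff_AE) auto
    then have "AE z in hypF. False" using AEF
    proof eventually_elim
      case (elim z)
      then have "0 < (1 - nsq n z) ^ ?M" by (simp add: ball_n_alt)
      then show ?case using elim(1) by (metis ennreal_eq_0_iff not_less)
    qed
    then have "(\<integral>\<^sup>+z. ennreal ((1 - nsq n (mob n A z)) ^ ?M) \<partial>hypF) = 0" for A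
      by (subst nn_integral_0_iff_AE) (auto elim: eventually_mono)
    then have "ennreal (omega n ?M) = 0" using unf by simp
    then show False using omega_pos[of n ?M] by (simp add: ennreal_eq_0_iff)
  qed
  have pt: "ennreal (inverse (cmod (A $$ (n,n))) ^ (2 * ?M)) * I \<le> ennreal (4 ^ ?M) * (\<integral>\<^sup>+z. ennreal ((1 - nsq n (mob n A z)) ^ ?M) \<partial>hypF)"
    if A: "A \<in> G" for A
  proof -
    let ?a = "cmod (A $$ (n,n))"
    have a1: "1 \<le> ?a" by (rule U_n1_nn_ge_1[OF G_U_n1[OF A]])
    have "ennreal (inverse ?a ^ (2 * ?M)) * I = (\<integral>\<^sup>+z. ennreal (inverse ?a ^ (2 * ?M)) * ennreal ((1 - nsq n z) ^ ?M) \<partial>hypF)"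
      unfolding I_def by (rule nn_integral_cmult[symmetric]) measurable
    also have "\<dots> \<le> (\<integral>\<^sup>+z. ennreal (4 ^ ?M) * ennreal ((1 - nsq n (mob n A z)) ^ ?M) \<partial>hypF)"
    proof (rule nn_integral_mono_AE)
      show "AE z in hypF. ennreal (inverse ?a ^ (2 * ?M)) * ennreal ((1 - nsq n z) ^ ?M) \<le> ennreal (4 ^ ?M) * ennreal ((1 - nsq n (mob n A z)) ^ ?M)"
        using AEF
      proof eventually_elim
        case (elim z)
        let ?d = "cmod (denom n A z)"
        have d: "?d \<le> 2 * ?a"
          using U_n1_last_bounds(2)[OF G_U_n1[OF A] G_U_n1[OF minv(1)[OF A]] minv(2)[OF A] lift_carrier(1) ball_hq_lift[OF elim]]
          by (simp add: mult_lift_last[OF G_carrier[OF A]])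
        have "1 - nsq n z = ?d\<^sup>2 * (1 - nsq n (mob n A z))" by (rule one_minus_nsq_mob[OF G_U_n1[OF A] elim])
        also have "\<dots> \<le> (2 * ?a)\<^sup>2 * (1 - nsq n (mob n A z))"
          using d mob_in_ball[OF G_U_n1[OF A] elim] by (intro mult_right_mono power_mono) (auto simp: ball_n_alt)
        finally have "inverse ?a ^ 2 * (1 - nsq n z) \<le> inverse ?a ^ 2 * ((2 * ?a)\<^sup>2 * (1 - nsq n (mob n A z)))"
          by (rule mult_left_mono) simp
        also have "inverse ?a ^ 2 * ((2 * ?a)\<^sup>2 * y) = 4 * y" for y
        proof -
          have "inverse ?a * ?a = 1" using a1 by (intro left_inverse) auto
          then have "(inverse ?a * ?a)\<^sup>2 * 4 * y = 4 * y" by simp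
          then show ?thesis by (simp only: power_mult_distrib ac_simps) simp
        qed
        finally have "inverse ?a ^ 2 * (1 - nsq n z) \<le> 4 * (1 - nsq n (mob n A z))" .
        then have "(inverse ?a ^ 2 * (1 - nsq n z)) ^ ?M \<le> (4 * (1 - nsq n (mob n A z))) ^ ?M"
          using elim by (intro power_mono) (auto simp: ball_n_alt)
        then have "inverse ?a ^ (2 * ?M) * (1 - nsq n z) ^ ?M \<le> 4 ^ ?M * (1 - nsq n (mob n A z)) ^ ?M"
          by (simp only: power_mult_distrib power_mult)
        then show ?case by (subst (1 2) ennreal_mult'[symmetric]) (auto intro!: ennreal_leI)
      qed
    qed
    also have "\<dots> = ennreal (4 ^ ?M) * (\<integral>\<^sup>+z. ennreal ((1 - nsq n (mob n A z)) ^ ?M) \<partial>hypF)"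
      by (rule nn_integral_cmult) measurable
    finally show ?thesis .
  qed
  have "(\<integral>\<^sup>+A. ennreal (inverse (cmod (A $$ (n,n))) ^ (2 * ?M)) \<partial>count_space G) * I
     = (\<integral>\<^sup>+A. ennreal (inverse (cmod (A $$ (n,n))) ^ (2 * ?M)) * I \<partial>count_space G)"
    by (rule nn_integral_multc[symmetric]) simp
  also have "\<dots> \<le> (\<integral>\<^sup>+A. ennreal (4 ^ ?M) * (\<integral>\<^sup>+z. ennreal ((1 - nsq n (mob n A z)) ^ ?M) \<partial>hypF) \<partial>count_space G)"
    by (rule nn_integral_mono) (use pt in simp)
  also have "\<dots> = ennreal (4 ^ ?M) * (\<integral>\<^sup>+A. \<integral>\<^sup>+z. ennreal ((1 - nsq n (mob n A z)) ^ ?M) \<partial>hypF \<partial>count_space G)"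
    by (rule nn_integral_cmult) simp
  also have "\<dots> < \<infinity>"
    unfolding unf infinity_ennreal_def by (rule ennreal_mult_less_top[THEN iffD2]) (simp only: ennreal_less_top simp_thms)
  finally have "(\<integral>\<^sup>+A. ennreal (inverse (cmod (A $$ (n,n))) ^ (2 * ?M)) \<partial>count_space G) * I < \<infinity>" .
  then have "(\<integral>\<^sup>+A. ennreal (inverse (cmod (A $$ (n,n))) ^ (2 * ?M)) \<partial>count_space G) < \<infinity>"
    unfolding infinity_ennreal_def ennreal_mult_less_top using I0 by (elim disjE) simp_all
  then show "(\<integral>\<^sup>+A. ennreal (norm (inverse (cmod (A $$ (n,n))) ^ (2 * ?M))) \<partial>count_space G) < \<infinity>"
    by simp
qed simp

text \<open>A convergent series of positive terms has only finitely many terms above a given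
  positive level.\<close>

lemma finite_nn_le: "finite {A \<in> G. cmod (A $$ (n,n)) \<le> R}"
proof -
  let ?S = "{A \<in> G. cmod (A $$ (n,n)) \<le> R}"
  define p where "p = 2 * (n + 2)"
  define e where "e = inverse (max R 1) ^ p"
  have e: "0 < e" by (simp add: e_def)
  have "ennreal e * emeasure (count_space G) ?S = (\<integral>\<^sup>+A. ennreal e * indicator ?S A \<partial>count_space G)"
    by (rule nn_integral_cmult_indicator[symmetric]) auto
  also have "\<dots> \<le> (\<integral>\<^sup>+A. ennreal (norm (inverse (cmod (A $$ (n,n))) ^ p)) \<partial>count_space G)"
  proof (rule nn_integral_mono)
    fix A assume "A \<in> space (count_space G)"
    then have "1 \<le> cmod (A $$ (n,n))" using U_n1_nn_ge_1[OF G_U_n1] by simp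
    then show "ennreal e * indicator ?S A \<le> ennreal (norm (inverse (cmod (A $$ (n,n))) ^ p))"
      by (auto simp: indicator_def e_def norm_power intro!: ennreal_leI power_mono le_imp_inverse_le)
  qed
  also have "\<dots> < \<infinity>" using integrable_inverse_nn by (simp add: integrable_iff_bounded p_def)
  finally have "emeasure (count_space G) ?S < \<infinity>"
    using e by (auto simp: ennreal_mult_less_top less_top[symmetric] ennreal_mult_eq_top_iff)
  then show ?thesis using emeasure_count_space[of ?S G] by (auto split: if_splits)
qed

end

section \<open>The inner product of theta series\<close>

lemma mult_lift_measurable:
  assumes "A \<in> carrier_mat (n+1) (n+1)" "i \<le> n"
  shows "(\<lambda>z. (A *\<^sub>v lift n z) $ i) \<in> borel_measurable (vol_e n)"
  unfolding mult_lift_index[OF assms] vol_e_def by measurable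

lemma cmod_integral_le_const:
  fixes f :: "'a \<Rightarrow> complex"
  assumes "finite_measure M" "\<And>x. cmod (f x) \<le> B"
  shows "cmod (\<integral>x. f x \<partial>M) \<le> B * measure M (space M)"
proof -
  interpret finite_measure M by fact
  have B: "0 \<le> B" using assms(2) norm_ge_zero order_trans by blast
  have "cmod (\<integral>x. f x \<partial>M) \<le> (\<integral>x. cmod (f x) \<partial>M)" by (rule integral_norm_bound)
  also have "\<dots> \<le> (\<integral>x. B \<partial>M)"
    using B assms(2) by (intro integral_mono_AE' ) auto
  finally show ?thesis by (simp add: mult.commute)
qed

text \<open>The geodesic enters only as a measurable family of unit negative vectors with bounded
  last coordinate and a finite measure on the parameter. The bound on N leaves 2(n+2) powers for
  convergence over the group and another 2(n+2) for integrability over the ball.\<close>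

locale theta_setup = ball_lattice +
  fixes T :: "real measure" and U :: "real \<Rightarrow> complex vec" and \<tau> :: "real \<Rightarrow> real" and Mx :: real and N :: nat
  assumes T: "finite_measure T" "sets T = sets borel"
    and U: "\<And>s. U s \<in> carrier_vec (n+1)" "\<And>s. hform n (U s) (U s) = -1"
    and \<tau>: "\<And>s. U s $ n = of_real (\<tau> s)" "\<And>s. 0 < \<tau> s" "\<And>s. \<tau> s \<le> Mx"
    and U_meas: "\<And>j. j \<le> n \<Longrightarrow> (\<lambda>s. U s $ j) \<in> borel_measurable borel"
    and N: "4 * (n + 2) \<le> N"
begin

sublocale T: finite_measure T by (rule T(1))

lemma sets_T [measurable_cong]: "sets T = sets borel" by (rule T(2))

lemma hq_U: "hq n (U s) = 1"
proof -
  have "complex_of_real (hq n (U s)) = 1" using U(2)[of s] by (simp add: hform_self)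
  then show ?thesis by (simp only: of_real_eq_1_iff)
qed

lemma Mx_pos: "0 < Mx"
  using \<tau>(2,3) less_le_trans by blast

definition hker :: "complex mat \<Rightarrow> real \<Rightarrow> (nat \<Rightarrow> complex) \<Rightarrow> complex" where
  "hker A s z = inverse (- hform n (A *\<^sub>v lift n z) (U s)) ^ N"

definition wt :: "(nat \<Rightarrow> complex) \<Rightarrow> real" where
  "wt z = indicator (ball_n n) z * (1 - nsq n z) ^ N"

text \<open>The part of the weight left over after the kernel bounds, still integrable. The
  indicator lets later estimates be stated at every point.\<close>

definition bwt :: "(nat \<Rightarrow> complex) \<Rightarrow> real" where
  "bwt z = indicator (ball_n n) z * (1 - nsq n z) ^ (n + 2)"

lemma wt_measurable [measurable]: "wt \<in> borel_measurable (vol_e n)"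
  unfolding wt_def by measurable

lemma integrable_bwt: "integrable (hyp_vol n) bwt"
proof -
  have "integrable (hyp_vol n) (\<lambda>z. (1 - nsq n z) ^ (n + 2))" by (rule has_integral_hyp_vol_power) simp
  moreover have "AE z in hyp_vol n. (1 - nsq n z) ^ (n + 2) = bwt z"
    using AE_hyp_vol_ball by eventually_elim (simp add: bwt_def)
  ultimately show ?thesis unfolding bwt_def
    by (subst integrable_cong_AE[symmetric]) (auto simp: bwt_def)
qed

lemma hker_measurable:
  assumes "A \<in> G"
  shows "(\<lambda>p. hker A (snd p) (fst p)) \<in> borel_measurable (vol_e n \<Otimes>\<^sub>M T)"
proof -
  have 1: "(\<lambda>p. (A *\<^sub>v lift n (fst p)) $ j) \<in> borel_measurable (vol_e n \<Otimes>\<^sub>M T)" if "j \<le> n" for j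
    by (rule measurable_compose[OF measurable_fst mult_lift_measurable[OF G_carrier[OF assms] that]])
  have 2: "(\<lambda>p. U (snd p) $ j) \<in> borel_measurable (vol_e n \<Otimes>\<^sub>M T)" if "j \<le> n" for j
    by (rule measurable_compose[OF measurable_snd]) (use U_meas[OF that] in simp)
  have "(\<lambda>p. hform n (A *\<^sub>v lift n (fst p)) (U (snd p))) \<in> borel_measurable (vol_e n \<Otimes>\<^sub>M T)"
    unfolding hform_def
    by (intro borel_measurable_diff borel_measurable_sum borel_measurable_times borel_measurable_cnj 1 2) auto
  then show ?thesis unfolding hker_def by measurable
qed

definition Cb :: real where "Cb = (2 * Mx) ^ N * 2 ^ (2 * (n+2))"

lemma hker_bound_base:
  assumes "w \<in> carrier_vec (n+1)" "0 < hq n w"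
  shows "cmod (inverse (- hform n w (U s)) ^ N) \<le> (2 * Mx) ^ N * inverse (cmod (w $ n)) ^ N"
proof -
  have wn: "0 < cmod (w $ n)" using hq_nonneg_imp_nz[OF assms(2)] by simp
  have "cmod (w $ n) / (2 * Mx) \<le> cmod (w $ n) / (2 * \<tau> s)"
    using \<tau>(2,3)[of s] wn by (intro divide_left_mono mult_pos_pos) auto
  also have "\<dots> = cmod (w $ n) * hq n (U s) / (2 * cmod (U s $ n))"
    using \<tau>(2)[of s] by (simp add: \<tau>(1) hq_U)
  also have "\<dots> \<le> cmod (hform n (U s) w)" by (rule hform_lower_hq) (use assms hq_U in auto)
  also have "\<dots> = cmod (- hform n w (U s))" by (metis hform_cnj complex_mod_cnj norm_minus_cancel)
  finally have le: "cmod (w $ n) / (2 * Mx) \<le> cmod (- hform n w (U s))" .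
  have "inverse (cmod (- hform n w (U s))) \<le> inverse (cmod (w $ n) / (2 * Mx))"
    using wn Mx_pos by (intro le_imp_inverse_le[OF le]) simp
  also have "\<dots> = 2 * Mx * inverse (cmod (w $ n))" by (simp only: inverse_divide) (simp only: divide_inverse)
  finally have "inverse (cmod (- hform n w (U s))) ^ N \<le> (2 * Mx * inverse (cmod (w $ n))) ^ N"
    by (rule power_mono) simp
  then show ?thesis by (simp only: norm_power norm_inverse power_mult_distrib)
qed

lemma hker_one_bound:
  assumes "z \<in> ball_n n"
  shows "cmod (hker (1\<^sub>m (n+1)) s z) \<le> (2 * Mx) ^ N"
proof -
  have "1\<^sub>m (n+1) *\<^sub>v lift n z = lift n z" by (rule one_mult_mat_vec) simp
  then show ?thesis using hker_bound_base[OF lift_carrier(1) ball_hq_lift[OF assms], of s] by (simp add: hker_def)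
qed

text \<open>Put r = sqrt (1 - |z|^2) and y = |(A Z)_n|. Two lower bounds compete: y >= |A_nn| r^2 /
  2, summable over the group but worse near the boundary, and y >= r. The first is spent on 2(n+2)
  of the N factors, the second on the rest.\<close>

lemma hker_bound:
  assumes A: "A \<in> G" and z: "z \<in> ball_n n"
  shows "cmod (hker A s z) \<le> Cb * inverse (cmod (A $$ (n,n))) ^ (2 * (n+2)) * inverse (sqrt (1 - nsq n z)) ^ (N + 2 * (n+2))"
proof -
  let ?p = "2 * (n+2)" and ?a = "cmod (A $$ (n,n))"
  define r where "r = sqrt (1 - nsq n z)"
  define y where "y = cmod ((A *\<^sub>v lift n z) $ n)"
  have r: "0 < r" using z by (simp add: r_def ball_n_alt)
  have r2: "r * r = 1 - nsq n z" using z by (simp add: r_def ball_n_alt)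
  have a: "0 < ?a" using U_n1_nn_ge_1[OF G_U_n1[OF A]] by linarith
  have c: "A *\<^sub>v lift n z \<in> carrier_vec (n+1)" using G_carrier[OF A] by simp
  have h: "hq n (A *\<^sub>v lift n z) = r * r" using U_n1_hq[OF G_U_n1[OF A] lift_carrier(1), of z] by (simp add: hq_lift r2)
  have h0: "0 < hq n (A *\<^sub>v lift n z)" using h r by simp
  have y1: "?a * (r * r) / 2 \<le> y"
    using U_n1_last_bounds(1)[OF G_U_n1[OF A] G_U_n1[OF minv(1)[OF A]] minv(2)[OF A] lift_carrier(1) ball_hq_lift[OF z]]
    by (simp add: y_def hq_lift r2)
  have y2: "r \<le> y"
  proof -
    have "r\<^sup>2 \<le> y\<^sup>2" using h nsq_nonneg[of n "vec_index (A *\<^sub>v lift n z)"] unfolding hq_def y_def power2_eq_square by linarith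
    then show ?thesis by (rule power2_le_imp_le) (simp add: y_def)
  qed
  have y0: "0 < y" using y2 r by linarith
  have Np: "N = ?p + (N - ?p)" using N by simp
  have i1: "inverse y \<le> 2 * inverse ?a * inverse r * inverse r"
  proof -
    have "inverse y \<le> inverse (?a * (r * r) / 2)" using y1 a r by (intro le_imp_inverse_le) auto
    also have "\<dots> = 2 * inverse ?a * inverse r * inverse r" by (simp only: inverse_divide) (simp only: divide_inverse inverse_mult_distrib mult.assoc)
    finally show ?thesis .
  qed
  have i2: "inverse y \<le> inverse r" using y2 r by (intro le_imp_inverse_le) auto
  have "inverse y ^ N = inverse y ^ ?p * inverse y ^ (N - ?p)" using Np by (metis power_add)
  also have "\<dots> \<le> (2 * inverse ?a * inverse r * inverse r) ^ ?p * inverse r ^ (N - ?p)"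
    using i1 i2 y0 a r by (intro mult_mono power_mono) auto
  also have "\<dots> = 2 ^ ?p * inverse ?a ^ ?p * (inverse r ^ ?p * (inverse r ^ ?p * inverse r ^ (N - ?p)))"
    by (simp only: power_mult_distrib mult.assoc)
  also have "inverse r ^ ?p * (inverse r ^ ?p * inverse r ^ (N - ?p)) = inverse r ^ (N + ?p)"
    using Np by (metis power_add add.commute)
  finally have yN: "inverse y ^ N \<le> 2 ^ ?p * inverse ?a ^ ?p * inverse r ^ (N + ?p)" .
  have "cmod (hker A s z) \<le> (2 * Mx) ^ N * inverse y ^ N"
    unfolding hker_def y_def by (rule hker_bound_base[OF c h0])
  also have "\<dots> \<le> (2 * Mx) ^ N * (2 ^ ?p * inverse ?a ^ ?p * inverse r ^ (N + ?p))"
    using yN Mx_pos by (intro mult_left_mono) auto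
  finally show ?thesis by (simp only: Cb_def r_def mult.assoc)
qed

definition aw :: "complex mat \<Rightarrow> real" where
  "aw A = inverse (cmod (A $$ (n,n))) ^ (2 * (n+2))"

lemma aw_nonneg: "0 \<le> aw A" by (simp add: aw_def)

lemma integrable_aw: "integrable (count_space G) aw"
  using integrable_inverse_nn by (simp add: aw_def[abs_def])

lemma prod_bound:
  assumes A: "A \<in> G" and p: "cmod p \<le> P" and q: "z \<in> ball_n n \<Longrightarrow> cmod q \<le> Q * aw A * inverse (sqrt (1 - nsq n z)) ^ (N + 2 * (n+2))"
    and Q: "0 \<le> Q" and pz: "0 \<le> P"
  shows "cmod (p * cnj q * of_real (wt z)) \<le> P * Q * aw A * bwt z"
proof (cases "z \<in> ball_n n")
  case False
  then show ?thesis by (simp add: wt_def bwt_def)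
next
  case True
  let ?p = "2 * (n+2)"
  define r where "r = sqrt (1 - nsq n z)"
  have r: "0 < r" "r \<le> 1" using True by (auto simp: r_def ball_n_alt)
  have r2: "r\<^sup>2 = 1 - nsq n z" using True by (simp add: r_def ball_n_alt)
  have w: "wt z = r ^ (2 * N)" and b: "bwt z = r ^ ?p" unfolding wt_def bwt_def r2[symmetric] power_mult using True by simp_all
  \<comment> \<open>The weight r^(2N) absorbs the singularity r^-(N+p) and leaves r^(N-p), which is
    at most r^p because N >= 2p.\<close>
  have "2 * N = (N + ?p) + (N - ?p)" using N by simp
  then have "inverse r ^ (N + ?p) * r ^ (2 * N) = inverse r ^ (N + ?p) * (r ^ (N + ?p) * r ^ (N - ?p))" by (metis power_add)
  also have "\<dots> = r ^ (N - ?p)"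
  proof -
    have "inverse r ^ (N + ?p) * r ^ (N + ?p) = 1" using r by (simp only: power_mult_distrib[symmetric]) simp
    then show ?thesis by (simp only: mult.assoc[symmetric] mult_1_left)
  qed
  also have "\<dots> \<le> r ^ ?p" using r N by (intro power_decreasing) auto
  finally have k: "inverse r ^ (N + ?p) * r ^ (2 * N) \<le> r ^ ?p" .
  have "cmod (p * cnj q * of_real (wt z)) = cmod p * cmod q * r ^ (2 * N)"
    unfolding w using r by (simp add: norm_mult norm_power)
  also have "\<dots> \<le> P * (Q * aw A * inverse r ^ (N + ?p)) * r ^ (2 * N)"
    using p q[OF True] pz r by (intro mult_right_mono mult_mono) (auto simp: r_def)
  also have "\<dots> = P * Q * aw A * (inverse r ^ (N + ?p) * r ^ (2 * N))" by (simp only: mult.assoc)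
  also have "\<dots> \<le> P * Q * aw A * r ^ ?p"
    using k pz Q aw_nonneg by (intro mult_left_mono) auto
  finally show ?thesis unfolding b .
qed

section \<open>Automorphy and unfolding of the theta integral\<close>

definition phi :: "complex mat \<Rightarrow> (nat \<Rightarrow> complex) \<Rightarrow> complex" where
  "phi A z = (\<integral>s. hker A s z \<partial>T)"

definition Phi :: "(nat \<Rightarrow> complex) \<Rightarrow> complex" where
  "Phi z = (\<integral>A. phi A z \<partial>count_space G)"

lemma phi_measurable:
  assumes "A \<in> G"
  shows "phi A \<in> borel_measurable (vol_e n)"
  unfolding phi_def
  by (rule T.borel_measurable_lebesgue_integral) (use hker_measurable[OF assms] in \<open>simp add: case_prod_beta'\<close>)

definition mT :: real where "mT = measure T (space T)"

lemma mT_nonneg: "0 \<le> mT" by (simp add: mT_def)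

lemma Cb_nonneg: "0 \<le> Cb" using Mx_pos by (simp add: Cb_def)

lemma phi_bound:
  assumes A: "A \<in> G" and z: "z \<in> ball_n n"
  shows "cmod (phi A z) \<le> Cb * mT * aw A * inverse (sqrt (1 - nsq n z)) ^ (N + 2 * (n+2))"
proof -
  have "cmod (phi A z) \<le> (Cb * aw A * inverse (sqrt (1 - nsq n z)) ^ (N + 2 * (n+2))) * measure T (space T)"
    unfolding phi_def aw_def by (rule cmod_integral_le_const[OF T(1) hker_bound[OF A z]])
  then show ?thesis unfolding mT_def by (simp only: ac_simps)
qed

lemma phi_one_bound:
  assumes z: "z \<in> ball_n n"
  shows "cmod (phi (1\<^sub>m (n+1)) z) \<le> (2 * Mx) ^ N * mT"
  unfolding phi_def mT_def by (rule cmod_integral_le_const[OF T(1) hker_one_bound[OF z]])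

lemma hker_mob:
  assumes A: "A \<in> G" and B: "B \<in> G" and z: "z \<in> ball_n n"
  shows "hker A s (mob n B z) = denom n B z ^ N * hker (A * B) s z"
proof -
  let ?d = "denom n B z"
  have d0: "?d \<noteq> 0" by (rule denom_nz[OF G_U_n1[OF B] z])
  have "A * B *\<^sub>v lift n z = A *\<^sub>v (B *\<^sub>v lift n z)"
    by (rule assoc_mult_mat_vec[OF G_carrier[OF A] G_carrier[OF B] lift_carrier(1)])
  also have "\<dots> = ?d \<cdot>\<^sub>v (A *\<^sub>v lift n (mob n B z))"
    unfolding mult_lift[OF G_U_n1[OF B] z] by (rule mult_mat_vec[OF G_carrier[OF A] lift_carrier(1)])
  finally have "hform n (A * B *\<^sub>v lift n z) (U s) = ?d * hform n (A *\<^sub>v lift n (mob n B z)) (U s)"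
    using G_carrier[OF A] by (simp add: hform_smult_left)
  then show ?thesis unfolding hker_def power_mult_distrib[symmetric] using d0 by (simp add: mult.assoc[symmetric])
qed

lemma phi_mob:
  assumes "A \<in> G" "B \<in> G" "z \<in> ball_n n"
  shows "phi A (mob n B z) = denom n B z ^ N * phi (A * B) z"
  unfolding phi_def hker_mob[OF assms] by simp

lemma bij_right_mult:
  assumes B: "B \<in> G"
  shows "bij_betw (\<lambda>A. A * B) G G"
proof (rule bij_betw_byWitness[where f'="\<lambda>A. A * minv B"])
  have c: "A * B * minv B = A" "A * minv B * B = A" if "A \<in> G" for A
    using assoc_mult_mat[OF G_carrier[OF that] G_carrier[OF B] G_carrier[OF minv(1)[OF B]]]
      assoc_mult_mat[OF G_carrier[OF that] G_carrier[OF minv(1)[OF B]] G_carrier[OF B]] minv[OF B] G_carrier[OF that]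
    by simp_all
  show "\<forall>A\<in>G. A * B * minv B = A" "\<forall>A\<in>G. A * minv B * B = A" using c by auto
  show "(\<lambda>A. A * B) ` G \<subseteq> G" "(\<lambda>A. A * minv B) ` G \<subseteq> G" using B minv(1)[OF B] G_mult by auto
qed

text \<open>Translating by B pulls out the same power of \<open>denom\<close> from every term and
  replaces A by A B, a permutation of the group.\<close>

lemma Phi_mob:
  assumes B: "B \<in> G" and z: "z \<in> ball_n n"
  shows "Phi (mob n B z) = denom n B z ^ N * Phi z"
proof -
  have "Phi (mob n B z) = (\<integral>A. denom n B z ^ N * phi (A * B) z \<partial>count_space G)"
    unfolding Phi_def by (rule Bochner_Integration.integral_cong) (use phi_mob[OF _ B z] in auto)
  also have "\<dots> = denom n B z ^ N * (\<integral>A. phi (A * B) z \<partial>count_space G)" by simp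
  also have "(\<integral>A. phi (A * B) z \<partial>count_space G) = Phi z"
    unfolding Phi_def by (rule integral_bij_count_space[OF bij_right_mult[OF B], of "\<lambda>A. phi A z"])
  finally show ?thesis .
qed

lemma wt_mob:
  assumes B: "B \<in> G" and z: "z \<in> ball_n n"
  shows "wt z = cmod (denom n B z) ^ (2 * N) * wt (mob n B z)"
  using one_minus_nsq_mob[OF G_U_n1[OF B] z] mob_in_ball[OF G_U_n1[OF B] z] z
  by (simp add: wt_def power_mult_distrib power_mult)

text \<open>Only one of the two theta factors is unfolded: this is its term at the identity against
  the full conjugate series.\<close>

definition hfun :: "(nat \<Rightarrow> complex) \<Rightarrow> complex" where
  "hfun z = phi (1\<^sub>m (n+1)) z * cnj (Phi z) * of_real (wt z)"

text \<open>The two automorphy factors together cancel against the one of the weight. Summing over B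
  therefore rebuilds the full series in the first slot.\<close>

lemma hfun_mob:
  assumes B: "B \<in> G" and z: "z \<in> ball_n n"
  shows "hfun (mob n B z) = phi B z * cnj (Phi z) * of_real (wt z)"
proof -
  let ?d = "denom n B z"
  have 1: "phi (1\<^sub>m (n+1)) (mob n B z) = ?d ^ N * phi B z"
    using phi_mob[OF G_one B z] left_mult_one_mat[OF G_carrier[OF B]] by simp
  have "complex_of_real (wt z) = (?d * cnj ?d) ^ N * of_real (wt (mob n B z))"
    by (subst wt_mob[OF B z]) (simp add: power_mult complex_norm_square[symmetric])
  then show ?thesis unfolding hfun_def 1 Phi_mob[OF B z] by (simp add: power_mult_distrib mult_ac)
qed

interpretation cG: sigma_finite_measure "count_space G"
  by (rule sigma_finite_measure_count_space_countable[OF countable_G])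

interpretation hv: sigma_finite_measure "hyp_vol n" by (rule sigma_finite_hyp_vol)

interpretation hF: sigma_finite_measure hypF by (rule sigma_finite_hypF)

interpretation P1: pair_sigma_finite "count_space G" "hyp_vol n" ..

interpretation P2: pair_sigma_finite "count_space G" hypF ..

interpretation TT: pair_sigma_finite T T ..

lemma finite_measure_T_pair: "finite_measure (T \<Otimes>\<^sub>M T)"
  by (rule finite_measure_pair_measure) (rule T(1))+

definition gfun :: "complex mat \<times> (nat \<Rightarrow> complex) \<Rightarrow> complex" where
  "gfun p = phi (1\<^sub>m (n+1)) (snd p) * cnj (phi (fst p) (snd p)) * of_real (wt (snd p))"

lemma gfun_bound:
  assumes "A \<in> G"
  shows "cmod (gfun (A, z)) \<le> ((2 * Mx) ^ N * mT * (Cb * mT) * aw A) * bwt z"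
proof (cases "z \<in> ball_n n")
  case True
  then show ?thesis unfolding gfun_def fst_conv snd_conv
    using Mx_pos Cb_nonneg mT_nonneg by (intro prod_bound[OF assms phi_one_bound phi_bound[OF assms]]) auto
qed (simp add: gfun_def wt_def bwt_def)

lemma integrable_gfun: "integrable (count_space G \<Otimes>\<^sub>M hyp_vol n) gfun"
proof (rule integrable_pair_bound[OF sigma_finite_hyp_vol _ _ integrable_bwt])
  show "gfun \<in> borel_measurable (count_space G \<Otimes>\<^sub>M hyp_vol n)"
  proof (rule measurable_pair_measure_countable1[OF countable_G])
    fix A assume A: "A \<in> G"
    note [measurable] = phi_measurable[OF A] phi_measurable[OF G_one]
    show "(\<lambda>z. gfun (A, z)) \<in> borel_measurable (hyp_vol n)"
      unfolding gfun_def fst_conv snd_conv by measurable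
  qed
  show "integrable (count_space G) (\<lambda>A. (2 * Mx) ^ N * mT * (Cb * mT) * aw A)"
    by (rule integrable_mult_right) (rule integrable_aw)
  show "cmod (gfun (A, z)) \<le> (2 * Mx) ^ N * mT * (Cb * mT) * aw A * bwt z" if "A \<in> space (count_space G)" for A z
    using gfun_bound that by simp
qed

lemma hfun_eq: "hfun z = (\<integral>A. gfun (A, z) \<partial>count_space G)"
  unfolding hfun_def Phi_def gfun_def by (simp add: mult_ac)

lemma integrable_hfun: "integrable (hyp_vol n) hfun"
  using P1.integrable_snd[of "\<lambda>A z. gfun (A, z)"] integrable_gfun unfolding hfun_eq[abs_def] by simp

lemma unfolding_step:
  "(\<integral>z. Phi z * cnj (Phi z) * of_real (wt z) \<partial>hypF) = (\<integral>z. hfun z \<partial>hyp_vol n)"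
proof -
  have m: "hfun \<in> borel_measurable (vol_e n)" using integrable_hfun by (simp add: borel_measurable_integrable)
  have i: "integrable (count_space G \<Otimes>\<^sub>M hypF) (\<lambda>p. hfun (mob n (fst p) (snd p)))"
    using integrable_hfun unfolding distr_unfold[symmetric]
    by (subst (asm) integrable_distr_eq) (use m in auto)
  have AEF: "AE z in hypF. z \<in> ball_n n"
    unfolding hypF_def by (subst AE_density) (use F_ball in \<open>auto simp: indicator_def\<close>)
  have "(\<integral>z. hfun z \<partial>hyp_vol n) = (\<integral>p. hfun (mob n (fst p) (snd p)) \<partial>(count_space G \<Otimes>\<^sub>M hypF))"
    by (subst distr_unfold[symmetric], rule integral_distr) (use m in auto)
  also have "\<dots> = (\<integral>z. \<integral>A. hfun (mob n A z) \<partial>count_space G \<partial>hypF)"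
    using P2.integral_snd[of "\<lambda>A z. hfun (mob n A z)"] i by (simp add: case_prod_beta')
  also have "\<dots> = (\<integral>z. Phi z * cnj (Phi z) * of_real (wt z) \<partial>hypF)"
  proof (rule integral_cong_AE)
    show "(\<lambda>z. \<integral>A. hfun (mob n A z) \<partial>count_space G) \<in> borel_measurable hypF"
      using P2.integrable_snd[of "\<lambda>A z. hfun (mob n A z)"] i by (simp add: case_prod_beta' borel_measurable_integrable)
    have [measurable]: "Phi \<in> borel_measurable (vol_e n)"
      unfolding Phi_def
    proof (rule cG.borel_measurable_lebesgue_integral)
      show "(\<lambda>(z, A). phi A z) \<in> borel_measurable (vol_e n \<Otimes>\<^sub>M count_space G)"
      proof -
        have "(\<lambda>p. phi (fst p) (snd p)) \<in> borel_measurable (count_space G \<Otimes>\<^sub>M vol_e n)"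
          by (rule measurable_pair_measure_countable1[OF countable_G]) (use phi_measurable in simp)
        from measurable_pair_swap[OF this] show ?thesis by simp
      qed
    qed
    show "(\<lambda>z. Phi z * cnj (Phi z) * of_real (wt z)) \<in> borel_measurable hypF" by measurable
    show "AE z in hypF. (\<integral>A. hfun (mob n A z) \<partial>count_space G) = Phi z * cnj (Phi z) * of_real (wt z)"
      using AEF
    proof eventually_elim
      case (elim z)
      have "(\<integral>A. hfun (mob n A z) \<partial>count_space G) = (\<integral>A. phi A z * (cnj (Phi z) * of_real (wt z)) \<partial>count_space G)"
        by (rule Bochner_Integration.integral_cong) (use hfun_mob[OF _ elim] in \<open>auto simp: mult.assoc\<close>)
      also have "\<dots> = Phi z * (cnj (Phi z) * of_real (wt z))" unfolding Phi_def by simp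
      finally show ?case by (simp add: mult.assoc)
    qed
  qed
  finally show ?thesis ..
qed

definition EA :: "complex mat \<Rightarrow> real \<Rightarrow> real \<Rightarrow> complex" where
  "EA A s s' = hform n (A *\<^sub>v U s) (U s')"

text \<open>Fubini brings the ball integral inside the two parameter integrals, where the
  reproducing property evaluates it.\<close>

lemma single_term:
  assumes A: "A \<in> G"
  shows "(\<integral>z. gfun (A, z) \<partial>hyp_vol n)
    = of_real (omega n N) * (\<integral>p. cnj (inverse (- EA A (fst p) (snd p)) ^ N) \<partial>(T \<Otimes>\<^sub>M T))"
proof -
  interpret TTf: finite_measure "T \<Otimes>\<^sub>M T" by (rule finite_measure_T_pair)
  interpret Q: pair_sigma_finite "hyp_vol n" "T \<Otimes>\<^sub>M T" ..
  have sfT: "sigma_finite_measure T" and sfTT: "sigma_finite_measure (T \<Otimes>\<^sub>M T)" by unfold_locales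
  define k where "k z p = hker (1\<^sub>m (n+1)) (fst p) z * cnj (hker A (snd p) z) * complex_of_real (wt z)" for z p
  have kb: "cmod (k z p) \<le> ((2 * Mx) ^ N * Cb * aw A * bwt z) * 1" for z p
  proof (cases "z \<in> ball_n n")
    case True
    then have "cmod (k z p) \<le> (2 * Mx) ^ N * Cb * aw A * bwt z"
      unfolding k_def aw_def using Mx_pos Cb_nonneg
      by (intro prod_bound[OF A hker_one_bound, unfolded aw_def] hker_bound[OF A]) auto
    then show ?thesis by simp
  qed (simp add: k_def wt_def bwt_def)
  have km: "(\<lambda>q. k (fst q) (snd q)) \<in> borel_measurable (hyp_vol n \<Otimes>\<^sub>M (T \<Otimes>\<^sub>M T))"
  proof -
    have 1: "(\<lambda>q. (fst q, fst (snd q))) \<in> hyp_vol n \<Otimes>\<^sub>M (T \<Otimes>\<^sub>M T) \<rightarrow>\<^sub>M vol_e n \<Otimes>\<^sub>M T"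
      and 2: "(\<lambda>q. (fst q, snd (snd q))) \<in> hyp_vol n \<Otimes>\<^sub>M (T \<Otimes>\<^sub>M T) \<rightarrow>\<^sub>M vol_e n \<Otimes>\<^sub>M T"
      by measurable
    have [measurable]: "(\<lambda>q. hker (1\<^sub>m (n+1)) (fst (snd q)) (fst q)) \<in> borel_measurable (hyp_vol n \<Otimes>\<^sub>M (T \<Otimes>\<^sub>M T))"
      using measurable_compose[OF 1 hker_measurable[OF G_one]] by simp
    have [measurable]: "(\<lambda>q. hker A (snd (snd q)) (fst q)) \<in> borel_measurable (hyp_vol n \<Otimes>\<^sub>M (T \<Otimes>\<^sub>M T))"
      using measurable_compose[OF 2 hker_measurable[OF A]] by simp
    show ?thesis unfolding k_def by measurable
  qed
  have ki: "integrable (hyp_vol n \<Otimes>\<^sub>M (T \<Otimes>\<^sub>M T)) (\<lambda>q. k (fst q) (snd q))"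
  proof (rule integrable_pair_bound[OF sfTT km _ TTf.integrable_const[of 1]])
    show "integrable (hyp_vol n) (\<lambda>z. (2 * Mx) ^ N * Cb * aw A * bwt z)"
      by (rule integrable_mult_right) (rule integrable_bwt)
    show "cmod (k (fst (z, p)) (snd (z, p))) \<le> (2 * Mx) ^ N * Cb * aw A * bwt z * 1" for z p
      unfolding fst_conv snd_conv by (rule kb)
  qed
  have "(\<integral>z. gfun (A, z) \<partial>hyp_vol n) = (\<integral>z. \<integral>p. k z p \<partial>(T \<Otimes>\<^sub>M T) \<partial>hyp_vol n)"
  proof (rule integral_cong_AE)
    show "(\<lambda>z. gfun (A, z)) \<in> borel_measurable (hyp_vol n)"
    proof -
      note [measurable] = phi_measurable[OF A] phi_measurable[OF G_one]
      show ?thesis unfolding gfun_def fst_conv snd_conv by measurable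
    qed
    show "(\<lambda>z. \<integral>p. k z p \<partial>(T \<Otimes>\<^sub>M T)) \<in> borel_measurable (hyp_vol n)"
      by (rule sigma_finite_measure.borel_measurable_lebesgue_integral[OF sfTT]) (use km in \<open>simp add: case_prod_beta'\<close>)
    show "AE z in hyp_vol n. gfun (A, z) = (\<integral>p. k z p \<partial>(T \<Otimes>\<^sub>M T))"
      using AE_hyp_vol_ball
    proof eventually_elim
      case (elim z)
      have zs: "z \<in> space (vol_e n)" using elim by (simp add: ball_n_alt)
      have m1: "(\<lambda>s. hker B s z) \<in> borel_measurable T" if "B \<in> G" for B
        using measurable_compose[OF measurable_Pair1'[OF zs, of T] hker_measurable[OF that]] by simp
      have i1: "integrable T (\<lambda>s. hker (1\<^sub>m (n+1)) s z)"
        by (rule T.integrable_const_bound[OF _ m1[OF G_one], of "(2 * Mx) ^ N"]) (use hker_one_bound[OF elim] in auto)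
      have i2: "integrable T (\<lambda>s. cnj (hker A s z))"
        by (rule T.integrable_const_bound) (use hker_bound[OF A elim] m1[OF A] in auto)
      have prod: "integrable (T \<Otimes>\<^sub>M T) (\<lambda>p. hker (1\<^sub>m (n+1)) (fst p) z * cnj (hker A (snd p) z))"
      proof (rule integrable_pair_bound[OF sfT _ integrable_norm[OF i1] integrable_norm[OF i2]])
        show "(\<lambda>p. hker (1\<^sub>m (n+1)) (fst p) z * cnj (hker A (snd p) z)) \<in> borel_measurable (T \<Otimes>\<^sub>M T)"
          using measurable_compose[OF measurable_fst m1[OF G_one]] measurable_compose[OF measurable_snd m1[OF A]] by measurable
      qed (simp add: norm_mult)
      have "(\<integral>p. hker (1\<^sub>m (n+1)) (fst p) z * cnj (hker A (snd p) z) \<partial>(T \<Otimes>\<^sub>M T))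
         = (\<integral>s. \<integral>s'. hker (1\<^sub>m (n+1)) s z * cnj (hker A s' z) \<partial>T \<partial>T)"
        using TT.integral_fst'[OF prod] by simp
      also have "\<dots> = phi (1\<^sub>m (n+1)) z * cnj (phi A z)"
        unfolding phi_def by simp
      finally show ?case unfolding k_def gfun_def by simp
    qed
  qed
  also have "\<dots> = (\<integral>p. \<integral>z. k z p \<partial>hyp_vol n \<partial>(T \<Otimes>\<^sub>M T))"
    by (rule Q.Fubini_integral[symmetric]) (use ki in \<open>simp add: case_prod_beta'\<close>)
  also have "\<dots> = (\<integral>p. of_real (omega n N) * cnj (inverse (- EA A (fst p) (snd p)) ^ N) \<partial>(T \<Otimes>\<^sub>M T))"
  proof (rule Bochner_Integration.integral_cong[OF refl])
    fix p :: "real \<times> real"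
    \<comment> \<open>The isometry is moved to the other side of the form, so that both kernels
      depend on the lift of z itself. Here the conjugate sits on the A-factor and in the reproducing
      lemma on the other one, hence the outer conjugation below.\<close>
    let ?P = "minv A *\<^sub>v U (snd p)"
    have Pc: "?P \<in> carrier_vec (n+1)" using G_carrier[OF minv(1)[OF A]] U(1) by simp
    have hP: "hform n (A *\<^sub>v u) (U (snd p)) = hform n u ?P" if "u \<in> carrier_vec (n+1)" for u
    proof -
      have "hform n (A *\<^sub>v u) (A *\<^sub>v ?P) = hform n u ?P" by (rule U_n1_hform[OF G_U_n1[OF A] that Pc])
      then show ?thesis using minv_cancel(2)[OF A U(1)] by simp
    qed
    have "0 < hq n ?P" using U_n1_hq[OF G_U_n1[OF minv(1)[OF A]] U(1)] by (simp add: hq_U)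
    have "(\<integral>z. k z p \<partial>hyp_vol n) = (\<integral>z. cnj (inverse (- hform n (lift n z) ?P) ^ N * cnj (inverse (- hform n (lift n z) (U (fst p))) ^ N)
        * of_real ((1 - nsq n z) ^ N)) \<partial>hyp_vol n)"
    proof (rule integral_cong_AE)
      show "(\<lambda>z. k z p) \<in> borel_measurable (hyp_vol n)"
      proof -
        have "(\<lambda>z. (z, p)) \<in> hyp_vol n \<rightarrow>\<^sub>M hyp_vol n \<Otimes>\<^sub>M (T \<Otimes>\<^sub>M T)"
          by (rule measurable_Pair2') (use T(2) in \<open>auto simp: space_pair_measure sets_eq_imp_space_eq\<close>)
        from measurable_compose[OF this km] show ?thesis by simp
      qed
      show "AE z in hyp_vol n. k z p = cnj (inverse (- hform n (lift n z) ?P) ^ N * cnj (inverse (- hform n (lift n z) (U (fst p))) ^ N)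
        * of_real ((1 - nsq n z) ^ N))"
        using AE_hyp_vol_ball
      proof eventually_elim
        case (elim z)
        have "1\<^sub>m (n+1) *\<^sub>v lift n z = lift n z" by (rule one_mult_mat_vec) simp
        then show ?case using elim unfolding k_def hker_def hP[OF lift_carrier(1)] by (simp add: wt_def mult_ac)
      qed
    qed measurable
    also have "\<dots> = cnj (\<integral>z. inverse (- hform n (lift n z) ?P) ^ N * cnj (inverse (- hform n (lift n z) (U (fst p))) ^ N)
        * of_real ((1 - nsq n z) ^ N) \<partial>hyp_vol n)" by (rule Bochner_Integration.integral_cnj)
    also have "\<dots> = cnj (of_real (omega n N) * inverse (- hform n (U (fst p)) ?P) ^ N)"
      by (subst reproducing_hyp_vol[where t="\<tau> (fst p)"]) (use N U \<tau> Pc \<open>0 < hq n ?P\<close> in auto)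
    finally show "(\<integral>z. k z p \<partial>hyp_vol n) = of_real (omega n N) * cnj (inverse (- EA A (fst p) (snd p)) ^ N)"
      unfolding EA_def hP[OF U(1)] by simp
  qed
  also have "\<dots> = of_real (omega n N) * (\<integral>p. cnj (inverse (- EA A (fst p) (snd p)) ^ N) \<partial>(T \<Otimes>\<^sub>M T))" by simp
  finally show ?thesis .
qed

theorem inner_product_identity:
  "(\<integral>z. Phi z * cnj (Phi z) * of_real (wt z) \<partial>hypF)
    = of_real (omega n N) * (\<integral>A. (\<integral>p. cnj (inverse (- EA A (fst p) (snd p)) ^ N) \<partial>(T \<Otimes>\<^sub>M T)) \<partial>count_space G)"
proof -
  have "(\<integral>z. Phi z * cnj (Phi z) * of_real (wt z) \<partial>hypF) = (\<integral>z. \<integral>A. gfun (A, z) \<partial>count_space G \<partial>hyp_vol n)"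
    unfolding unfolding_step hfun_eq[abs_def] ..
  also have "\<dots> = (\<integral>A. \<integral>z. gfun (A, z) \<partial>hyp_vol n \<partial>count_space G)"
    by (rule P1.Fubini_integral) (use integrable_gfun in simp)
  also have "\<dots> = (\<integral>A. of_real (omega n N) * (\<integral>p. cnj (inverse (- EA A (fst p) (snd p)) ^ N) \<partial>(T \<Otimes>\<^sub>M T)) \<partial>count_space G)"
    by (rule Bochner_Integration.integral_cong) (use single_term in auto)
  finally show ?thesis by simp
qed

end

section \<open>Translates of a geodesic\<close>

text \<open>The orthogonal complement of a negative vector is positive definite: orthogonality gives
  |V_n| |W_n| <= |V'| |W'| while |W'| < |W_n|, which forces V_n = 0 first and then V = 0.\<close>

lemma hform_orth_negative:
  assumes V: "V \<in> carrier_vec (n+1)" and orth: "hform n V W = 0" and W: "0 < hq n W" and V0: "0 \<le> hq n V"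
  shows "V = 0\<^sub>v (n+1)"
proof -
  have e: "(\<Sum>j<n. V $ j * cnj (W $ j)) = V $ n * cnj (W $ n)" using orth by (simp add: hform_def)
  have "cmod (V $ n) * cmod (W $ n) \<le> sqrt (vsq n V) * sqrt (vsq n W)"
    using cmod_sum_mult_cnj_le[where n=n and a="vec_index V" and b="vec_index W"] unfolding e by (simp add: norm_mult)
  also have "\<dots> \<le> cmod (V $ n) * sqrt (vsq n W)"
    using sqrt_vsq_le[OF V0] by (intro mult_right_mono) auto
  finally have le: "cmod (V $ n) * cmod (W $ n) \<le> cmod (V $ n) * sqrt (vsq n W)" .
  have "sqrt (vsq n W) < cmod (W $ n)" using W by (intro real_less_lsqrt) (auto simp: hq_def)
  then have n0: "V $ n = 0" using le by (smt (verit) mult_less_cancel_left_pos norm_le_zero_iff)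
  then have "vsq n V = 0" using V0 by (simp add: hq_def order_antisym)
  then have "\<forall>j<n. V $ j = 0" by (simp add: nsq_def sum_nonneg_eq_0_iff)
  then show ?thesis using V n0 by (intro eq_vecI) (auto simp: less_Suc_eq)
qed

text \<open>Apply the definiteness of the complement to the component \<open>V\<close> of Z
  orthogonal to W, whose \<open>hq\<close> is 1 - |h|^2. A value |h| <= 1 forces V = 0, which is the
  equality case and excludes |h| < 1.\<close>

lemma reversed_cauchy_schwarz:
  assumes Z: "Z \<in> carrier_vec (n+1)" "hform n Z Z = -1" and W: "W \<in> carrier_vec (n+1)" "hform n W W = -1"
  shows "1 \<le> cmod (hform n Z W)"
    and "cmod (hform n Z W) = 1 \<Longrightarrow> Z = (- hform n Z W) \<cdot>\<^sub>v W"
proof -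
  define h where "h = hform n Z W"
  define V where "V = Z + h \<cdot>\<^sub>v W"
  have Vc: "V \<in> carrier_vec (n+1)" using Z W by (simp add: V_def)
  have hc: "hform n W Z = cnj h" by (simp add: h_def hform_cnj)
  have VW: "hform n V W = 0" using Z W by (simp add: V_def hform_lin h_def)
  have "hform n V V = -1 + of_real ((cmod h)\<^sup>2)"
    using Z W by (simp add: V_def hform_lin h_def[symmetric] hc complex_norm_square[symmetric] algebra_simps del: of_real_power)
  then have "complex_of_real (- hq n V) = of_real (- 1 + (cmod h)\<^sup>2)" by (simp add: hform_self)
  then have "- hq n V = - 1 + (cmod h)\<^sup>2" by (simp only: of_real_eq_iff)
  then have hV: "hq n V = 1 - (cmod h)\<^sup>2" by simp
  have "complex_of_real (hq n W) = of_real 1" using W(2) by (simp add: hform_self)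
  then have hW: "hq n W = 1" by (simp only: of_real_eq_iff)
  have V0: "V = 0\<^sub>v (n+1)" if "cmod h \<le> 1"
  proof (rule hform_orth_negative[OF Vc VW])
    show "0 \<le> hq n V" using that by (simp add: hV abs_square_le_1)
  qed (simp add: hW)
  have hq0: "hq n (0\<^sub>v (n+1)) = 0" by (simp add: hq_def nsq_def)
  show "1 \<le> cmod h"
  proof (rule ccontr)
    assume "\<not> 1 \<le> cmod h"
    then have "cmod h < 1" by simp
    then have "(cmod h)\<^sup>2 < 1" by (simp add: abs_square_less_1)
    then show False using V0 hV hq0 \<open>cmod h < 1\<close> by simp
  qed
  assume "cmod h = 1"
  then have V0: "Z + h \<cdot>\<^sub>v W = 0\<^sub>v (n+1)" using V0 by (simp add: V_def)
  show "Z = (- h) \<cdot>\<^sub>v W"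
  proof (rule eq_vecI)
    fix i assume "i < dim_vec (- h \<cdot>\<^sub>v W)"
    then have i: "i < n + 1" using W by simp
    have "(Z + h \<cdot>\<^sub>v W) $ i = 0\<^sub>v (n+1) $ i" using V0 by simp
    then show "Z $ i = (- h \<cdot>\<^sub>v W) $ i" using i Z W by (simp add: eq_neg_iff_add_eq_0)
  qed (use Z W in auto)
qed

lemma cosh_ge_quadratic: "1 + t\<^sup>2 / 2 \<le> cosh (t::real)"
proof -
  have sinh_ge: "x \<le> sinh x" if "0 \<le> x" for x :: real
  proof -
    have "sinh 0 - 0 \<le> sinh x - x"
    proof (rule DERIV_nonneg_imp_nondecreasing[OF that, of "\<lambda>x. sinh x - x"])
      fix y :: real
      show "\<exists>d. ((\<lambda>x. sinh x - x) has_real_derivative d) (at y) \<and> 0 \<le> d"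
        by (rule exI[of _ "cosh y - 1"]) (auto intro!: derivative_eq_intros simp: cosh_real_ge_1)
    qed
    then show ?thesis by simp
  qed
  have "\<bar>t / 2\<bar>\<^sup>2 \<le> (sinh \<bar>t / 2\<bar>)\<^sup>2" by (rule power_mono[OF sinh_ge]) auto
  moreover have "(sinh \<bar>t / 2\<bar>)\<^sup>2 = (sinh (t / 2))\<^sup>2"
    using sinh_minus[of "t / 2"] by (cases "0 \<le> t") auto
  ultimately have "t\<^sup>2 / 4 \<le> (sinh (t / 2))\<^sup>2" by (simp add: power_divide)
  moreover have "cosh t = 1 + 2 * (sinh (t / 2))\<^sup>2"
    using cosh_double[of "t / 2"] cosh_square_eq[of "t / 2"] by simp
  ultimately show ?thesis by simp
qed

text \<open>With a, b the moduli and c = Re (alpha conj beta), the squared modulus is 2ab cosh (s -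
  s0) + 2c. Its minimum is at least 1 and c <= ab, hence 4ab >= 1. The curvature bound does not
  depend on the coefficients, which makes later estimates uniform over the group.\<close>

lemma exp_combination_lower:
  fixes \<alpha> \<beta> :: complex
  assumes ge: "\<And>s::real. 1 \<le> cmod (of_real (exp (s/2)) * \<alpha> + of_real (exp (- s/2)) * \<beta>)"
  obtains s0 where "\<And>s. 1 + (s - s0)\<^sup>2 / 4 \<le> (cmod (of_real (exp (s/2)) * \<alpha> + of_real (exp (- s/2)) * \<beta>))\<^sup>2"
proof -
  \<comment> \<open>If one coefficient were zero, the remaining exponential could be pushed below 1;
    the chosen parameter does this explicitly.\<close>
  have a0: "\<alpha> \<noteq> 0"
  proof
    assume "\<alpha> = 0"
    then have "1 \<le> exp (- ln (cmod \<beta> + 1)) * cmod \<beta>" using ge[of "2 * ln (cmod \<beta> + 1)"] by (simp add: norm_mult)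
    also have "\<dots> = cmod \<beta> / (cmod \<beta> + 1)" by (simp add: exp_minus add_nonneg_pos divide_inverse mult.commute)
    also have "\<dots> < 1" by (simp add: add_nonneg_pos)
    finally show False by simp
  qed
  have b0: "\<beta> \<noteq> 0"
  proof
    assume "\<beta> = 0"
    then have "1 \<le> exp (- ln (cmod \<alpha> + 1)) * cmod \<alpha>" using ge[of "- 2 * ln (cmod \<alpha> + 1)"] by (simp add: norm_mult)
    also have "\<dots> = cmod \<alpha> / (cmod \<alpha> + 1)" by (simp add: exp_minus add_nonneg_pos divide_inverse mult.commute)
    also have "\<dots> < 1" by (simp add: add_nonneg_pos)
    finally show False by simp
  qed
  define a b c where "a = cmod \<alpha>" and "b = cmod \<beta>" and "c = Re (\<alpha> * cnj \<beta>)"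
  define s0 where "s0 = ln (b / a)"
  have ab: "0 < a" "0 < b" using a0 b0 by (auto simp: a_def b_def)
  have es: "exp s0 = b / a" using ab by (simp add: s0_def)
  have cle: "c \<le> a * b" unfolding a_def b_def c_def by (metis complex_Re_le_cmod complex_mod_cnj norm_mult)
  have sq: "(cmod (of_real (exp (s/2)) * \<alpha> + of_real (exp (- s/2)) * \<beta>))\<^sup>2 = 2 * (a * b) * cosh (s - s0) + 2 * c" for s
  proof -
    let ?p = "exp (s/2)" and ?q = "exp (- s/2)"
    have pq: "?p * ?q = 1" by (simp add: exp_add[symmetric])
    have p2: "?p * ?p = exp s" and q2: "?q * ?q = exp (- s)" by (simp_all add: exp_add[symmetric])
    have "(cmod (of_real ?p * \<alpha> + of_real ?q * \<beta>))\<^sup>2 = (?p * ?p) * a\<^sup>2 + (?q * ?q) * b\<^sup>2 + 2 * (?p * ?q) * c"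
      unfolding cmod_power2 a_def b_def c_def by (simp add: algebra_simps power2_eq_square)
    also have "\<dots> = exp s * a\<^sup>2 + exp (- s) * b\<^sup>2 + 2 * c" unfolding pq p2 q2 by simp
    also have "exp s * a\<^sup>2 = (a * b) * exp (s - s0)"
      using ab by (simp add: exp_diff es power2_eq_square)
    also have "exp (- s) * b\<^sup>2 = (a * b) * exp (- (s - s0))"
    proof -
      have "exp (- (s - s0)) = exp (- s) * exp s0" by (simp add: exp_add[symmetric])
      then show ?thesis using ab by (simp add: es power2_eq_square)
    qed
    finally show ?thesis by (simp add: cosh_def algebra_simps)
  qed
  have "1 \<le> (cmod (of_real (exp (s0/2)) * \<alpha> + of_real (exp (- s0/2)) * \<beta>))\<^sup>2"
    using ge[of s0] by (rule one_le_power)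
  then have base: "1 \<le> 2 * (a * b) + 2 * c" unfolding sq by simp
  then have m: "1 \<le> 4 * (a * b)" using cle by simp
  show ?thesis
  proof (rule that[of s0])
    fix s
    have "1 + (s - s0)\<^sup>2 / 4 \<le> 2 * (a * b) + 2 * c + (a * b) * (s - s0)\<^sup>2"
      using base mult_right_mono[OF m, of "(s - s0)\<^sup>2"] by simp
    also have "\<dots> = 2 * (a * b) * (1 + (s - s0)\<^sup>2 / 2) + 2 * c" by (simp add: algebra_simps)
    also have "\<dots> \<le> 2 * (a * b) * cosh (s - s0) + 2 * c"
      using cosh_ge_quadratic[of "s - s0"] ab by simp
    finally show "1 + (s - s0)\<^sup>2 / 4 \<le> (cmod (of_real (exp (s/2)) * \<alpha> + of_real (exp (- s/2)) * \<beta>))\<^sup>2"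
      unfolding sq .
  qed
qed

text \<open>x and y are null vectors over the endpoints, scaled so that <x, y> = -1/2 makes their
  exponential combinations unit vectors. The unit scalar \<open>\<sigma>\<close> is the part of the
  action of g invisible in the ball.\<close>

locale lattice_geodesic = ball_lattice +
  fixes x y :: "complex vec" and xn yn L :: real and g :: "complex mat" and \<sigma> :: complex
  assumes free: "acts_freely n G"
    and xy: "x \<in> carrier_vec (n+1)" "y \<in> carrier_vec (n+1)"
    and nul: "hform n x x = 0" "hform n y y = 0" "hform n x y = - 1/2"
    and last: "x $ n = of_real xn" "y $ n = of_real yn" "0 < xn" "0 < yn"
    and L: "0 < L"
    and g: "g \<in> G" "cmod \<sigma> = 1" "g *\<^sub>v x = (\<sigma> * of_real (exp (L/2))) \<cdot>\<^sub>v x" "g *\<^sub>v y = (\<sigma> * of_real (exp (- L/2))) \<cdot>\<^sub>v y"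
    and prim: "primitive_in G g"
begin

section \<open>The geodesic by arc length and the elements translating it\<close>

definition u :: "real \<Rightarrow> complex vec" where
  "u s = of_real (exp (s/2)) \<cdot>\<^sub>v x + of_real (exp (- s/2)) \<cdot>\<^sub>v y"

lemma u_carrier [simp]: "u s \<in> carrier_vec (n+1)" "u s \<in> carrier_vec (Suc n)"
  using xy by (auto simp: u_def)

lemma dim_u [simp]: "dim_vec (u s) = Suc n"
  using carrier_vecD[OF u_carrier(2)] .

lemma u_index: "j \<le> n \<Longrightarrow> u s $ j = of_real (exp (s/2)) * x $ j + of_real (exp (- s/2)) * y $ j"
  using xy by (simp add: u_def)

lemma hform_u: "hform n (u s) (u s') = - of_real (cosh ((s - s')/2))"
proof -
  have yx: "hform n y x = - 1/2" using hform_cnj[of n x y] nul by simp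
  have "hform n (u s) (u s') = - of_real ((exp (s/2) * exp (- s'/2) + exp (- s/2) * exp (s'/2)) / 2)"
    using xy unfolding u_def by (simp add: hform_lin nul yx algebra_simps add_divide_distrib)
  also have "exp (s/2) * exp (- s'/2) = exp ((s - s')/2)" by (simp add: exp_add[symmetric] diff_divide_distrib)
  also have "exp (- s/2) * exp (s'/2) = exp (- ((s - s')/2))" by (simp add: exp_add[symmetric] diff_divide_distrib)
  finally show ?thesis by (simp add: cosh_def)
qed

lemma hform_u_self: "hform n (u s) (u s) = - 1"
  by (simp add: hform_u)

lemma hq_u: "hq n (u s) = 1"
proof -
  have "complex_of_real (hq n (u s)) = of_real 1" using hform_u_self[of s] by (simp add: hform_self)
  then show ?thesis by (simp only: of_real_eq_iff)
qed

text \<open>The sinh addition theorem. It lets an isometry be known on the whole geodesic from its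
  values at two points.\<close>

lemma u_interpolate:
  assumes "s1 \<noteq> s2"
  shows "u s = of_real (sinh ((s - s2)/2) / sinh ((s1 - s2)/2)) \<cdot>\<^sub>v u s1 + of_real (sinh ((s1 - s)/2) / sinh ((s1 - s2)/2)) \<cdot>\<^sub>v u s2"
proof -
  let ?d = "sinh ((s1 - s2)/2)"
  have d: "?d \<noteq> 0" using assms by simp
  have sh: "2 * sinh t = exp t - exp (- t)" for t :: real by (simp add: sinh_def)
  have 1: "exp (s/2) * ?d = exp (s1/2) * sinh ((s - s2)/2) + exp (s2/2) * sinh ((s1 - s)/2)"
  proof -
    have "2 * (exp (s/2) * ?d) = exp (s/2) * (2 * ?d)" by simp
    also have "\<dots> = exp (s1/2) * (2 * sinh ((s - s2)/2)) + exp (s2/2) * (2 * sinh ((s1 - s)/2))"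
      unfolding sh by (simp add: algebra_simps exp_add[symmetric] diff_divide_distrib add_divide_distrib)
    finally show ?thesis by simp
  qed
  have 2: "exp (- s/2) * ?d = exp (- s1/2) * sinh ((s - s2)/2) + exp (- s2/2) * sinh ((s1 - s)/2)"
  proof -
    have "2 * (exp (- s/2) * ?d) = exp (- s/2) * (2 * ?d)" by simp
    also have "\<dots> = exp (- s1/2) * (2 * sinh ((s - s2)/2)) + exp (- s2/2) * (2 * sinh ((s1 - s)/2))"
      unfolding sh by (simp add: algebra_simps exp_add[symmetric] diff_divide_distrib add_divide_distrib)
    finally show ?thesis by simp
  qed
  have d1: "exp (s/2) = sinh ((s - s2)/2) / ?d * exp (s1/2) + sinh ((s1 - s)/2) / ?d * exp (s2/2)"
    using 1 d by (simp add: field_simps)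
  have d2: "exp (- s/2) = sinh ((s - s2)/2) / ?d * exp (- s1/2) + sinh ((s1 - s)/2) / ?d * exp (- s2/2)"
    using 2 d by (simp add: field_simps)
  show ?thesis
  proof (rule eq_vecI)
    fix i assume "i < dim_vec (of_real (sinh ((s - s2)/2) / ?d) \<cdot>\<^sub>v u s1 + of_real (sinh ((s1 - s)/2) / ?d) \<cdot>\<^sub>v u s2)"
    then have i: "i \<le> n" "i < n + 1" using u_carrier(1)[of s2] by auto
    have 3: "u s $ i = of_real (sinh ((s - s2)/2) / ?d * exp (s1/2) + sinh ((s1 - s)/2) / ?d * exp (s2/2)) * x $ i
      + of_real (sinh ((s - s2)/2) / ?d * exp (- s1/2) + sinh ((s1 - s)/2) / ?d * exp (- s2/2)) * y $ i"
      unfolding u_index[OF i(1)] d1[symmetric] d2[symmetric] ..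
    have "(of_real (sinh ((s - s2)/2) / ?d) \<cdot>\<^sub>v u s1 + of_real (sinh ((s1 - s)/2) / ?d) \<cdot>\<^sub>v u s2) $ i
      = of_real (sinh ((s - s2)/2) / ?d) * u s1 $ i + of_real (sinh ((s1 - s)/2) / ?d) * u s2 $ i"
      using i by simp
    also have "\<dots> = u s $ i" unfolding 3 unfolding u_index[OF i(1)] by (simp add: algebra_simps)
    finally show "u s $ i = (of_real (sinh ((s - s2)/2) / ?d) \<cdot>\<^sub>v u s1 + of_real (sinh ((s1 - s)/2) / ?d) \<cdot>\<^sub>v u s2) $ i" ..
  qed (use u_carrier(1)[of s] u_carrier(1)[of s2] in auto)
qed

text \<open>An invariant line spanned by u s is a fixed point in the ball, which freeness allows
  only for the identity.\<close>

lemma fixes_u_imp_one: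
  assumes A: "A \<in> G" and fx: "A *\<^sub>v u s = \<zeta> \<cdot>\<^sub>v u s"
  shows "A = 1\<^sub>m (n+1)"
proof (rule ccontr)
  assume ne: "A \<noteq> 1\<^sub>m (n+1)"
  define w where "w = (\<lambda>j\<in>{..<n}. u s $ j / u s $ n)"
  have un: "u s $ n \<noteq> 0" using hq_nonneg_imp_nz[of n "u s"] by (simp add: hq_u)
  have lw: "u s = (u s $ n) \<cdot>\<^sub>v lift n w"
    using un carrier_vecD[OF u_carrier(1), of s] by (intro eq_vecI) (auto simp: lift_def w_def less_Suc_eq)
  have "hq n (u s) = (cmod (u s $ n))\<^sup>2 * hq n (lift n w)" by (subst lw) (rule hq_smult[OF lift_carrier(1)])
  then have "0 < (cmod (u s $ n))\<^sup>2 * hq n (lift n w)" by (simp add: hq_u)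
  then have "0 < hq n (lift n w)" by (rule zero_less_mult_pos) (use un in simp)
  then have wb: "w \<in> ball_n n" by (simp add: hq_lift ball_n_alt space_vol_e cpts_def w_def)
  have "A *\<^sub>v lift n w = \<zeta> \<cdot>\<^sub>v lift n w"
  proof -
    have "(u s $ n) \<cdot>\<^sub>v (A *\<^sub>v lift n w) = A *\<^sub>v u s"
      by (subst (2) lw, rule mult_mat_vec[OF G_carrier[OF A] lift_carrier(1), symmetric])
    also have "\<dots> = (u s $ n) \<cdot>\<^sub>v (\<zeta> \<cdot>\<^sub>v lift n w)"
      unfolding fx by (subst lw) (simp add: smult_smult_assoc mult.commute)
    finally have "(1 / u s $ n) \<cdot>\<^sub>v ((u s $ n) \<cdot>\<^sub>v (A *\<^sub>v lift n w)) = (1 / u s $ n) \<cdot>\<^sub>v ((u s $ n) \<cdot>\<^sub>v (\<zeta> \<cdot>\<^sub>v lift n w))" by simp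
    then show ?thesis using un by (simp add: smult_smult_assoc)
  qed
  then have "denom n A w \<cdot>\<^sub>v lift n (mob n A w) = \<zeta> \<cdot>\<^sub>v lift n w" by (simp add: mult_lift[OF G_U_n1[OF A] wb])
  then have "mob n A w = w"
    by (rule lift_smult_inj) (use denom_nz[OF G_U_n1[OF A] wb] ball_in_cpts[OF wb] in auto)
  then show False using free A ne wb by (auto simp: acts_freely_def)
qed

text \<open>The unit scalar is allowed because an element of the group moves points of the ball,
  that is, lines of vectors. It is required to be the same for all s.\<close>

definition translates :: "complex mat \<Rightarrow> real \<Rightarrow> bool" where
  "translates A t \<longleftrightarrow> (\<exists>\<zeta>. cmod \<zeta> = 1 \<and> (\<forall>s. A *\<^sub>v u s = \<zeta> \<cdot>\<^sub>v u (s + t)))"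

lemma translates_zero: "A \<in> G \<Longrightarrow> translates A 0 \<Longrightarrow> A = 1\<^sub>m (n+1)"
  using fixes_u_imp_one[of A 0] by (auto simp: translates_def)

lemma translates_g: "translates g L"
  unfolding translates_def
proof (intro exI[of _ \<sigma>] conjI allI g(2))
  fix s
  have c: "g \<in> carrier_mat (n+1) (n+1)" by (rule G_carrier[OF g(1)])
  have "g *\<^sub>v u s = of_real (exp (s/2)) \<cdot>\<^sub>v (g *\<^sub>v x) + of_real (exp (- s/2)) \<cdot>\<^sub>v (g *\<^sub>v y)"
    unfolding u_def using c xy by (simp add: mult_add_distrib_mat_vec[OF c] mult_mat_vec[OF c])
  also have "\<dots> = \<sigma> \<cdot>\<^sub>v u (s + L)"
  proof (rule eq_vecI)
    fix i assume "i < dim_vec (\<sigma> \<cdot>\<^sub>v u (s + L))"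
    then have i: "i \<le> n" "i < n + 1" using u_carrier(1)[of "s + L"] by auto
    have e: "exp ((s + L)/2) = exp (s/2) * exp (L/2)" "exp (- (s + L)/2) = exp (- s/2) * exp (- L/2)"
      by (simp_all add: exp_add[symmetric] add_divide_distrib)
    have us: "u (s + L) $ i = of_real (exp (s/2) * exp (L/2)) * x $ i + of_real (exp (- s/2) * exp (- L/2)) * y $ i"
      unfolding u_index[OF i(1)] e ..
    show "(of_real (exp (s/2)) \<cdot>\<^sub>v (g *\<^sub>v x) + of_real (exp (- s/2)) \<cdot>\<^sub>v (g *\<^sub>v y)) $ i = (\<sigma> \<cdot>\<^sub>v u (s + L)) $ i"
      unfolding g(3,4) using i xy by (simp add: us) (simp add: algebra_simps)
  qed (use xy u_carrier(1)[of "s + L"] g c in auto)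
  finally show "g *\<^sub>v u s = \<sigma> \<cdot>\<^sub>v u (s + L)" .
qed

lemma translates_mult:
  assumes "A \<in> G" "B \<in> G" "translates A a" "translates B b"
  shows "translates (A * B) (a + b)"
proof -
  obtain \<zeta> \<xi> where z: "cmod \<zeta> = 1" "\<And>s. A *\<^sub>v u s = \<zeta> \<cdot>\<^sub>v u (s + a)" "cmod \<xi> = 1" "\<And>s. B *\<^sub>v u s = \<xi> \<cdot>\<^sub>v u (s + b)"
    using assms by (auto simp: translates_def)
  have "A * B *\<^sub>v u s = (\<xi> * \<zeta>) \<cdot>\<^sub>v u (s + (a + b))" for s
    using assoc_mult_mat_vec[OF G_carrier[OF assms(1)] G_carrier[OF assms(2)] u_carrier(1), of s]
      mult_mat_vec[OF G_carrier[OF assms(1)] u_carrier(1), of \<xi> "s + b"]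
    by (simp add: z smult_smult_assoc algebra_simps)
  then show ?thesis unfolding translates_def using z by (intro exI[of _ "\<xi> * \<zeta>"]) (auto simp: norm_mult)
qed

lemma translates_minv:
  assumes A: "A \<in> G" "translates A a"
  shows "translates (minv A) (- a)"
proof -
  obtain \<zeta> where z: "cmod \<zeta> = 1" "\<And>s. A *\<^sub>v u s = \<zeta> \<cdot>\<^sub>v u (s + a)" using A by (auto simp: translates_def)
  have z0: "\<zeta> \<noteq> 0" using z(1) by auto
  have "minv A *\<^sub>v u s = inverse \<zeta> \<cdot>\<^sub>v u (s + - a)" for s
  proof -
    have "u (s + - a) = minv A *\<^sub>v (A *\<^sub>v u (s + - a))" using minv_cancel(1)[OF A(1) u_carrier(1)] by simp
    also have "\<dots> = \<zeta> \<cdot>\<^sub>v (minv A *\<^sub>v u s)"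
      using mult_mat_vec[OF G_carrier[OF minv(1)[OF A(1)]] u_carrier(1), of \<zeta> s] by (simp add: z)
    finally show ?thesis using z0 by (simp add: smult_smult_assoc)
  qed
  then show ?thesis unfolding translates_def using z by (intro exI[of _ "inverse \<zeta>"]) (auto simp: norm_inverse)
qed

lemma translates_one: "translates (1\<^sub>m (n+1)) 0"
  unfolding translates_def
proof (intro exI[of _ 1] conjI allI)
  show "1\<^sub>m (n+1) *\<^sub>v u s = 1 \<cdot>\<^sub>v u (s + 0)" for s
    using one_mult_mat_vec[OF u_carrier(1), of s] by simp
qed simp

lemma G_pow: "D \<in> G \<Longrightarrow> D ^\<^sub>m m \<in> G"
proof (induction m)
  case 0
  then show ?case using G_carrier[of D] G_one by simp
qed (auto intro: G_mult)

lemma translates_pow: "D \<in> G \<Longrightarrow> translates D t \<Longrightarrow> translates (D ^\<^sub>m m) (of_nat m * t)"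
proof (induction m)
  case 0
  then show ?case using G_carrier[of D] translates_one by simp
next
  case (Suc m)
  then show ?case using translates_mult[OF G_pow[of D m], of D "of_nat m * t" t] by (simp add: algebra_simps)
qed

lemma translates_cosh: "translates A t \<Longrightarrow> cmod (hform n (A *\<^sub>v u 0) (u 0)) = cosh (t/2)"
  by (auto simp: translates_def hform_smult_left hform_u norm_mult)

text \<open>If shorter translations existed, there would be a least one t0, and it would have to
  divide L. Then g would be a proper power of the element realising t0, against primitivity.\<close>

lemma no_short_translation:
  assumes A: "A \<in> G" "translates A t" "0 < t" "t < L"
  shows False
proof -
  define S where "S = {t. \<exists>B\<in>G. translates B t \<and> 0 < t \<and> t < L}"
  \<comment> \<open>Two applications of the lower bound for the last coordinate, each losing a
    factor 2 |u(0)_n|, confine every translation shorter than L to this set, which is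
    finite.\<close>
  define Gb where "Gb = {B \<in> G. cmod (B $$ (n,n)) \<le> cosh L * 4 * (cmod (u 0 $ n))\<^sup>2}"
  have un: "0 < cmod (u 0 $ n)" using hq_nonneg_imp_nz[of n "u 0"] by (simp add: hq_u)
  have "S \<subseteq> (\<lambda>B. 2 * arcosh (cmod (hform n (B *\<^sub>v u 0) (u 0)))) ` Gb"
  proof
    fix t assume "t \<in> S"
    then obtain B where B: "B \<in> G" "translates B t" "0 < t" "t < L" by (auto simp: S_def)
    have Bc: "B *\<^sub>v u 0 \<in> carrier_vec (n+1)" using G_carrier[OF B(1)] by simp
    have hB: "hq n (B *\<^sub>v u 0) = 1" using U_n1_hq[OF G_U_n1[OF B(1)] u_carrier(1)] by (simp add: hq_u)
    have "cmod (B $$ (n,n)) / (2 * cmod (u 0 $ n)) \<le> cmod ((B *\<^sub>v u 0) $ n)"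
      using U_n1_last_bounds(1)[OF G_U_n1[OF B(1)] G_U_n1[OF minv(1)[OF B(1)]] minv(2)[OF B(1)] u_carrier(1), of 0] by (simp add: hq_u)
    moreover have "cmod ((B *\<^sub>v u 0) $ n) / (2 * cmod (u 0 $ n)) \<le> cmod (hform n (u 0) (B *\<^sub>v u 0))"
      using hform_lower_hq[of n "B *\<^sub>v u 0" "u 0"] by (simp add: hq_u hB)
    moreover have "cmod (hform n (u 0) (B *\<^sub>v u 0)) = cosh (t/2)"
      using translates_cosh[OF B(2)] by (metis hform_cnj complex_mod_cnj)
    moreover have "cosh (t/2) \<le> cosh L" using B by (subst cosh_real_nonneg_le_iff) auto
    ultimately have "cmod ((B *\<^sub>v u 0) $ n) / (2 * cmod (u 0 $ n)) \<le> cosh L"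
      "cmod (B $$ (n,n)) / (2 * cmod (u 0 $ n)) \<le> cmod ((B *\<^sub>v u 0) $ n)" by linarith+
    then have "cmod ((B *\<^sub>v u 0) $ n) \<le> cosh L * (2 * cmod (u 0 $ n))"
      "cmod (B $$ (n,n)) \<le> cmod ((B *\<^sub>v u 0) $ n) * (2 * cmod (u 0 $ n))"
      using un by (auto simp: pos_divide_le_eq)
    then have "cmod (B $$ (n,n)) \<le> (cosh L * (2 * cmod (u 0 $ n))) * (2 * cmod (u 0 $ n))"
      using un by (meson less_imp_le mult_nonneg_nonneg mult_right_mono order_trans zero_le_numeral)
    then have "B \<in> Gb" using B(1) by (simp add: Gb_def power2_eq_square mult_ac)
    moreover have "t = 2 * arcosh (cmod (hform n (B *\<^sub>v u 0) (u 0)))"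
      unfolding translates_cosh[OF B(2)] using B by (simp add: arcosh_cosh_real)
    ultimately show "t \<in> (\<lambda>B. 2 * arcosh (cmod (hform n (B *\<^sub>v u 0) (u 0)))) ` Gb" by blast
  qed
  then have fin: "finite S" by (rule finite_subset) (simp add: Gb_def finite_nn_le)
  have ne: "S \<noteq> {}" using A by (auto simp: S_def)
  define t0 where "t0 = Min S"
  have "t0 \<in> S" unfolding t0_def by (rule Min_in[OF fin ne])
  then obtain D where D: "D \<in> G" "translates D t0" "0 < t0" "t0 < L" by (auto simp: S_def)
  \<comment> \<open>Division with remainder: g times the inverse of D^q translates by the remainder,
    which is below t0 and so must vanish. Freeness then gives g = D^q.\<close>
  define q where "q = nat \<lfloor>L / t0\<rfloor>"
  have "1 \<le> L / t0" using D by simp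
  then have q: "real q \<le> L / t0" "L / t0 < real q + 1"
    unfolding q_def by (auto simp: of_nat_nat le_floor_iff)
  have r: "0 \<le> L - real q * t0" "L - real q * t0 < t0"
    using q D(3) by (auto simp: field_simps)
  let ?Dq = "D ^\<^sub>m q"
  have Dq: "?Dq \<in> G" by (rule G_pow[OF D(1)])
  let ?B = "g * minv ?Dq"
  have B: "?B \<in> G" by (rule G_mult[OF g(1) minv(1)[OF Dq]])
  have trB: "translates ?B (L - real q * t0)"
    using translates_mult[OF g(1) minv(1)[OF Dq] translates_g translates_minv[OF Dq translates_pow[OF D(1,2)]]] by simp
  have r0: "L - real q * t0 = 0"
  proof (rule ccontr)
    assume "L - real q * t0 \<noteq> 0"
    then have "L - real q * t0 \<in> S" using r B trB D unfolding S_def by (intro CollectI bexI[of _ ?B]) auto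
    then have "t0 \<le> L - real q * t0" unfolding t0_def by (rule Min_le[OF fin])
    then show False using r by simp
  qed
  have "?B = 1\<^sub>m (n+1)" using translates_zero[OF B] trB unfolding r0 by simp
  have "g = g * (minv ?Dq * ?Dq)" using minv(2)[OF Dq] right_mult_one_mat[OF G_carrier[OF g(1)]] by simp
  also have "\<dots> = ?B * ?Dq" using assoc_mult_mat[OF G_carrier[OF g(1)] G_carrier[OF minv(1)[OF Dq]] G_carrier[OF Dq]] by simp
  also have "\<dots> = ?Dq" using \<open>?B = 1\<^sub>m (n+1)\<close> left_mult_one_mat[OF G_carrier[OF Dq]] by simp
  finally have gq: "g = ?Dq" .
  have "2 \<le> q"
  proof (rule ccontr)
    assume "\<not> 2 \<le> q"
    then have "real q * t0 \<le> 1 * t0" using D(3) by (intro mult_right_mono) auto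
    then show False using r0 D(4) by simp
  qed
  then show False using prim gq D(1) by (auto simp: primitive_in_def)
qed

text \<open>Two coincidences with different second parameters would make A carry two points of the
  geodesic to two of its points. Then A either shifts the geodesic by less than L or reverses it; a
  nonzero shift contradicts primitivity, while a zero shift or a reversal fixes a point and
  contradicts freeness.\<close>

lemma coincidence_unique:
  assumes A: "A \<in> G" "A \<noteq> 1\<^sub>m (n+1)"
    and s1: "s1 \<in> {0..L}" "s1' \<in> {0..L}" "cmod (hform n (A *\<^sub>v u s1) (u s1')) = 1"
    and s2: "s2 \<in> {0..L}" "s2' \<in> {0..L}" "cmod (hform n (A *\<^sub>v u s2) (u s2')) = 1"
  shows "s1' = s2'"
proof (rule ccontr)
  assume ne': "s1' \<noteq> s2'"
  have Ac: "A *\<^sub>v u s \<in> carrier_vec (n+1)" for s using G_carrier[OF A(1)] by simp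
  have AA: "hform n (A *\<^sub>v u s) (A *\<^sub>v u s') = hform n (u s) (u s')" for s s'
    by (rule U_n1_hform[OF G_U_n1[OF A(1)]]) auto
  have As: "hform n (A *\<^sub>v u s) (A *\<^sub>v u s) = -1" for s unfolding AA by (rule hform_u_self)
  define z1 z2 where "z1 = - hform n (A *\<^sub>v u s1) (u s1')" and "z2 = - hform n (A *\<^sub>v u s2) (u s2')"
  have n12: "cmod z1 = 1" "cmod z2 = 1" using s1 s2 by (auto simp: z1_def z2_def)
  have e1: "A *\<^sub>v u s1 = z1 \<cdot>\<^sub>v u s1'" unfolding z1_def
    by (rule reversed_cauchy_schwarz(2)[OF Ac As u_carrier(1) hform_u_self s1(3)])
  have e2: "A *\<^sub>v u s2 = z2 \<cdot>\<^sub>v u s2'" unfolding z2_def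
    by (rule reversed_cauchy_schwarz(2)[OF Ac As u_carrier(1) hform_u_self s2(3)])
  \<comment> \<open>Since hyperbolic cosines are positive, comparing moduli shows that the two
    distances agree and comparing phases shows z1 = z2.\<close>
  have cc: "complex_of_real (cosh ((s1 - s2)/2)) = z1 * cnj z2 * of_real (cosh ((s1' - s2')/2))"
    using AA[of s1 s2] unfolding e1 e2 by (simp add: hform_smult_left hform_smult_right hform_u mult_ac)
  have ceq: "cosh ((s1 - s2)/2) = cosh ((s1' - s2')/2)"
    using arg_cong[OF cc, of cmod] n12 by (simp add: norm_mult cosh_real_nonneg)
  have "cosh ((s1' - s2')/2) \<noteq> 0" using cosh_real_pos[of "(s1' - s2')/2"] by linarith
  then have "complex_of_real (cosh ((s1' - s2')/2)) \<noteq> 0" by (simp only: of_real_eq_0_iff not_False_eq_True)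
  then have z12: "z1 * cnj z2 = 1" using cc unfolding ceq by (metis mult_cancel_right1)
  have "z1 * (cnj z2 * z2) = z2" using z12 by (simp add: mult.assoc[symmetric])
  moreover have "cnj z2 * z2 = 1" using n12(2) by (metis complex_norm_square mult.commute of_real_1 power_one)
  ultimately have z: "z1 = z2" by simp
  have absd: "\<bar>s1 - s2\<bar> = \<bar>s1' - s2'\<bar>"
  proof -
    have "cosh \<bar>(s1 - s2)/2\<bar> = cosh \<bar>(s1' - s2')/2\<bar>"
      using \<open>cosh ((s1 - s2)/2) = cosh ((s1' - s2')/2)\<close> by (simp only: cosh_real_abs)
    then have "\<bar>(s1 - s2)/2\<bar> = \<bar>(s1' - s2')/2\<bar>"
      by (metis abs_ge_zero arcosh_cosh_real)
    then show ?thesis by simp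
  qed
  have ne: "s1 \<noteq> s2" using absd ne' by auto
  let ?a = "\<lambda>s. complex_of_real (sinh ((s - s2)/2) / sinh ((s1 - s2)/2))"
  let ?b = "\<lambda>s. complex_of_real (sinh ((s1 - s)/2) / sinh ((s1 - s2)/2))"
  have Au: "A *\<^sub>v u s = z1 \<cdot>\<^sub>v (?a s \<cdot>\<^sub>v u s1' + ?b s \<cdot>\<^sub>v u s2')" for s
  proof -
    have "A *\<^sub>v u s = A *\<^sub>v (?a s \<cdot>\<^sub>v u s1 + ?b s \<cdot>\<^sub>v u s2)" using u_interpolate[OF ne, of s] by simp
    also have "\<dots> = ?a s \<cdot>\<^sub>v (A *\<^sub>v u s1) + ?b s \<cdot>\<^sub>v (A *\<^sub>v u s2)"
      using mult_add_distrib_mat_vec[OF G_carrier[OF A(1)], of "?a s \<cdot>\<^sub>v u s1" "?b s \<cdot>\<^sub>v u s2"]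
        mult_mat_vec[OF G_carrier[OF A(1)] u_carrier(1)] by simp
    also have "\<dots> = z1 \<cdot>\<^sub>v (?a s \<cdot>\<^sub>v u s1' + ?b s \<cdot>\<^sub>v u s2')"
      unfolding e1 e2 z by (intro eq_vecI) (auto simp: algebra_simps)
    finally show ?thesis .
  qed
  from absd consider "s1 - s2 = s1' - s2'" | "s1 - s2 = s2' - s1'" by linarith
  then show False
  proof cases
    case 1
    define t where "t = s1' - s1"
    have t: "s1' = s1 + t" "s2' = s2 + t" using 1 by (auto simp: t_def)
    have "A *\<^sub>v u s = z1 \<cdot>\<^sub>v u (s + t)" for s
    proof -
      have "u (s + t) = ?a s \<cdot>\<^sub>v u s1' + ?b s \<cdot>\<^sub>v u s2'"
        using u_interpolate[OF ne', of "s + t"] unfolding t by simp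
      then show ?thesis using Au[of s] by simp
    qed
    then have translates: "translates A t" using n12 by (auto simp: translates_def)
    \<comment> \<open>A shift by exactly L or -L inside [0, L] would need both s1 and s2 at the same
      endpoint, but they differ.\<close>
    have lt: "t < L" "- L < t" using s1 s2 ne unfolding t by auto
    consider "t = 0" | "0 < t" | "t < 0" by linarith
    then show False
    proof cases
      case 1
      then show False using translates_zero[OF A(1)] translates A(2) by simp
    next
      case 2
      then show False using no_short_translation[OF A(1) translates] lt by simp
    next
      case 3
      then show False using no_short_translation[OF minv(1)[OF A(1)] translates_minv[OF A(1) translates]] lt by simp
    qed
  next
    case 2
    \<comment> \<open>In the reversed case A acts as s -> t - s, with fixed parameter t/2.\<close>
    define t where "t = s1' + s1"
    have t: "s1' = t - s1" "s2' = t - s2" using 2 by (auto simp: t_def)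
    have sm: "sinh (- q / 2) = - sinh (q / 2)" for q :: real using sinh_minus[of "q/2"] by simp
    have c1: "sinh ((t/2 - (t - s2))/2) / sinh ((t - s1 - (t - s2))/2) = sinh ((t/2 - s2)/2) / sinh ((s1 - s2)/2)"
      using sm[of "t/2 - s2"] sm[of "s1 - s2"] by (simp add: algebra_simps)
    have c2: "sinh ((t - s1 - t/2)/2) / sinh ((t - s1 - (t - s2))/2) = sinh ((s1 - t/2)/2) / sinh ((s1 - s2)/2)"
      using sm[of "s1 - t/2"] sm[of "s1 - s2"] by (simp add: algebra_simps)
    have "u (t/2) = ?a (t/2) \<cdot>\<^sub>v u s1' + ?b (t/2) \<cdot>\<^sub>v u s2'"
      using u_interpolate[OF ne', of "t/2"] unfolding t c1 c2 .
    then have "A *\<^sub>v u (t/2) = z1 \<cdot>\<^sub>v u (t/2)" using Au[of "t/2"] by simp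
    then show False using fixes_u_imp_one[OF A(1)] A(2) by blast
  qed
qed

end

section \<open>Asymptotics of the sum over the lattice\<close>

lemma cosh_le_exp_quadratic: "cosh y \<le> exp ((y::real)\<^sup>2 / 2)"
proof -
  have tanh_le: "tanh x \<le> x" if "0 \<le> x" for x :: real
  proof -
    have "0 - tanh 0 \<le> x - tanh x"
    proof (rule DERIV_nonneg_imp_nondecreasing[OF that, of "\<lambda>x. x - tanh x"])
      fix z :: real
      have "cosh z \<noteq> 0" using cosh_real_pos[of z] by linarith
      then show "\<exists>d. ((\<lambda>x. x - tanh x) has_real_derivative d) (at z) \<and> 0 \<le> d"
        by (intro exI[of _ "(tanh z)\<^sup>2"]) (auto intro!: derivative_eq_intros)
    qed
    then show ?thesis by simp
  qed
  have pos: "cosh x \<le> exp (x\<^sup>2 / 2)" if "0 \<le> x" for x :: real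
  proof -
    have "0\<^sup>2 / 2 - ln (cosh 0) \<le> x\<^sup>2 / 2 - ln (cosh x)"
    proof (rule DERIV_nonneg_imp_nondecreasing[OF that, of "\<lambda>x. x\<^sup>2 / 2 - ln (cosh x)"])
      fix z :: real assume z: "0 \<le> z"
      have "0 < cosh z" by (rule cosh_real_pos)
      then show "\<exists>d. ((\<lambda>x. x\<^sup>2 / 2 - ln (cosh x)) has_real_derivative d) (at z) \<and> 0 \<le> d"
        using tanh_le[OF z]
        by (intro exI[of _ "z - tanh z"]) (auto intro!: derivative_eq_intros simp: tanh_def)
    qed
    then have "ln (cosh x) \<le> x\<^sup>2 / 2" by simp
    then have "exp (ln (cosh x)) \<le> exp (x\<^sup>2 / 2)" by (simp only: exp_le_cancel_iff)
    then show ?thesis by (simp add: cosh_real_pos)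
  qed
  show ?thesis using pos[of "\<bar>y\<bar>"] by (simp add: cosh_real_abs)
qed

lemma cauchy_kernel_integral:
  assumes "c > 0"
  shows "integrable lborel (\<lambda>s. inverse (1 + c\<^sup>2 * (s - s0)\<^sup>2))"
    and "(\<integral>s. inverse (1 + c\<^sup>2 * (s - s0)\<^sup>2) \<partial>lborel) = pi / c"
proof -
  have 1: "integrable lborel (\<lambda>x::real. inverse (1 + x\<^sup>2))"
    using integrable_inverse_1_plus_square by (simp add: set_integrable_def)
  have 2: "(\<integral>x. inverse (1 + x\<^sup>2) \<partial>lborel) = pi"
    using LBINT_inverse_1_plus_square
    by (simp add: interval_lebesgue_integral_def set_lebesgue_integral_def)
  have e: "inverse (1 + (- c * s0 + c * s)\<^sup>2) = inverse (1 + c\<^sup>2 * (s - s0)\<^sup>2)" for s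
    by (simp add: power2_eq_square algebra_simps)
  show "integrable lborel (\<lambda>s. inverse (1 + c\<^sup>2 * (s - s0)\<^sup>2))"
    using lborel_integrable_real_affine[OF 1, of c "- c * s0"] assms unfolding e by simp
  have "pi = \<bar>c\<bar> *\<^sub>R (\<integral>s. inverse (1 + (- c * s0 + c * s)\<^sup>2) \<partial>lborel)"
    unfolding 2[symmetric] by (rule lborel_integral_real_affine) (use assms in simp)
  then show "(\<integral>s. inverse (1 + c\<^sup>2 * (s - s0)\<^sup>2) \<partial>lborel) = pi / c"
    unfolding e using assms by (simp add: field_simps)
qed

text \<open>Bernoulli's inequality for (1 + q^2/4)^(N/2). The Cauchy kernel serves as majorant
  because its integral is explicit and scales like 1 / sqrt N, exactly the order of the diagonal
  term.\<close>

lemma inverse_power_le_cauchy_kernel: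
  fixes h q :: real
  assumes h: "0 \<le> h" "1 + q\<^sup>2 / 4 \<le> h\<^sup>2" and N: "2 \<le> N"
  shows "inverse h ^ N \<le> inverse (1 + (sqrt (real N) / 4)\<^sup>2 * q\<^sup>2)"
proof -
  \<comment> \<open>Halving N rounds down; N >= 2 ensures that at least N/4 survives.\<close>
  define M where "M = N div 2"
  have NM: "2 * M \<le> N" "real N / 4 \<le> real M" using N unfolding M_def by linarith+
  have "1 \<le> h\<^sup>2" using h(2) zero_le_power2[of q] by linarith
  then have h1: "1 \<le> h" using h(1) power2_le_imp_le[of 1 h] by simp
  have "1 + real N * q\<^sup>2 / 16 \<le> 1 + real M * (q\<^sup>2 / 4)"
    using mult_right_mono[OF NM(2), of "q\<^sup>2 / 4"] by simp
  also have "\<dots> \<le> (1 + q\<^sup>2 / 4) ^ M"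
    by (rule Bernoulli_inequality, rule order_trans[of _ 0]) auto
  also have "\<dots> \<le> (h\<^sup>2) ^ M" by (rule power_mono[OF h(2)]) simp
  also have "\<dots> = h ^ (2 * M)" by (simp add: power_mult)
  also have "\<dots> \<le> h ^ N" by (rule power_increasing[OF NM(1) h1])
  finally have "1 + real N * q\<^sup>2 / 16 \<le> h ^ N" .
  then have "inverse (h ^ N) \<le> inverse (1 + real N * q\<^sup>2 / 16)"
    by (rule le_imp_inverse_le) (simp add: add_pos_nonneg)
  then show ?thesis by (simp add: power_inverse power_divide)
qed

lemma sqrt_times_power_tendsto_0:
  assumes "0 \<le> c" "c < (1::real)"
  shows "(\<lambda>N. sqrt (real N) * c ^ N) \<longlonglongrightarrow> 0"
proof (rule tendsto_sandwich[of "\<lambda>_. 0" _ _ "\<lambda>N. real N * c ^ N"])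
  show "(\<lambda>N. real N * c ^ N) \<longlonglongrightarrow> 0" using powser_times_n_limit_0[of c] assms by simp
  show "eventually (\<lambda>N. sqrt (real N) * c ^ N \<le> real N * c ^ N) sequentially"
    using eventually_ge_at_top[of 1]
  proof eventually_elim
    case (elim N)
    have "sqrt (real N) \<le> real N" using elim by (intro real_le_lsqrt) (auto simp: power2_eq_square)
    then show ?case using assms by (intro mult_right_mono) auto
  qed
qed (use assms in auto)

lemma gaussian_integral_8:
  "integrable lborel (\<lambda>x::real. exp (- x\<^sup>2 / 8))" "(\<integral>x. exp (- x\<^sup>2 / 8) \<partial>lborel) = sqrt (8 * pi)"
proof -
  have e: "exp (- x\<^sup>2 / 8) = sqrt (8 * pi) * normal_density 0 2 x" for x
    by (simp add: normal_density_def mult_ac)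
  show "integrable lborel (\<lambda>x::real. exp (- x\<^sup>2 / 8))" "(\<integral>x. exp (- x\<^sup>2 / 8) \<partial>lborel) = sqrt (8 * pi)"
    unfolding e by simp_all
qed

text \<open>The quadratic lower bound and the Gaussian upper bound for cosh squeeze the power
  between (1 + x^2 / (8N))^N and exp (x^2 / 8).\<close>

lemma cosh_power_limit: "(\<lambda>N. cosh (x / (2 * sqrt (real N))) ^ N) \<longlonglongrightarrow> exp (x\<^sup>2 / 8)"
proof (rule tendsto_sandwich[of "\<lambda>N. (1 + x\<^sup>2 / 8 / real N) ^ N" _ _ "\<lambda>_. exp (x\<^sup>2 / 8)"])
  show "(\<lambda>N. (1 + x\<^sup>2 / 8 / real N) ^ N) \<longlonglongrightarrow> exp (x\<^sup>2 / 8)"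
    by (rule tendsto_exp_limit_sequentially)
  have y2: "(x / (2 * sqrt (real N)))\<^sup>2 / 2 = x\<^sup>2 / 8 / real N" for N
    by (simp add: power_divide power_mult_distrib)
  show "eventually (\<lambda>N. (1 + x\<^sup>2 / 8 / real N) ^ N \<le> cosh (x / (2 * sqrt (real N))) ^ N) sequentially"
  proof (rule always_eventually, rule allI)
    fix N
    show "(1 + x\<^sup>2 / 8 / real N) ^ N \<le> cosh (x / (2 * sqrt (real N))) ^ N"
      using cosh_ge_quadratic[of "x / (2 * sqrt (real N))"] unfolding y2 by (intro power_mono) auto
  qed
  show "eventually (\<lambda>N. cosh (x / (2 * sqrt (real N))) ^ N \<le> exp (x\<^sup>2 / 8)) sequentially"
    using eventually_gt_at_top[of 0]
  proof eventually_elim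
    case (elim N)
    have "cosh (x / (2 * sqrt (real N))) ^ N \<le> exp (x\<^sup>2 / 8 / real N) ^ N"
      using cosh_le_exp_quadratic[of "x / (2 * sqrt (real N))"] unfolding y2 by (intro power_mono) auto
    also have "\<dots> = exp (x\<^sup>2 / 8)" using elim by (simp add: exp_of_nat_mult[symmetric])
    finally show ?case .
  qed
qed simp

section \<open>Double integrals along the geodesic\<close>

context lattice_geodesic
begin

text \<open>Freezing the parameter outside [0, L] makes bounds on the curve hold for every real s
  and not only on the support of the measure.\<close>

definition clip :: "real \<Rightarrow> real" where "clip s = max 0 (min L s)"

lemma clip_range: "clip s \<in> {0..L}" using L by (auto simp: clip_def)

lemma clip_id: "s \<in> {0<..<L} \<Longrightarrow> clip s = s" by (auto simp: clip_def)

definition UU :: "real \<Rightarrow> complex vec" where "UU s = u (clip s)"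

text \<open>Half the arc length of one period: in the parameter t = tanh (s/2) this is dt / (1 -
  t^2), see \<open>distr_TT_tanh\<close>.\<close>

definition TT :: "real measure" where "TT = density lborel (\<lambda>s. ennreal (indicator {0<..<L} s / 2))"

lemma sets_TT [simp, measurable_cong]: "sets TT = sets borel" by (simp add: TT_def)

lemma space_TT [simp]: "space TT = UNIV" by (simp add: TT_def)

lemma emeasure_TT: "emeasure TT UNIV = ennreal (L / 2)"
proof -
  have "emeasure TT UNIV = (\<integral>\<^sup>+s. ennreal (indicator {0<..<L} s / 2) \<partial>lborel)"
    unfolding TT_def by (subst emeasure_density) auto
  also have "\<dots> = (\<integral>\<^sup>+s. ennreal (1/2) * indicator {0<..<L} s \<partial>lborel)"
    by (rule nn_integral_cong) (auto simp: indicator_def)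
  also have "\<dots> = ennreal (1/2) * ennreal L" using L by (subst nn_integral_cmult_indicator) auto
  also have "\<dots> = ennreal (1/2 * L)" by (rule ennreal_mult'[symmetric]) simp
  also have "1/2 * L = L / 2" by simp
  finally show ?thesis .
qed

lemma finite_measure_TT: "finite_measure TT" by (rule finite_measureI) (simp add: emeasure_TT)

lemma measure_TT: "measure TT (space TT) = L / 2"
  using L by (simp add: measure_def emeasure_TT)

lemma measure_TT_UNIV: "measure TT UNIV = L / 2"
  using measure_TT by simp

lemma integral_TT:
  fixes f :: "real \<Rightarrow> real"
  assumes "f \<in> borel_measurable borel"
  shows "(\<integral>s. f s \<partial>TT) = (\<integral>s. indicator {0<..<L} s / 2 * f s \<partial>lborel)"
  unfolding TT_def using assms by (subst integral_density) auto

lemma AE_TT: "AE s in TT. s \<in> {0<..<L}"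
  unfolding TT_def by (subst AE_density) (auto simp: indicator_def)

lemma AE_TT_finite: "finite S \<Longrightarrow> AE s in TT. s \<notin> S"
  unfolding TT_def by (subst AE_density) (auto intro: eventually_mono[OF AE_not_in[OF finite_imp_null_set_lborel]])

definition EE :: "complex mat \<Rightarrow> real \<Rightarrow> real \<Rightarrow> complex" where
  "EE A s s' = hform n (A *\<^sub>v UU s) (UU s')"

lemma hform_Au:
  assumes "A \<in> G"
  shows "hform n (A *\<^sub>v u s) w = of_real (exp (s/2)) * hform n (A *\<^sub>v x) w + of_real (exp (- s/2)) * hform n (A *\<^sub>v y) w"
proof -
  note c = G_carrier[OF assms]
  have "A *\<^sub>v u s = of_real (exp (s/2)) \<cdot>\<^sub>v (A *\<^sub>v x) + of_real (exp (- s/2)) \<cdot>\<^sub>v (A *\<^sub>v y)"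
    unfolding u_def using c xy by (simp add: mult_add_distrib_mat_vec[OF c] mult_mat_vec[OF c])
  then show ?thesis using c xy by (simp add: hform_lin)
qed

lemma hform_right_u: "hform n v (u s) = of_real (exp (s/2)) * hform n v x + of_real (exp (- s/2)) * hform n v y"
  unfolding u_def using xy by (simp add: hform_lin)

lemma EE_measurable [measurable]:
  assumes "A \<in> G"
  shows "(\<lambda>p. EE A (fst p) (snd p)) \<in> borel_measurable (borel \<Otimes>\<^sub>M borel)"
  unfolding EE_def UU_def hform_Au[OF assms] hform_right_u clip_def by measurable

lemma cmod_hform_translate_ge_1:
  assumes "A \<in> G"
  shows "1 \<le> cmod (hform n (A *\<^sub>v u s) (u s'))"
proof (rule reversed_cauchy_schwarz(1)[OF _ _ u_carrier(1) hform_u_self])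
  show "A *\<^sub>v u s \<in> carrier_vec (n+1)" using G_carrier[OF assms] by simp
  show "hform n (A *\<^sub>v u s) (A *\<^sub>v u s) = - 1"
    using U_n1_hform[OF G_U_n1[OF assms] u_carrier(1) u_carrier(1)] hform_u_self by simp
qed

lemma cmod_EE_ge_1: "A \<in> G \<Longrightarrow> 1 \<le> cmod (EE A s s')"
  by (simp add: EE_def UU_def cmod_hform_translate_ge_1)

definition kN :: "complex mat \<Rightarrow> nat \<Rightarrow> real \<Rightarrow> real \<Rightarrow> real" where
  "kN A N s s' = inverse (cmod (EE A s s')) ^ N"

lemma kN_measurable:
  assumes "A \<in> G"
  shows "(\<lambda>p. kN A N (fst p) (snd p)) \<in> borel_measurable (borel \<Otimes>\<^sub>M borel)"
proof -
  note [measurable] = EE_measurable[OF assms]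
  show ?thesis unfolding kN_def by measurable
qed

lemma kN_measurable1:
  assumes "A \<in> G"
  shows "(\<lambda>s. kN A N s s') \<in> borel_measurable borel"
  using measurable_compose[OF measurable_Pair2'[of s' borel borel] kN_measurable[OF assms]] by simp

lemma kN_le_1: "A \<in> G \<Longrightarrow> kN A N s s' \<le> 1"
  unfolding kN_def using cmod_EE_ge_1[of A s s'] by (intro power_le_one) (auto simp: inverse_le_1_iff)

lemma kN_nonneg: "0 \<le> kN A N s s'" by (simp add: kN_def)

text \<open>For fixed s' the pairing is an exponential combination in s, bounded below by 1 in
  modulus. The Cauchy kernel with c = sqrt N / 4 has integral 4 pi / sqrt N, and the density of
  \<open>TT\<close> halves it. The bound is uniform in A and s'.\<close>

lemma inner_bound:
  assumes A: "A \<in> G" and N: "2 \<le> N"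
  shows "sqrt (real N) * (\<integral>s. kN A N s s' \<partial>TT) \<le> 2 * pi"
proof -
  let ?w = "u (clip s')"
  have ge: "1 \<le> cmod (of_real (exp (s/2)) * hform n (A *\<^sub>v x) ?w + of_real (exp (- s/2)) * hform n (A *\<^sub>v y) ?w)" for s
    using cmod_hform_translate_ge_1[OF A, of s "clip s'"] unfolding hform_Au[OF A] .
  obtain s0 where s0: "\<And>s. 1 + (s - s0)\<^sup>2 / 4 \<le> (cmod (of_real (exp (s/2)) * hform n (A *\<^sub>v x) ?w + of_real (exp (- s/2)) * hform n (A *\<^sub>v y) ?w))\<^sup>2"
    using exp_combination_lower[OF ge] by blast
  let ?c = "sqrt (real N) / 4"
  have c: "0 < ?c" using N by simp
  note K = cauchy_kernel_integral[OF c, of s0]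
  have "(\<integral>s. kN A N s s' \<partial>TT) = (\<integral>s. indicator {0<..<L} s / 2 * kN A N s s' \<partial>lborel)"
    by (rule integral_TT[OF kN_measurable1[OF A]])
  also have "\<dots> \<le> (\<integral>s. inverse (1 + ?c\<^sup>2 * (s - s0)\<^sup>2) / 2 \<partial>lborel)"
  proof (rule integral_mono_AE')
    show "integrable lborel (\<lambda>s. inverse (1 + ?c\<^sup>2 * (s - s0)\<^sup>2) / 2)" using K(1) by simp
    show "AE s in lborel. indicator {0<..<L} s / 2 * kN A N s s' \<le> inverse (1 + ?c\<^sup>2 * (s - s0)\<^sup>2) / 2"
    proof (rule AE_I2)
      fix s :: real
      show "indicator {0<..<L} s / 2 * kN A N s s' \<le> inverse (1 + ?c\<^sup>2 * (s - s0)\<^sup>2) / 2"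
      proof (cases "s \<in> {0<..<L}")
        case True
        have "kN A N s s' \<le> inverse (1 + ?c\<^sup>2 * (s - s0)\<^sup>2)"
          unfolding kN_def EE_def UU_def clip_id[OF True] hform_Au[OF A]
          by (rule inverse_power_le_cauchy_kernel[OF _ s0 N]) simp
        then show ?thesis using True by simp
      next
        case False
        have "0 \<le> ?c\<^sup>2 * (s - s0)\<^sup>2" by (rule mult_nonneg_nonneg) auto
        then show ?thesis using False by simp
      qed
    qed
    show "AE s in lborel. 0 \<le> inverse (1 + ?c\<^sup>2 * (s - s0)\<^sup>2) / 2"
    proof (rule AE_I2)
      fix s :: real
      have "0 \<le> ?c\<^sup>2 * (s - s0)\<^sup>2" by (rule mult_nonneg_nonneg) auto
      then show "0 \<le> inverse (1 + ?c\<^sup>2 * (s - s0)\<^sup>2) / 2" by simp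
    qed
  qed
  also have "\<dots> = (pi / ?c) / 2" using K(2) by simp
  finally have "sqrt (real N) * (\<integral>s. kN A N s s' \<partial>TT) \<le> sqrt (real N) * ((pi / ?c) / 2)"
    by (rule mult_left_mono) simp
  also have "\<dots> = 2 * pi" using N by (simp add: field_simps)
  finally show ?thesis .
qed

definition JJ :: "complex mat \<Rightarrow> nat \<Rightarrow> real" where
  "JJ A N = (\<integral>s'. \<integral>s. kN A N s s' \<partial>TT \<partial>TT)"

lemma inner_measurable:
  assumes A: "A \<in> G"
  shows "(\<lambda>s'. \<integral>s. kN A N s s' \<partial>TT) \<in> borel_measurable borel"
proof -
  interpret finite_measure TT by (rule finite_measure_TT)
  have "(\<lambda>(s', s). kN A N s s') \<in> borel_measurable (borel \<Otimes>\<^sub>M borel)"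
    using measurable_pair_swap[OF kN_measurable[OF A]] by simp
  then have "(\<lambda>(s', s). kN A N s s') \<in> borel_measurable (borel \<Otimes>\<^sub>M TT)"
    by (subst measurable_cong_sets[OF sets_pair_measure_cong[OF refl sets_TT] refl])
  then show ?thesis by (rule borel_measurable_lebesgue_integral)
qed

lemma inner_nonneg: "0 \<le> (\<integral>s. kN A N s s' \<partial>TT)"
  by (rule integral_nonneg_AE) (simp add: kN_nonneg)

lemma dominated_TT:
  fixes f :: "nat \<Rightarrow> real \<Rightarrow> real"
  assumes "\<And>N. f N \<in> borel_measurable borel" "l \<in> borel_measurable borel"
    and "AE s in TT. (\<lambda>N. f N s) \<longlonglongrightarrow> l s" and "\<And>N s. \<bar>f N s\<bar> \<le> B"
  shows "(\<lambda>N. \<integral>s. f N s \<partial>TT) \<longlonglongrightarrow> (\<integral>s. l s \<partial>TT)"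
proof -
  interpret finite_measure TT by (rule finite_measure_TT)
  show ?thesis
    by (rule integral_dominated_convergence[where w="\<lambda>_. B"]) (use assms in auto)
qed

lemma JJ_limit:
  assumes A: "A \<in> G"
    and lim: "AE s' in TT. (\<lambda>N. sqrt (real N) * (\<integral>s. kN A N s s' \<partial>TT)) \<longlonglongrightarrow> c"
  shows "(\<lambda>N. sqrt (real N) * JJ A N) \<longlonglongrightarrow> c * (L / 2)"
proof -
  \<comment> \<open>The shift by 2 makes the uniform bound available for every index of the
    sequence.\<close>
  let ?f = "\<lambda>N s'. sqrt (real (N+2)) * (\<integral>s. kN A (N+2) s s' \<partial>TT)"
  have "(\<lambda>N. \<integral>s'. ?f N s' \<partial>TT) \<longlonglongrightarrow> (\<integral>s'. c \<partial>TT)"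
  proof (rule dominated_TT)
    show "?f N \<in> borel_measurable borel" for N using inner_measurable[OF A] by measurable
    show "AE s' in TT. (\<lambda>N. ?f N s') \<longlonglongrightarrow> c"
      using lim by eventually_elim (rule LIMSEQ_ignore_initial_segment)
    show "\<bar>?f N s'\<bar> \<le> 2 * pi" for N s'
      using inner_bound[OF A, of "N+2" s'] inner_nonneg[of A "N+2" s'] by (simp add: abs_mult)
  qed simp
  then have "(\<lambda>N. sqrt (real (N+2)) * JJ A (N+2)) \<longlonglongrightarrow> c * (L / 2)"
    unfolding JJ_def by (simp add: mult.commute measure_TT_UNIV)
  then show ?thesis by (rule LIMSEQ_offset)
qed

text \<open>Outside at most one exceptional s', the modulus of the pairing attains on the compact
  interval a minimum greater than 1, so the inner integral decays geometrically and beats sqrt N.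
  The exceptional value is a null set for the outer integral.\<close>

lemma JJ_off_diagonal:
  assumes A: "A \<in> G" "A \<noteq> 1\<^sub>m (n+1)"
  shows "(\<lambda>N. sqrt (real N) * JJ A N) \<longlonglongrightarrow> 0"
proof -
  interpret finite_measure TT by (rule finite_measure_TT)
  define S where "S = {s' \<in> {0..L}. \<exists>s\<in>{0..L}. cmod (hform n (A *\<^sub>v u s) (u s')) = 1}"
  have "finite S"
  proof (cases "S = {}")
    case False
    then obtain a where "a \<in> S" by blast
    then have "S \<subseteq> {a}" using coincidence_unique[OF A] unfolding S_def by blast
    then show ?thesis using finite_subset by blast
  qed simp
  have "AE s' in TT. (\<lambda>N. sqrt (real N) * (\<integral>s. kN A N s s' \<partial>TT)) \<longlonglongrightarrow> 0"
    using AE_TT AE_TT_finite[OF \<open>finite S\<close>]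
  proof eventually_elim
    case (elim s')
    have s': "s' \<in> {0..L}" using elim by auto
    have cont: "continuous_on {0..L} (\<lambda>s. cmod (hform n (A *\<^sub>v u s) (u s')))"
      unfolding hform_Au[OF A(1)] by (intro continuous_intros) auto
    obtain sm where sm: "sm \<in> {0..L}" "\<And>s. s \<in> {0..L} \<Longrightarrow> cmod (hform n (A *\<^sub>v u sm) (u s')) \<le> cmod (hform n (A *\<^sub>v u s) (u s'))"
      using continuous_attains_inf[OF compact_Icc _ cont] L by auto
    define m where "m = cmod (hform n (A *\<^sub>v u sm) (u s'))"
    have m1: "1 < m" using cmod_hform_translate_ge_1[OF A(1), of sm s'] elim(2) s' sm(1) unfolding m_def S_def by force
    have kb: "kN A N s s' \<le> inverse m ^ N" for N s
    proof -
      have "m \<le> cmod (EE A s s')"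
        using sm(2)[OF clip_range[of s]] elim(1) by (simp add: EE_def UU_def m_def clip_id)
      then show ?thesis unfolding kN_def using m1 by (intro power_mono le_imp_inverse_le) auto
    qed
    have ib: "(\<integral>s. kN A N s s' \<partial>TT) \<le> inverse m ^ N * (L/2)" for N
    proof -
      have "(\<integral>s. kN A N s s' \<partial>TT) \<le> (\<integral>s. inverse m ^ N \<partial>TT)"
        by (rule integral_mono_AE') (use kb m1 in auto)
      then show ?thesis by (simp add: mult.commute measure_TT_UNIV)
    qed
    have "(\<lambda>N. (sqrt (real N) * inverse m ^ N) * (L/2)) \<longlonglongrightarrow> 0 * (L/2)"
      by (intro tendsto_mult tendsto_const sqrt_times_power_tendsto_0) (use m1 in \<open>auto simp: inverse_less_1_iff\<close>)
    then have up: "(\<lambda>N. (sqrt (real N) * inverse m ^ N) * (L/2)) \<longlonglongrightarrow> 0" by simp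
    show ?case
    proof (rule tendsto_sandwich[OF _ _ tendsto_const up])
      show "\<forall>\<^sub>F N in sequentially. 0 \<le> sqrt (real N) * (\<integral>s. kN A N s s' \<partial>TT)"
        using inner_nonneg by simp
      show "\<forall>\<^sub>F N in sequentially. sqrt (real N) * (\<integral>s. kN A N s s' \<partial>TT) \<le> sqrt (real N) * inverse m ^ N * (L/2)"
        using ib by (intro always_eventually allI) (simp add: mult.assoc mult_left_mono)
    qed
  qed
  from JJ_limit[OF A(1) this] show ?thesis by simp
qed

lemma EE_one: "EE (1\<^sub>m (n+1)) s s' = - of_real (cosh ((clip s - clip s')/2))"
  unfolding EE_def UU_def using one_mult_mat_vec[OF u_carrier(1), of "clip s"] by (simp add: hform_u)

lemma kN_one: "kN (1\<^sub>m (n+1)) N s s' = inverse (cosh ((clip s - clip s')/2)) ^ N"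
  unfolding kN_def EE_one by (simp add: cosh_real_nonneg)

lemma JJ_diagonal: "(\<lambda>N. sqrt (real N) * JJ (1\<^sub>m (n+1)) N) \<longlonglongrightarrow> sqrt (8 * pi) / 2 * (L / 2)"
proof (rule JJ_limit[OF G_one])
  show "AE s' in TT. (\<lambda>N. sqrt (real N) * (\<integral>s. kN (1\<^sub>m (n+1)) N s s' \<partial>TT)) \<longlonglongrightarrow> sqrt (8 * pi) / 2"
    using AE_TT
  proof eventually_elim
    case (elim s')
    \<comment> \<open>The substitution s = s' + t / sqrt N. For s' inside the period the indicator
      is eventually 1 at each t, so the limit is a full Gaussian integral.\<close>
    define f where "f N t = indicator {0<..<L} (s' + t / sqrt (real N)) / 2 * inverse (cosh (t / (2 * sqrt (real N)))) ^ N" for N t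
    have eq: "sqrt (real N) * (\<integral>s. kN (1\<^sub>m (n+1)) N s s' \<partial>TT) = (\<integral>t. f N t \<partial>lborel)" if "N \<ge> 1" for N
    proof -
      let ?r = "sqrt (real N)"
      have r: "0 < ?r" using that by simp
      have "(\<integral>s. kN (1\<^sub>m (n+1)) N s s' \<partial>TT) = (\<integral>s. indicator {0<..<L} s / 2 * kN (1\<^sub>m (n+1)) N s s' \<partial>lborel)"
        by (rule integral_TT[OF kN_measurable1[OF G_one]])
      also have "\<dots> = (\<integral>s. indicator {0<..<L} s / 2 * inverse (cosh ((s - s')/2)) ^ N \<partial>lborel)"
        by (rule Bochner_Integration.integral_cong) (use elim in \<open>auto simp: indicator_def kN_one[unfolded Suc_eq_plus1[symmetric]] clip_id\<close>)
      also have "\<dots> = \<bar>1 / ?r\<bar> *\<^sub>R (\<integral>t. indicator {0<..<L} (s' + 1 / ?r * t) / 2 * inverse (cosh ((s' + 1 / ?r * t - s')/2)) ^ N \<partial>lborel)"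
        by (rule lborel_integral_real_affine) (use r in simp)
      also have "\<dots> = 1 / ?r * (\<integral>t. f N t \<partial>lborel)"
        unfolding f_def using r by (simp add: mult.commute)
      finally show ?thesis using r by simp
    qed
    have "(\<lambda>N. \<integral>t. f (N+2) t \<partial>lborel) \<longlonglongrightarrow> (\<integral>t. exp (- t\<^sup>2 / 8) / 2 \<partial>lborel)"
    proof (rule integral_dominated_convergence[where w="\<lambda>t. inverse (1 + (1/4)\<^sup>2 * (t - 0)\<^sup>2)"])
      show "integrable lborel (\<lambda>t. inverse (1 + (1/4)\<^sup>2 * (t - 0)\<^sup>2) :: real)" by (rule cauchy_kernel_integral) simp
      show "f (N+2) \<in> borel_measurable lborel" for N
        unfolding f_def[abs_def] cosh_def by measurable
      show "(\<lambda>t. exp (- t\<^sup>2 / 8) / 2) \<in> borel_measurable (lborel :: real measure)" by measurable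
      show "AE t in lborel. (\<lambda>N. f (N+2) t) \<longlonglongrightarrow> exp (- t\<^sup>2 / 8) / 2"
      proof (rule AE_I2)
        fix t :: real
        have "(\<lambda>N. t / sqrt (real N)) \<longlonglongrightarrow> 0"
          by (intro real_tendsto_divide_at_top[OF tendsto_const] filterlim_compose[OF sqrt_at_top filterlim_real_sequentially])
        then have "(\<lambda>N. s' + t / sqrt (real N)) \<longlonglongrightarrow> s' + 0" by (intro tendsto_intros)
        then have "eventually (\<lambda>N. s' + t / sqrt (real N) \<in> {0<..<L}) sequentially"
          by (rule topological_tendstoD) (use elim in auto)
        then have ev: "eventually (\<lambda>N. f N t = inverse (cosh (t / (2 * sqrt (real N))) ^ N) / 2) sequentially"
          by eventually_elim (simp add: f_def power_inverse)
        have "(\<lambda>N. inverse (cosh (t / (2 * sqrt (real N))) ^ N) / 2) \<longlonglongrightarrow> inverse (exp (t\<^sup>2 / 8)) / 2"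
          by (intro tendsto_intros cosh_power_limit) auto
        then have "(\<lambda>N. f N t) \<longlonglongrightarrow> inverse (exp (t\<^sup>2 / 8)) / 2"
          by (subst tendsto_cong[OF ev])
        then have "(\<lambda>N. f N t) \<longlonglongrightarrow> exp (- t\<^sup>2 / 8) / 2" by (simp add: exp_minus)
        then show "(\<lambda>N. f (N+2) t) \<longlonglongrightarrow> exp (- t\<^sup>2 / 8) / 2" by (rule LIMSEQ_ignore_initial_segment)
      qed
      show "AE t in lborel. norm (f (N+2) t) \<le> inverse (1 + (1/4)\<^sup>2 * (t - 0)\<^sup>2)" for N
      proof (rule AE_I2)
        fix t :: real
        let ?M = "N + 2"
        let ?q = "t / sqrt (real ?M)"
        have r: "0 < sqrt (real ?M)" by simp
        \<comment> \<open>From cosh (q/2) >= 1 + q^2/8, squaring gives the hypothesis 1 + q^2/4 of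
          the Cauchy-kernel bound.\<close>
        have "(1 + (q/2)\<^sup>2 / 2)\<^sup>2 = 1 + q\<^sup>2 / 4 + (q\<^sup>2 / 8)\<^sup>2" for q :: real
          by (simp add: power2_eq_square algebra_simps)
        then have "1 + q\<^sup>2 / 4 \<le> (1 + (q/2)\<^sup>2 / 2)\<^sup>2" for q :: real by simp
        then have "1 + ?q\<^sup>2 / 4 \<le> (1 + (?q/2)\<^sup>2 / 2)\<^sup>2" .
        also have "\<dots> \<le> (cosh (?q/2))\<^sup>2"
          using cosh_ge_quadratic[of "?q/2"] by (intro power_mono) auto
        finally have "inverse (cosh (?q/2)) ^ ?M \<le> inverse (1 + (sqrt (real ?M) / 4)\<^sup>2 * ?q\<^sup>2)"
          by (intro inverse_power_le_cauchy_kernel) (auto simp: cosh_real_nonneg)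
        also have "(sqrt (real ?M) / 4)\<^sup>2 * ?q\<^sup>2 = (1/4)\<^sup>2 * (t - 0)\<^sup>2"
        proof -
          have "sqrt (real ?M) / 4 * ?q = 1/4 * (t - 0)" using r by simp
          then show ?thesis by (simp only: power_mult_distrib[symmetric])
        qed
        finally have k: "inverse (cosh (?q/2)) ^ ?M \<le> inverse (1 + (1/4)\<^sup>2 * (t - 0)\<^sup>2)" .
        have "norm (f ?M t) \<le> inverse (cosh (?q/2)) ^ ?M"
          unfolding f_def by (auto simp: indicator_def cosh_real_nonneg abs_mult mult.commute)
        then show "norm (f ?M t) \<le> inverse (1 + (1/4)\<^sup>2 * (t - 0)\<^sup>2)" using k by linarith
      qed
    qed
    then have "(\<lambda>N. \<integral>t. f (N+2) t \<partial>lborel) \<longlonglongrightarrow> sqrt (8 * pi) / 2"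
      using gaussian_integral_8 by simp
    moreover have "sqrt (real (N+2)) * (\<integral>s. kN (1\<^sub>m (n+1)) (N+2) s s' \<partial>TT) = (\<integral>t. f (N+2) t \<partial>lborel)" for N
      by (rule eq) simp
    ultimately have "(\<lambda>N. sqrt (real (N+2)) * (\<integral>s. kN (1\<^sub>m (n+1)) (N+2) s s' \<partial>TT)) \<longlonglongrightarrow> sqrt (8 * pi) / 2"
      by (simp only:)
    then show ?case by (rule LIMSEQ_offset)
  qed
qed


section \<open>Majorant over the lattice and the limit of the sum\<close>

definition tau :: "real \<Rightarrow> real" where
  "tau s = exp (clip s / 2) * xn + exp (- clip s / 2) * yn"

definition Mx :: real where "Mx = exp (L / 2) * xn + yn"

lemma tau: "UU s $ n = of_real (tau s)" "0 < tau s" "tau s \<le> Mx"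
proof -
  show "UU s $ n = of_real (tau s)" by (simp add: UU_def u_index last tau_def)
  show "0 < tau s" unfolding tau_def using last by (intro add_pos_pos mult_pos_pos) auto
  have "exp (clip s / 2) \<le> exp (L / 2)" "exp (- clip s / 2) \<le> 1" using clip_range[of s] by auto
  then have "exp (clip s / 2) * xn \<le> exp (L / 2) * xn" "exp (- clip s / 2) * yn \<le> 1 * yn"
    using last by (auto intro!: mult_right_mono)
  then show "tau s \<le> Mx" unfolding tau_def Mx_def by linarith
qed

lemma theta_setup_lattice_geodesic:
  assumes "4 * (n + 2) \<le> N"
  shows "theta_setup n G F TT UU tau Mx N"
proof (rule theta_setup.intro[OF ball_lattice_axioms], rule theta_setup_axioms.intro)
  show "finite_measure TT" by (rule finite_measure_TT)
  show "(\<lambda>s. UU s $ j) \<in> borel_measurable borel" if "j \<le> n" for j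
    unfolding UU_def u_index[OF that] clip_def by measurable
qed (use tau hform_u_self assms in \<open>auto simp: UU_def\<close>)

definition II :: "complex mat \<Rightarrow> nat \<Rightarrow> complex" where
  "II A N = (\<integral>p. cnj (inverse (- EE A (fst p) (snd p)) ^ N) \<partial>(TT \<Otimes>\<^sub>M TT))"

lemma JJ_pair:
  assumes A: "A \<in> G"
  shows "integrable (TT \<Otimes>\<^sub>M TT) (\<lambda>p. kN A N (fst p) (snd p))"
    and "(\<integral>p. kN A N (fst p) (snd p) \<partial>(TT \<Otimes>\<^sub>M TT)) = JJ A N"
proof -
  interpret finite_measure TT by (rule finite_measure_TT)
  interpret P: pair_sigma_finite TT TT ..
  interpret PP: finite_measure "TT \<Otimes>\<^sub>M TT" by (rule finite_measure_pair_measure) (rule finite_measure_TT)+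
  have m: "(\<lambda>p. kN A N (fst p) (snd p)) \<in> borel_measurable (TT \<Otimes>\<^sub>M TT)"
    using kN_measurable[OF A] by (subst measurable_cong_sets[OF sets_pair_measure_cong[OF sets_TT sets_TT] refl])
  show i: "integrable (TT \<Otimes>\<^sub>M TT) (\<lambda>p. kN A N (fst p) (snd p))"
    by (rule PP.integrable_const_bound[OF _ m, of 1]) (use kN_le_1[OF A] kN_nonneg in auto)
  show "(\<integral>p. kN A N (fst p) (snd p) \<partial>(TT \<Otimes>\<^sub>M TT)) = JJ A N"
    using P.integral_snd[of "\<lambda>s s'. kN A N s s'"] i unfolding JJ_def by (simp add: case_prod_beta')
qed

lemma II_le_JJ:
  assumes A: "A \<in> G"
  shows "cmod (II A N) \<le> JJ A N"
proof -
  have "cmod (II A N) \<le> (\<integral>p. cmod (cnj (inverse (- EE A (fst p) (snd p)) ^ N)) \<partial>(TT \<Otimes>\<^sub>M TT))"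
    unfolding II_def by (rule integral_norm_bound)
  also have "\<dots> = JJ A N"
    unfolding JJ_pair(2)[OF A, symmetric] kN_def by (simp add: norm_power norm_inverse)
  finally show ?thesis .
qed

lemma II_one: "II (1\<^sub>m (n+1)) N = of_real (JJ (1\<^sub>m (n+1)) N)"
proof -
  have "cnj (inverse (- EE (1\<^sub>m (n+1)) s s') ^ N) = of_real (kN (1\<^sub>m (n+1)) N s s')" for s s'
    unfolding EE_one kN_one by simp
  then have "II (1\<^sub>m (n+1)) N = (\<integral>p. of_real (kN (1\<^sub>m (n+1)) N (fst p) (snd p)) \<partial>(TT \<Otimes>\<^sub>M TT))"
    unfolding II_def by (simp only:)
  then show ?thesis by (simp only: integral_complex_of_real JJ_pair(2)[OF G_one])
qed

lemma Mx_positive: "0 < Mx"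
  using tau(2,3) less_le_trans by blast

text \<open>Passing from the pairing to the last coordinate of A u(s), and from there to A_nn, costs
  a factor 2 \<open>Mx\<close> each time.\<close>

lemma EE_lower:
  assumes A: "A \<in> G"
  shows "cmod (A $$ (n,n)) / (4 * Mx\<^sup>2) \<le> cmod (EE A s s')"
proof -
  have hU: "hq n (UU t) = 1" and Uc: "UU t \<in> carrier_vec (n+1)" for t by (auto simp: UU_def hq_u)
  have cU: "cmod (UU t $ n) = tau t" for t using tau(1,2)[of t] by simp
  let ?v = "A *\<^sub>v UU s"
  have hv: "hq n ?v = 1" using U_n1_hq[OF G_U_n1[OF A] Uc] hU by simp
  have "cmod (A $$ (n,n)) / (2 * Mx) \<le> cmod (A $$ (n,n)) / (2 * tau s)"
    using tau(2,3)[of s] by (intro divide_left_mono mult_pos_pos) auto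
  also have "\<dots> \<le> cmod (?v $ n)"
    using U_n1_last_bounds(1)[OF G_U_n1[OF A] G_U_n1[OF minv(1)[OF A]] minv(2)[OF A] Uc, of s] by (simp add: hU cU)
  finally have 1: "cmod (A $$ (n,n)) / (2 * Mx) \<le> cmod (?v $ n)" .
  have "cmod (?v $ n) / (2 * Mx) \<le> cmod (?v $ n) / (2 * tau s')"
    using tau(2,3)[of s'] by (intro divide_left_mono mult_pos_pos) auto
  also have "\<dots> \<le> cmod (hform n (UU s') ?v)"
    using hform_lower_hq[of n ?v "UU s'"] by (simp add: hU hv cU)
  also have "\<dots> = cmod (EE A s s')" unfolding EE_def by (metis hform_cnj complex_mod_cnj)
  finally have 2: "cmod (?v $ n) / (2 * Mx) \<le> cmod (EE A s s')" .
  have "cmod (A $$ (n,n)) / (4 * Mx\<^sup>2) = cmod (A $$ (n,n)) / (2 * Mx) / (2 * Mx)" by (simp add: power2_eq_square)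
  also have "\<dots> \<le> cmod (?v $ n) / (2 * Mx)" using 1 Mx_positive by (intro divide_right_mono) auto
  finally show ?thesis using 2 by linarith
qed

definition pw :: nat where "pw = 2 * (n + 2)"

definition CC :: real where
  "CC = pi * L * (8 * Mx\<^sup>2) ^ pw + 2 ^ pw * (4 * Mx\<^sup>2) ^ pw * (L / 2)\<^sup>2"

text \<open>The majorant for dominated convergence over the group: free of N and summable in A. For
  small |A_nn| the uniform bound is enough, since \<open>8 * Mx\<^sup>2\<close> over |A_nn| is at
  least 1; for large |A_nn| the integrand itself is small. \<open>CC\<close> adds the constants of
  the two cases.\<close>

lemma JJ_bound:
  assumes A: "A \<in> G" and N: "pw \<le> N"
  shows "sqrt (real N) * JJ A N \<le> CC * inverse (cmod (A $$ (n,n))) ^ pw"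
proof -
  interpret finite_measure TT by (rule finite_measure_TT)
  let ?a = "cmod (A $$ (n,n))"
  have a1: "1 \<le> ?a" by (rule U_n1_nn_ge_1[OF G_U_n1[OF A]])
  have a0: "A $$ (n,n) \<noteq> 0" using a1 by auto
  have N2: "2 \<le> N" using N by (simp add: pw_def)
  have M0: "0 < 4 * Mx\<^sup>2" using Mx_positive by simp
  have np: "0 \<le> 2 ^ pw * (4 * Mx\<^sup>2) ^ pw * (L / 2)\<^sup>2 * inverse ?a ^ pw" "0 \<le> pi * L * (8 * Mx\<^sup>2) ^ pw * inverse ?a ^ pw"
    using L by (intro mult_nonneg_nonneg; simp)+
  show ?thesis
  proof (cases "?a \<le> 8 * Mx\<^sup>2")
    case True
    have "sqrt (real N) * JJ A N = (\<integral>s'. sqrt (real N) * (\<integral>s. kN A N s s' \<partial>TT) \<partial>TT)"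
      unfolding JJ_def by simp
    also have "\<dots> \<le> (\<integral>s'. 2 * pi \<partial>TT)"
      by (rule integral_mono_AE') (use inner_bound[OF A N2] in auto)
    also have "\<dots> = pi * L" by (simp add: measure_TT_UNIV)
    also have "\<dots> = pi * L * 1" by simp
    also have "\<dots> \<le> pi * L * ((8 * Mx\<^sup>2) * inverse ?a) ^ pw"
    proof (intro mult_left_mono one_le_power)
      show "1 \<le> 8 * Mx\<^sup>2 * inverse ?a" using True a0 pos_le_divide_eq[of ?a 1 "8 * Mx\<^sup>2"] by (simp add: divide_inverse)
    qed (use L in simp)
    also have "\<dots> = pi * L * (8 * Mx\<^sup>2) ^ pw * inverse ?a ^ pw" by (simp only: power_mult_distrib mult.assoc)
    finally show ?thesis unfolding CC_def distrib_right using np(1) by linarith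
  next
    case False
    \<comment> \<open>Here e >= 2, so after \<open>pw\<close> factors have been set aside for
      summability the remaining ones still supply 2^-(N - pw), which compensates sqrt N.\<close>
    define e where "e = ?a / (4 * Mx\<^sup>2)"
    have e2: "2 \<le> e" using False M0 by (simp add: e_def pos_le_divide_eq)
    have kb: "kN A N s s' \<le> inverse e ^ N" for s s'
      unfolding kN_def using EE_lower[OF A, of s s'] e2 by (intro power_mono le_imp_inverse_le) (auto simp: e_def)
    have ib: "(\<integral>s. kN A N s s' \<partial>TT) \<le> inverse e ^ N * (L/2)" for s'
    proof -
      have "(\<integral>s. kN A N s s' \<partial>TT) \<le> (\<integral>s. inverse e ^ N \<partial>TT)"
        by (rule integral_mono_AE') (use kb e2 in auto)
      then show ?thesis by (simp add: mult.commute measure_TT_UNIV)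
    qed
    have "JJ A N \<le> (\<integral>s'. inverse e ^ N * (L/2) \<partial>TT)"
      unfolding JJ_def by (rule integral_mono_AE') (use ib e2 L in auto)
    then have J: "JJ A N \<le> inverse e ^ N * (L/2)\<^sup>2" by (simp add: measure_TT_UNIV power2_eq_square mult_ac)
    have "sqrt (real N) * inverse e ^ N = inverse e ^ pw * (sqrt (real N) * inverse e ^ (N - pw))"
      using N by (simp add: power_add[symmetric])
    also have "\<dots> \<le> inverse e ^ pw * 2 ^ pw"
    proof (rule mult_left_mono)
      have "inverse e ^ (N - pw) \<le> (1/2) ^ (N - pw)"
        using e2 le_imp_inverse_le[of 2 e] by (intro power_mono) auto
      moreover have "sqrt (real N) \<le> 2 ^ N"
      proof -
        have "sqrt (real N) \<le> real N" using N2 by (intro real_le_lsqrt) (auto simp: power2_eq_square)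
        also have "\<dots> \<le> 2 ^ N" using of_nat_less_two_power[of N] by (rule less_imp_le)
        finally show ?thesis .
      qed
      ultimately have "sqrt (real N) * inverse e ^ (N - pw) \<le> 2 ^ N * (1/2) ^ (N - pw)"
        using e2 by (intro mult_mono) auto
      also have "(2::real) ^ N = 2 ^ pw * 2 ^ (N - pw)" using N by (simp add: power_add[symmetric])
      also have "2 ^ pw * 2 ^ (N - pw) * (1/2) ^ (N - pw) = (2::real) ^ pw" by (simp add: power_one_over)
      finally show "sqrt (real N) * inverse e ^ (N - pw) \<le> 2 ^ pw" .
    qed (use e2 in simp)
    also have "inverse e ^ pw = (4 * Mx\<^sup>2) ^ pw * inverse ?a ^ pw"
    proof -
      have "inverse e = 4 * Mx\<^sup>2 * inverse ?a" unfolding e_def inverse_divide by (simp only: divide_inverse)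
      then show ?thesis by (simp only: power_mult_distrib[of "4 * Mx\<^sup>2" "inverse ?a"])
    qed
    finally have sN: "sqrt (real N) * inverse e ^ N \<le> (4 * Mx\<^sup>2) ^ pw * inverse ?a ^ pw * 2 ^ pw" .
    have "sqrt (real N) * JJ A N \<le> sqrt (real N) * (inverse e ^ N * (L/2)\<^sup>2)"
      using J by (rule mult_left_mono) simp
    also have "\<dots> = (sqrt (real N) * inverse e ^ N) * (L/2)\<^sup>2" by simp
    also have "\<dots> \<le> ((4 * Mx\<^sup>2) ^ pw * inverse ?a ^ pw * 2 ^ pw) * (L/2)\<^sup>2"
      using sN by (rule mult_right_mono) simp
    also have "\<dots> = 2 ^ pw * (4 * Mx\<^sup>2) ^ pw * (L / 2)\<^sup>2 * inverse ?a ^ pw" by (simp only: ac_simps)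
    finally show ?thesis unfolding CC_def distrib_right using np(2) by linarith
  qed
qed

definition SS :: "nat \<Rightarrow> complex" where
  "SS N = (\<integral>A. II A N \<partial>count_space G)"

theorem SS_limit: "(\<lambda>N. of_real (sqrt (real N)) * SS N) \<longlonglongrightarrow> of_real (sqrt (8 * pi) / 2 * (L / 2))"
proof -
  let ?l = "complex_of_real (sqrt (8 * pi) / 2 * (L / 2))"
  define f where "f A = (if A = 1\<^sub>m (n+1) then ?l else 0)" for A :: "complex mat"
  let ?s = "\<lambda>N A. of_real (sqrt (real (N + pw))) * II A (N + pw)"
  have "(\<lambda>N. \<integral>A. ?s N A \<partial>count_space G) \<longlonglongrightarrow> (\<integral>A. f A \<partial>count_space G)"
  proof (rule integral_dominated_convergence[where w="\<lambda>A. CC * inverse (cmod (A $$ (n,n))) ^ pw"])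
    show "integrable (count_space G) (\<lambda>A. CC * inverse (cmod (A $$ (n,n))) ^ pw)"
      unfolding pw_def by (rule integrable_mult_right) (rule integrable_inverse_nn)
    show "AE A in count_space G. (\<lambda>N. ?s N A) \<longlonglongrightarrow> f A"
    proof (rule AE_I2)
      fix A assume "A \<in> space (count_space G)"
      then have A: "A \<in> G" by simp
      have "(\<lambda>N. of_real (sqrt (real N)) * II A N) \<longlonglongrightarrow> f A"
      proof (cases "A = 1\<^sub>m (n+1)")
        case True
        have "(\<lambda>N. complex_of_real (sqrt (real N) * JJ A N)) \<longlonglongrightarrow> ?l"
          unfolding True by (rule tendsto_of_real[OF JJ_diagonal])
        then show ?thesis unfolding f_def True II_one by simp
      next
        case False
        have "(\<lambda>N. of_real (sqrt (real N)) * II A N) \<longlonglongrightarrow> 0"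
        proof (rule Lim_null_comparison[OF _ JJ_off_diagonal[OF A False]])
          show "\<forall>\<^sub>F N in sequentially. cmod (of_real (sqrt (real N)) * II A N) \<le> sqrt (real N) * JJ A N"
            using II_le_JJ[OF A] by (intro always_eventually allI) (simp add: norm_mult mult_left_mono)
        qed
        then show ?thesis using False by (simp add: f_def)
      qed
      then show "(\<lambda>N. ?s N A) \<longlonglongrightarrow> f A" by (rule LIMSEQ_ignore_initial_segment)
    qed
    show "AE A in count_space G. norm (?s N A) \<le> CC * inverse (cmod (A $$ (n,n))) ^ pw" for N
    proof (rule AE_I2)
      fix A assume "A \<in> space (count_space G)"
      then have A: "A \<in> G" by simp
      have "norm (?s N A) = sqrt (real (N + pw)) * cmod (II A (N + pw))" by (simp only: norm_mult norm_of_real) simp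
      also have "\<dots> \<le> sqrt (real (N + pw)) * JJ A (N + pw)" using II_le_JJ[OF A] by (rule mult_left_mono) simp
      also have "\<dots> \<le> CC * inverse (cmod (A $$ (n,n))) ^ pw" by (rule JJ_bound[OF A]) simp
      finally show "norm (?s N A) \<le> CC * inverse (cmod (A $$ (n,n))) ^ pw" .
    qed
  qed auto
  moreover have "(\<integral>A. f A \<partial>count_space G) = ?l"
  proof -
    have l0: "?l \<noteq> 0" using L by (simp only: of_real_eq_0_iff) simp
    have "{A \<in> G. f A \<noteq> 0} = {1\<^sub>m (n+1)}" using G_one l0 by (auto simp: f_def simp del: One_nat_def)
    then show ?thesis
      by (subst lebesgue_integral_count_space_finite_support) (simp_all add: f_def)
  qed
  moreover have "(\<integral>A. ?s N A \<partial>count_space G) = of_real (sqrt (real (N + pw))) * SS (N + pw)" for N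
    unfolding SS_def by (rule integral_mult_right_zero)
  ultimately have "(\<lambda>N. of_real (sqrt (real (N + pw))) * SS (N + pw)) \<longlonglongrightarrow> ?l" by (simp only:)
  then show ?thesis by (rule LIMSEQ_offset)
qed

end

section \<open>The geodesic of a hyperbolic element\<close>

lemma mob_eqI:
  assumes A: "A \<in> carrier_mat (n+1) (n+1)" and e: "A *\<^sub>v lift n z = c \<cdot>\<^sub>v lift n z'" "c \<noteq> 0" and z': "z' \<in> cpts n"
  shows "mob n A z = z'"
proof (rule PiE_ext[of _ "{..<n}" "\<lambda>_. UNIV"])
  fix j assume "j \<in> {..<n}"
  then have j: "j < n" by simp
  have d: "denom n A z = c" using mult_lift_last[OF A, of z] unfolding e by (simp add: lift_def)
  have "(\<Sum>l<n. A $$ (j, l) * z l) + A $$ (j, n) = c * z' j"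
    using mult_lift_index[OF A, of j z] j unfolding e by (simp add: lift_def)
  then show "mob n A z j = z' j" using j d e(2) by (simp add: mob_def)
qed (use z' in \<open>auto simp: cpts_def mob_def\<close>)

lemma dim_lift: "dim_vec (lift n z) = Suc n"
  by (simp add: lift_def)

lemma hform_lift: "hform n (lift n z) (lift n w) = bip n z w"
  by (simp add: hform_def bip_def)

lemma hform_mult_vec_sum:
  assumes A: "A \<in> carrier_mat (n+1) (n+1)" and c: "c \<in> carrier_vec (n+1)"
  shows "hform n (A *\<^sub>v c) w = (\<Sum>j<n+1. c $ j * hform n (col A j) w)"
proof -
  have e: "(A *\<^sub>v c) $ i = (\<Sum>j<n+1. c $ j * col A j $ i)" if "i < n + 1" for i
    unfolding mult_mat_vec_sum[OF A c that] using that A by (intro sum.cong) auto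
  have s: "(\<Sum>i<n. (A *\<^sub>v c) $ i * cnj (w $ i)) = (\<Sum>j<n+1. c $ j * (\<Sum>i<n. col A j $ i * cnj (w $ i)))"
  proof -
    have "(\<Sum>i<n. (A *\<^sub>v c) $ i * cnj (w $ i)) = (\<Sum>i<n. \<Sum>j<n+1. c $ j * (col A j $ i * cnj (w $ i)))"
      by (intro sum.cong refl) (simp only: e sum_distrib_right mult.assoc lessThan_iff less_SucI Suc_eq_plus1[symmetric])
    also have "\<dots> = (\<Sum>j<n+1. \<Sum>i<n. c $ j * (col A j $ i * cnj (w $ i)))" by (rule sum.swap)
    finally show ?thesis by (simp only: sum_distrib_left)
  qed
  have l: "(A *\<^sub>v c) $ n * cnj (w $ n) = (\<Sum>j<n+1. c $ j * (col A j $ n * cnj (w $ n)))"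
    by (simp only: e less_add_one sum_distrib_right mult.assoc)
  show ?thesis unfolding hform_def s l sum_subtractf[symmetric] right_diff_distrib ..
qed

locale hyperbolic_data =
  fixes n :: nat and G :: "complex mat set" and g :: "complex mat"
    and X Y :: "nat \<Rightarrow> complex" and lam :: real
    and v :: "nat \<Rightarrow> complex vec" and eps :: "nat \<Rightarrow> complex"
    and F :: "(nat \<Rightarrow> complex) set"
  assumes n: "n \<ge> 1"
    and GG: "subgroup_SU n G" "discrete_mat n G" "acts_freely n G"
    and gg: "g \<in> G" "primitive_in G g"
    and XY: "X \<in> sphere_n n" "Y \<in> sphere_n n" "\<forall>j<n. X j \<in> \<real> \<and> Y j \<in> \<real>"
    and eig: "eigenvector g (lift n X) (of_real lam)" "eigenvector g (lift n Y) (of_real (1 / lam))"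
    and lam: "lam\<^sup>2 > 1"
    and veig: "\<forall>i<n-1. eps i \<in> {-1, 1} \<and> eigenvector g (v i) (eps i)"
    and vorth: "\<forall>i<n-1. \<forall>j<n-1. eps i = eps j \<longrightarrow>
                   hform n (v i) (v j) = (if i = j then 1 else 0)"
    and FF: "fund_domain n G F"
begin

definition b :: real where "b = Re (bip n X Y)"

lemma g_U: "g \<in> U_n1 n" using GG gg SU_n1_subset_U_n1[of n] by (auto simp: subgroup_SU_def)

lemma g_carrier: "g \<in> carrier_mat (n+1) (n+1)" by (rule U_n1_carrier[OF g_U])

lemma g_lift: "g *\<^sub>v lift n X = of_real lam \<cdot>\<^sub>v lift n X" "g *\<^sub>v lift n Y = of_real (1 / lam) \<cdot>\<^sub>v lift n Y"
  using eig by (auto simp: eigenvector_def)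

lemma lam0: "lam \<noteq> 0" using lam by auto

lemma X_ne_Y: "lift n X \<noteq> lift n Y"
proof
  assume "lift n X = lift n Y"
  then have "of_real lam \<cdot>\<^sub>v lift n X = of_real (1 / lam) \<cdot>\<^sub>v lift n X" using g_lift by simp
  then have "(of_real lam \<cdot>\<^sub>v lift n X) $ n = (complex_of_real (1 / lam) \<cdot>\<^sub>v lift n X) $ n" by simp
  then have "complex_of_real lam = of_real (1 / lam)" by (simp add: lift_def)
  then have "lam = 1 / lam" by (simp only: of_real_eq_iff)
  then have "lam\<^sup>2 = 1" using lam0 by (simp add: field_simps power2_eq_square)
  then show False using lam by simp
qed

text \<open>For real unit vectors the pairing is -|X - Y|^2 / 2; its sign is needed for the
  normalisation of x and y.\<close>

lemma b_eq: "b = - (\<Sum>j<n. (Re (X j) - Re (Y j))\<^sup>2) / 2"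
proof -
  have re: "Im (X j) = 0" "Im (Y j) = 0" if "j < n" for j using XY(3) that by (auto simp: complex_is_Real_iff)
  have X1: "(\<Sum>j<n. (Re (X j))\<^sup>2) = 1"
    using XY(1) re unfolding sphere_n_def by (simp add: cmod_power2)
  have Y1: "(\<Sum>j<n. (Re (Y j))\<^sup>2) = 1"
    using XY(2) re unfolding sphere_n_def by (simp add: cmod_power2)
  have "b = (\<Sum>j<n. Re (X j) * Re (Y j)) - 1" unfolding b_def bip_def by (simp add: re)
  moreover have "(\<Sum>j<n. (Re (X j) - Re (Y j))\<^sup>2) = (\<Sum>j<n. (Re (X j))\<^sup>2) + (\<Sum>j<n. (Re (Y j))\<^sup>2) - 2 * (\<Sum>j<n. Re (X j) * Re (Y j))"
    by (simp add: power2_diff sum.distrib sum_subtractf sum_distrib_left mult.assoc)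
  ultimately show ?thesis using X1 Y1 by simp
qed

lemma b_neg: "b < 0"
proof -
  have "0 \<le> (\<Sum>j<n. (Re (X j) - Re (Y j))\<^sup>2)" by (rule sum_nonneg) simp
  moreover have "(\<Sum>j<n. (Re (X j) - Re (Y j))\<^sup>2) \<noteq> 0"
  proof
    assume "(\<Sum>j<n. (Re (X j) - Re (Y j))\<^sup>2) = 0"
    then have "\<forall>j<n. Re (X j) = Re (Y j)" by (simp add: sum_nonneg_eq_0_iff)
    then have "\<forall>j<n. X j = Y j" using XY(3) by (auto simp: complex_is_Real_iff complex_eq_iff)
    then have "lift n X = lift n Y" by (intro eq_vecI) (auto simp: lift_def)
    then show False using X_ne_Y by simp
  qed
  ultimately show ?thesis unfolding b_eq by simp
qed

lemma bip_XY: "bip n X Y = of_real b"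
proof -
  have "Im (bip n X Y) = 0" using XY(3) unfolding bip_def by (auto simp: complex_is_Real_iff intro!: sum.neutral)
  then show ?thesis by (simp add: b_def complex_eq_iff)
qed

lemma hform_XX: "hform n (lift n X) (lift n X) = 0" "hform n (lift n Y) (lift n Y) = 0"
proof -
  have "nsq n X = 1" "nsq n Y = 1" using XY by (auto simp: sphere_n_def nsq_def)
  then show "hform n (lift n X) (lift n X) = 0" "hform n (lift n Y) (lift n Y) = 0" by (simp_all add: hform_self hq_lift)
qed

text \<open>Since b < 0, the factor -1/b is positive, and together with the factor 1/2 in
  \<open>y\<close> it gives <x, y> = -1/2. The length is the logarithm of the squared eigenvalue
  because exp (L/2) = |lam|.\<close>

definition x :: "complex vec" where "x = of_real (- 1 / b) \<cdot>\<^sub>v lift n X"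
definition y :: "complex vec" where "y = of_real (1 / 2) \<cdot>\<^sub>v lift n Y"
definition L :: real where "L = ln (lam\<^sup>2)"

lemma exp_L: "exp (L / 2) = \<bar>lam\<bar>" "exp (- L / 2) = 1 / \<bar>lam\<bar>"
proof -
  have "exp (L / 2) ^ 2 = lam\<^sup>2" using lam0 unfolding L_def exp_of_nat_mult[symmetric] by simp
  then show 1: "exp (L / 2) = \<bar>lam\<bar>" by (metis abs_exp_cancel real_sqrt_abs)
  have "exp (- L / 2) = inverse (exp (L / 2))" using exp_minus[of "L / 2"] by simp
  then show "exp (- L / 2) = 1 / \<bar>lam\<bar>" unfolding 1 by (simp only: inverse_eq_divide)
qed

text \<open>The eigenvalue may be negative; its sign is the unit scalar by which g acts along the
  geodesic.\<close>

lemma geodesic_data: "lattice_geodesic n G F x y (- 1 / b) (1 / 2) L g (of_real (sgn lam))"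
proof (rule lattice_geodesic.intro)
  show "ball_lattice n G F" by (rule ball_lattice.intro) (use GG FF in auto)
  show "lattice_geodesic_axioms n G x y (- 1 / b) (1 / 2) L g (of_real (sgn lam))"
  proof (rule lattice_geodesic_axioms.intro)
    show "hform n x x = 0" "hform n y y = 0" "hform n x y = - 1 / 2"
      unfolding x_def y_def using b_neg by (simp_all add: hform_lin hform_XX[unfolded hform_lift] hform_lift bip_XY)
    show "0 < L" unfolding L_def using lam by (rule ln_gt_zero)
    show "g *\<^sub>v x = of_real (sgn lam) * of_real (exp (L / 2)) \<cdot>\<^sub>v x"
    proof -
      have "complex_of_real (sgn lam) * of_real (exp (L / 2)) = of_real lam"
        unfolding exp_L of_real_mult[symmetric] by (simp add: sgn_mult_abs)
      then show ?thesis unfolding x_def using mult_mat_vec[OF g_carrier lift_carrier(1), of _ X]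
        by (simp add: g_lift smult_smult_assoc mult.commute)
    qed
    show "g *\<^sub>v y = of_real (sgn lam) * of_real (exp (- L / 2)) \<cdot>\<^sub>v y"
    proof -
      have "sgn lam * (1 / \<bar>lam\<bar>) = 1 / lam" using lam0 by (simp add: sgn_if)
      then have "complex_of_real (sgn lam) * of_real (exp (- L / 2)) = of_real (1 / lam)"
        unfolding exp_L of_real_mult[symmetric] by simp
      then show ?thesis unfolding y_def using mult_mat_vec[OF g_carrier lift_carrier(1), of _ Y]
        by (simp only: g_lift smult_smult_assoc mult.commute)
    qed
    show "cmod (of_real (sgn lam)) = 1" using lam0 by (simp add: sgn_if)
  qed (use GG gg b_neg in \<open>auto simp: x_def y_def dim_lift\<close>)
qed

sublocale lattice_geodesic n G F x y "- 1 / b" "1 / 2" L g "of_real (sgn lam)" by (rule geodesic_data)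

section \<open>The matrix A_gamma and its inverse\<close>

abbreviation Ag :: "complex mat" where "Ag \<equiv> A_gamma n v X Y"

lemma Ag_carrier: "Ag \<in> carrier_mat (n+1) (n+1)" by (simp add: A_gamma_def)

lemma v_carrier: "i < n - 1 \<Longrightarrow> v i \<in> carrier_vec (n+1)"
  using veig g_carrier by (auto simp: eigenvector_def)

lemma g_v: "i < n - 1 \<Longrightarrow> g *\<^sub>v v i = eps i \<cdot>\<^sub>v v i"
  using veig by (auto simp: eigenvector_def)

text \<open>Eigenvectors for 1 and -1 are orthogonal because g preserves the form, so the
  orthonormality within each eigenspace extends to all of them.\<close>

lemma hform_vv:
  assumes "i < n - 1" "j < n - 1"
  shows "hform n (v i) (v j) = (if i = j then 1 else 0)"
proof (cases "eps i = eps j")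
  case True
  then show ?thesis using vorth assms by blast
next
  case False
  have "eps i = -1 \<or> eps i = 1" "eps j = -1 \<or> eps j = 1" using veig assms by auto
  then have e: "eps i * cnj (eps j) = -1" using False by auto
  have "hform n (v i) (v j) = hform n (g *\<^sub>v v i) (g *\<^sub>v v j)"
    by (rule U_n1_hform[OF g_U, symmetric]) (use v_carrier assms in auto)
  also have "\<dots> = (eps i * cnj (eps j)) * hform n (v i) (v j)"
    using assms v_carrier by (simp add: g_v hform_lin)
  finally have "hform n (v i) (v j) = - hform n (v i) (v j)" by (simp add: e)
  then have "hform n (v i) (v j) + hform n (v i) (v j) = 0" by (simp only: eq_neg_iff_add_eq_0)
  then have "2 * hform n (v i) (v j) = 0" by (simp only: mult_2)
  then show ?thesis using False by auto
qed

text \<open>Invariance multiplies the pairing by the product of the eigenvalues, which differs from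
  1 as m is neither 1 nor -1.\<close>

lemma hform_v_eig:
  assumes i: "i < n - 1" and w: "w \<in> carrier_vec (n+1)" "g *\<^sub>v w = of_real m \<cdot>\<^sub>v w" "m\<^sup>2 \<noteq> 1"
  shows "hform n (v i) w = 0" "hform n w (v i) = 0"
proof -
  have "hform n (v i) w = hform n (g *\<^sub>v v i) (g *\<^sub>v w)"
    by (rule U_n1_hform[OF g_U, symmetric]) (use v_carrier i w in auto)
  also have "\<dots> = (eps i * of_real m) * hform n (v i) w"
    using i v_carrier w by (simp add: g_v hform_lin)
  finally have "(1 - eps i * of_real m) * hform n (v i) w = 0" by (simp add: algebra_simps)
  moreover have "1 - eps i * of_real m \<noteq> 0"
  proof
    assume "1 - eps i * of_real m = 0"
    then have "eps i * of_real m = 1" by simp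
    then have "complex_of_real m = 1 \<or> complex_of_real m = -1" using veig i by (auto simp: minus_equation_iff)
    then have "m = 1 \<or> m = -1" by (metis of_real_1 of_real_eq_iff of_real_minus)
    then show False using w(3) by auto
  qed
  ultimately show 1: "hform n (v i) w = 0" by simp
  show "hform n w (v i) = 0" using hform_cnj[of n "v i" w] 1 by simp
qed

lemma lam_inv_sq: "(1 / lam)\<^sup>2 \<noteq> 1" "lam\<^sup>2 \<noteq> 1"
  using lam by (auto simp: power_divide)

lemma hform_v_XY:
  assumes "i < n - 1"
  shows "hform n (v i) (lift n X) = 0" "hform n (lift n X) (v i) = 0" "hform n (v i) (lift n Y) = 0" "hform n (lift n Y) (v i) = 0"
  using hform_v_eig[OF assms lift_carrier(1) g_lift(1) lam_inv_sq(2)] hform_v_eig[OF assms lift_carrier(1) g_lift(2) lam_inv_sq(1)] by auto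

lemma col_Ag:
  "j < n - 1 \<Longrightarrow> col Ag j = v j"
  "col Ag (n - 1) = of_real (1 / b) \<cdot>\<^sub>v lift n X + of_real (1 / 2) \<cdot>\<^sub>v lift n Y"
  "col Ag n = of_real (1 / b) \<cdot>\<^sub>v lift n X + of_real (- 1 / 2) \<cdot>\<^sub>v lift n Y"
proof -
  show "col Ag j = v j" if "j < n - 1"
    using that carrier_vecD[OF v_carrier[OF that]] by (intro eq_vecI) (auto simp: A_gamma_def)
  show "col Ag (n - 1) = of_real (1 / b) \<cdot>\<^sub>v lift n X + of_real (1 / 2) \<cdot>\<^sub>v lift n Y"
    using n by (intro eq_vecI) (auto simp: A_gamma_def bip_XY lift_def)
  show "col Ag n = of_real (1 / b) \<cdot>\<^sub>v lift n X + of_real (- 1 / 2) \<cdot>\<^sub>v lift n Y"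
    using n by (intro eq_vecI) (auto simp: A_gamma_def bip_XY lift_def)
qed

lemma sum_split_last: "(\<Sum>j<n+1. f j) = (\<Sum>j<n-1. f j) + f (n - 1) + (f n :: complex)"
  using n by (cases n) auto

text \<open>\<open>Theta_C\<close> takes \<open>the\<close> of \<open>mat_inverse\<close>, so its
  existence must be shown. A kernel vector, paired with each v_i and with the two endpoint lifts,
  has all coordinates zero.\<close>

lemma Ag_inverse: "\<exists>B. mat_inverse Ag = Some B \<and> B * Ag = 1\<^sub>m (n+1) \<and> B \<in> carrier_mat (n+1) (n+1)"
proof -
  have "Determinant.det Ag \<noteq> 0"
  proof
    assume "Determinant.det Ag = 0"
    then obtain c where c: "c \<in> carrier_vec (n+1)" "c \<noteq> 0\<^sub>v (n+1)" "Ag *\<^sub>v c = 0\<^sub>v (n+1)"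
      using det_0_iff_vec_prod_zero[OF Ag_carrier] by blast
    have z: "(\<Sum>j<n-1. c $ j * hform n (v j) w) + c $ (n - 1) * hform n (col Ag (n - 1)) w + c $ n * hform n (col Ag n) w = 0" for w
    proof -
      have "hform n (0\<^sub>v (n+1)) w = 0" by (simp add: hform_def)
      then have "(\<Sum>j<n+1. c $ j * hform n (col Ag j) w) = 0" using hform_mult_vec_sum[OF Ag_carrier c(1), of w] c(3) by simp
      then show ?thesis unfolding sum_split_last by (simp add: col_Ag(1))
    qed
    have YX: "hform n (lift n Y) (lift n X) = of_real b" using hform_cnj[of n "lift n X" "lift n Y"] by (simp add: hform_lift bip_XY)
    have XY': "hform n (lift n X) (lift n Y) = of_real b" by (simp add: hform_lift bip_XY)
    have b0: "b \<noteq> 0" using b_neg by simp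
    have ci: "c $ i = 0" if i: "i < n - 1" for i
    proof -
      have "(\<Sum>j<n-1. c $ j * hform n (v j) (v i)) = (\<Sum>j<n-1. if j = i then c $ j else 0)"
        using i by (intro sum.cong) (auto simp: hform_vv)
      also have "\<dots> = c $ i" using i by simp
      finally show ?thesis using z[of "v i"] unfolding col_Ag(2,3) using i by (simp add: hform_lin hform_v_XY)
    qed
    have s0: "(\<Sum>j<n-1. c $ j * hform n (v j) w) = 0" for w using ci by simp
    have 1: "c $ (n - 1) + c $ n = 0"
      using z[of "lift n Y"] b0 unfolding s0 col_Ag by (simp add: hform_lin hform_XX XY')
    have "c $ (n - 1) * (of_real (1/2) * of_real b) + c $ n * (of_real (- 1/2) * of_real b) = 0"
      using z[of "lift n X"] unfolding s0 col_Ag by (simp add: hform_lin hform_XX YX)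
    then have "(of_real b / 2) * (c $ (n - 1) - c $ n) = 0" by (simp add: algebra_simps)
    then have 2: "c $ (n - 1) = c $ n" using b0 by simp
    have "2 * c $ n = 0" using 1 unfolding 2 by simp
    then have "c $ n = 0" "c $ (n - 1) = 0" using 2 by auto
    then have "c $ j = 0" if "j < n + 1" for j
      using ci[of j] that by (cases "j < n - 1") (auto simp: not_less le_less_Suc_eq dest: le_antisym, metis One_nat_def Suc_pred le_neq_implies_less less_Suc_eq_le n not_less_eq_eq Suc_le_eq)
    then have "c = 0\<^sub>v (n+1)" using c(1) by (intro eq_vecI) auto
    then show False using c(2) by simp
  qed
  then have U: "Ag \<in> Units (ring_mat TYPE(complex) (n+1) ())" by (rule det_non_zero_imp_unit[OF Ag_carrier])
  then obtain B where "mat_inverse Ag = Some B" using mat_inverse(1)[OF Ag_carrier, where b="()"] by (cases "mat_inverse Ag") auto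
  then show ?thesis using mat_inverse(2)[OF Ag_carrier] by auto
qed

definition Bg :: "complex mat" where "Bg = the (mat_inverse Ag)"

lemma Bg: "Bg * Ag = 1\<^sub>m (n+1)" "Bg \<in> carrier_mat (n+1) (n+1)"
  using Ag_inverse by (auto simp: Bg_def)

definition q :: "real \<Rightarrow> complex vec" where
  "q t = of_real (1 + t) \<cdot>\<^sub>v x + of_real (1 - t) \<cdot>\<^sub>v y"

definition qn :: "real \<Rightarrow> real" where "qn t = (1 + t) * (- 1 / b) + (1 - t) / 2"

lemma qn_pos: "-1 < t \<Longrightarrow> t < 1 \<Longrightarrow> 0 < qn t"
proof -
  assume t: "-1 < t" "t < 1"
  have "0 < (1 + t) * (- 1 / b)" by (rule mult_pos_pos) (use t divide_neg_neg[of "-1" b] b_neg in auto)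
  then show "0 < qn t" unfolding qn_def using t by (intro add_pos_pos) auto
qed

text \<open>In terms of x and y the last two columns are y - x and -x - y. The overall minus sign
  disappears on passing to points of the ball.\<close>

lemma Ag_c0: "Ag *\<^sub>v lift n (c0pt n t) = (- 1) \<cdot>\<^sub>v q t"
proof (rule eq_vecI)
  fix i assume "i < dim_vec ((- 1) \<cdot>\<^sub>v q t)"
  then have i: "i < n + 1" by (simp add: q_def y_def lift_def)
  have "(Ag *\<^sub>v lift n (c0pt n t)) $ i = (\<Sum>l<n. Ag $$ (i, l) * c0pt n t l) + Ag $$ (i, n)"
    by (rule mult_lift_index[OF Ag_carrier]) (use i in simp)
  also have "(\<Sum>l<n. Ag $$ (i, l) * c0pt n t l) = (\<Sum>l<n. if l = n - 1 then Ag $$ (i, n - 1) * of_real t else 0)"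
    by (intro sum.cong) (auto simp: c0pt_def)
  also have "\<dots> = Ag $$ (i, n - 1) * of_real t" using n by simp
  also have "Ag $$ (i, n - 1) = col Ag (n - 1) $ i" using i n Ag_carrier by simp
  also have "Ag $$ (i, n) = col Ag n $ i" using i Ag_carrier by simp
  also have "col Ag (n - 1) $ i * of_real t + col Ag n $ i = ((- 1) \<cdot>\<^sub>v q t) $ i"
    unfolding col_Ag using i by (simp add: q_def x_def y_def dim_lift algebra_simps add_divide_distrib diff_divide_distrib)
  finally show "(Ag *\<^sub>v lift n (c0pt n t)) $ i = ((- 1) \<cdot>\<^sub>v q t) $ i" .
qed (use Ag_carrier in \<open>simp add: q_def y_def lift_def\<close>)

definition w :: "real \<Rightarrow> nat \<Rightarrow> complex" where "w t = mob n Ag (c0pt n t)"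

lemma c0pt_cpts: "c0pt n t \<in> cpts n" by (simp add: c0pt_def cpts_def)

lemma w_cpts: "w t \<in> cpts n" by (simp add: w_def)

lemma q_last: "q t $ n = of_real (qn t)"
  using n by (simp add: q_def x_def y_def qn_def lift_def)

lemma q_carrier: "q t \<in> carrier_vec (n+1)" by (simp add: q_def x_def y_def)

lemma lift_w:
  assumes "-1 < t" "t < 1"
  shows "q t = of_real (qn t) \<cdot>\<^sub>v lift n (w t)"
proof (rule eq_vecI)
  fix i assume "i < dim_vec (of_real (qn t) \<cdot>\<^sub>v lift n (w t))"
  then have i: "i \<le> n" by (simp add: lift_def)
  have d: "denom n Ag (c0pt n t) = - of_real (qn t)"
    using mult_lift_last[OF Ag_carrier, of "c0pt n t"] q_carrier[of t] unfolding Ag_c0 by (simp add: q_last)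
  have e: "(\<Sum>l<n. Ag $$ (i, l) * c0pt n t l) + Ag $$ (i, n) = - q t $ i"
    using mult_lift_index[OF Ag_carrier i, of "c0pt n t"] q_carrier[of t] i unfolding Ag_c0 by simp
  show "q t $ i = (of_real (qn t) \<cdot>\<^sub>v lift n (w t)) $ i"
    using i e qn_pos[OF assms] by (cases "i = n") (auto simp: q_last lift_def w_def mob_def d)
qed (use q_carrier[of t] in \<open>simp add: lift_def\<close>)

text \<open>The inverse map recovers the parameter, so the pulled-back form along the path is just
  the form along the axis.\<close>

lemma mob_Bg_w:
  assumes t: "-1 < t" "t < 1"
  shows "mob n Bg (w t) = c0pt n t"
proof (rule mob_eqI[OF Bg(2) _ _ c0pt_cpts])
  have l: "lift n (w t) = of_real (1 / qn t) \<cdot>\<^sub>v q t"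
    using qn_pos[OF t] unfolding lift_w[OF t] by (simp add: smult_smult_assoc)
  have "Bg *\<^sub>v ((- 1) \<cdot>\<^sub>v q t) = lift n (c0pt n t)"
    unfolding Ag_c0[symmetric] using assoc_mult_mat_vec[OF Bg(2) Ag_carrier lift_carrier(1), of "c0pt n t"] Bg(1)
      one_mult_mat_vec[OF lift_carrier(1)] by simp
  moreover have "Bg *\<^sub>v ((- 1) \<cdot>\<^sub>v q t) = (- 1) \<cdot>\<^sub>v (Bg *\<^sub>v q t)" by (rule mult_mat_vec[OF Bg(2) q_carrier])
  ultimately have "(- 1) \<cdot>\<^sub>v ((- 1) \<cdot>\<^sub>v (Bg *\<^sub>v q t)) = (- 1) \<cdot>\<^sub>v lift n (c0pt n t)" by simp
  then have "Bg *\<^sub>v q t = (- 1) \<cdot>\<^sub>v lift n (c0pt n t)" by (simp add: smult_smult_assoc)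
  then show "Bg *\<^sub>v lift n (w t) = of_real (- 1 / qn t) \<cdot>\<^sub>v lift n (c0pt n t)"
    unfolding l using mult_mat_vec[OF Bg(2) q_carrier, of "of_real (1 / qn t)" t] by (simp add: smult_smult_assoc)
  show "complex_of_real (- 1 / qn t) \<noteq> 0" using qn_pos[OF t] by (simp only: of_real_eq_0_iff) simp
qed

section \<open>Arc length, the end of the segment and the length of C\<close>

definition rho :: "real \<Rightarrow> real" where
  "rho s = sqrt (1 - (tanh (s/2))\<^sup>2) / qn (tanh (s/2))"

lemma tanh_range: "-1 < tanh (s/2)" "tanh (s/2) < (1::real)"
  using tanh_real_bounds[of "s/2"] by auto

text \<open>Both identities hold with the common factor 1 / cosh (s/2), so t = tanh (s/2) converts
  the axis parameter into arc length.\<close>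

lemma exp_tanh:
  "1 + tanh (s/2) = sqrt (1 - (tanh (s/2))\<^sup>2) * exp (s/2)" "1 - tanh (s/2) = sqrt (1 - (tanh (s/2))\<^sup>2) * exp (- s/(2::real))"
proof -
  have c: "0 < cosh (s/2)" by (rule cosh_real_pos)
  have "(cosh (s/2))\<^sup>2 - (sinh (s/2))\<^sup>2 = 1" using hyperbolic_pythagoras[of "s/2"] .
  moreover have "1 - (tanh (s/2))\<^sup>2 = ((cosh (s/2))\<^sup>2 - (sinh (s/2))\<^sup>2) / (cosh (s/2))\<^sup>2"
    using c by (simp add: tanh_def power_divide diff_divide_distrib)
  ultimately have "1 - (tanh (s/2))\<^sup>2 = (1 / cosh (s/2))\<^sup>2" by (simp only: power_divide power_one)
  then have r: "sqrt (1 - (tanh (s/2))\<^sup>2) = 1 / cosh (s/2)" using c by (simp add: real_sqrt_abs)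
  show "1 + tanh (s/2) = sqrt (1 - (tanh (s/2))\<^sup>2) * exp (s/2)"
  proof -
    have "1 + tanh (s/2) = (sinh (s/2) + cosh (s/2)) / cosh (s/2)" using c by (simp add: tanh_def add_divide_distrib)
    then show ?thesis unfolding r sinh_plus_cosh by simp
  qed
  show "1 - tanh (s/2) = sqrt (1 - (tanh (s/2))\<^sup>2) * exp (- s/2)"
  proof -
    have "1 - tanh (s/2) = (cosh (s/2) - sinh (s/2)) / cosh (s/2)" using c by (simp add: tanh_def diff_divide_distrib)
    then show ?thesis unfolding r cosh_minus_sinh by simp
  qed
qed

lemma q_tanh: "q (tanh (s/2)) = of_real (sqrt (1 - (tanh (s/2))\<^sup>2)) \<cdot>\<^sub>v u s"
proof (rule eq_vecI)
  fix i assume "i < dim_vec (of_real (sqrt (1 - (tanh (s/2))\<^sup>2)) \<cdot>\<^sub>v u s)"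
  then have i: "i < Suc n" "i \<le> n" by simp_all
  let ?r = "sqrt (1 - (tanh (s/2))\<^sup>2)"
  have "q (tanh (s/2)) $ i = of_real (1 + tanh (s/2)) * x $ i + of_real (1 - tanh (s/2)) * y $ i"
    using i by (simp add: q_def x_def y_def lift_def)
  also have "\<dots> = of_real (?r * exp (s/2)) * x $ i + of_real (?r * exp (- s/2)) * y $ i"
    unfolding exp_tanh ..
  also have "\<dots> = (of_real ?r \<cdot>\<^sub>v u s) $ i" using i by (simp add: u_index algebra_simps)
  finally show "q (tanh (s/2)) $ i = (of_real ?r \<cdot>\<^sub>v u s) $ i" .
qed (use q_carrier[of "tanh (s/2)"] in simp)

lemma rho_pos: "0 < rho s"
  unfolding rho_def using tanh_range[of s] qn_pos[OF tanh_range] by (intro divide_pos_pos) (auto simp: abs_square_less_1)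

lemma lift_w_u: "lift n (w (tanh (s/2))) = of_real (rho s) \<cdot>\<^sub>v u s"
proof -
  let ?t = "tanh (s/2)"
  have p: "qn ?t \<noteq> 0" using qn_pos[OF tanh_range, of s] by simp
  have "of_real (1 / qn ?t) \<cdot>\<^sub>v q ?t = lift n (w ?t)"
    using p unfolding lift_w[OF tanh_range] by (simp add: smult_smult_assoc)
  then show ?thesis unfolding q_tanh rho_def by (simp add: smult_smult_assoc)
qed

lemma mob_g_w0: "mob n g (w 0) = w (tanh (L/2))"
proof (rule mob_eqI[OF g_carrier _ _ w_cpts])
  have l0: "lift n (w 0) = of_real (rho 0) \<cdot>\<^sub>v u 0" using lift_w_u[of 0] by simp
  have "g *\<^sub>v u 0 = of_real (sgn lam) \<cdot>\<^sub>v u L"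
  proof -
    have "g *\<^sub>v u 0 = g *\<^sub>v x + g *\<^sub>v y"
      unfolding u_def using mult_add_distrib_mat_vec[OF g_carrier, of x y] xy by simp
    also have "\<dots> = of_real (sgn lam) \<cdot>\<^sub>v u L"
      unfolding lattice_geodesic.g(3,4)[OF geodesic_data] u_def using xy by (intro eq_vecI) (auto simp: algebra_simps)
    finally show ?thesis .
  qed
  then have "g *\<^sub>v lift n (w 0) = (of_real (rho 0) * of_real (sgn lam)) \<cdot>\<^sub>v u L"
    unfolding l0 using mult_mat_vec[OF g_carrier u_carrier(1), of "of_real (rho 0)" 0] by (simp add: smult_smult_assoc)
  also have "\<dots> = of_real (rho 0 * sgn lam / rho L) \<cdot>\<^sub>v lift n (w (tanh (L/2)))"
    unfolding lift_w_u using rho_pos[of L] by (simp add: smult_smult_assoc)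
  finally show "g *\<^sub>v lift n (w 0) = of_real (rho 0 * sgn lam / rho L) \<cdot>\<^sub>v lift n (w (tanh (L/2)))" .
  have "rho 0 * sgn lam / rho L \<noteq> 0" using rho_pos[of L] rho_pos[of 0] lam0 by (simp add: sgn_zero_iff)
  then show "complex_of_real (rho 0 * sgn lam / rho L) \<noteq> 0" by (simp only: of_real_eq_0_iff not_False_eq_True)
qed

text \<open>The description by \<open>THE\<close> is resolved by applying the inverse matrix, which
  separates parameters in (-1, 1).\<close>

lemma seg_end_eq: "seg_end n Ag g = tanh (L/2)"
  unfolding seg_end_def w_def[symmetric]
proof (rule the_equality)
  show "-1 < tanh (L/2) \<and> tanh (L/2) < 1 \<and> w (tanh (L/2)) = mob n g (w 0)"
    using tanh_range mob_g_w0 by simp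
next
  fix t assume t: "-1 < t \<and> t < 1 \<and> w t = mob n g (w 0)"
  then have "mob n Bg (w t) = mob n Bg (w (tanh (L/2)))" by (simp add: mob_g_w0)
  then have "c0pt n t = c0pt n (tanh (L/2))" using t mob_Bg_w[of t] mob_Bg_w[OF tanh_range, of L] by metis
  then have "c0pt n t (n - 1) = c0pt n (tanh (L/2)) (n - 1)" by simp
  then show "t = tanh (L/2)" using n by (simp add: c0pt_def)
qed

lemma hdist_eq: "hdist n (w 0) (mob n g (w 0)) = L"
proof -
  have bip_w: "bip n (w (tanh (s/2))) (w (tanh (s'/2))) = - of_real (rho s * rho s' * cosh ((s - s')/2))" for s s'
    unfolding hform_lift[symmetric] lift_w_u by (simp add: hform_smult_left hform_smult_right hform_u)
  have r: "rho 0 \<noteq> 0" "rho L \<noteq> 0" using rho_pos[of 0] rho_pos[of L] by auto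
  have "bip n (w 0) (w (tanh (L/2))) * bip n (w (tanh (L/2))) (w 0) / (bip n (w 0) (w 0) * bip n (w (tanh (L/2))) (w (tanh (L/2))))
     = of_real ((cosh (L/2))\<^sup>2)"
    using bip_w[of 0 L] bip_w[of L 0] bip_w[of 0 0] bip_w[of L L] r
    by (simp add: field_simps power2_eq_square)
  then have "hdist n (w 0) (mob n g (w 0)) = 2 * arcosh (sqrt ((cosh (L/2))\<^sup>2))"
    unfolding hdist_def mob_g_w0 by (simp only: Re_complex_of_real)
  also have "\<dots> = L" using lattice_geodesic.L[OF geodesic_data] by (simp add: cosh_real_nonneg arcosh_cosh_real)
  finally show ?thesis .
qed

end

section \<open>The theta series of the geodesic\<close>

context hyperbolic_data
begin

definition k0 :: real where "k0 = fact n / pi ^ n"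

lemma k0_pos: "0 < k0" by (simp add: k0_def)

lemma bergman_form: "bergman n z w' = of_real k0 * inverse (- bip n z w') ^ (n+1)"
  by (simp add: bergman_def k0_def)

lemma bip_self: "bip n z z = - of_real (1 - nsq n z)"
  unfolding hform_lift[symmetric] hform_self hq_lift ..

lemma bergman_self: "bergman n z z = of_real (k0 * inverse (1 - nsq n z) ^ (n+1))"
  unfolding bergman_form bip_self by simp

lemma one_minus_nsq_w: "1 - nsq n (w (tanh (s/2))) = (rho s)\<^sup>2"
  unfolding hq_lift[symmetric] lift_w_u by (simp add: hq_smult hq_u)

text \<open>The constant part of the form: K(z, z)^(1/(n+1)) = kap / (1 - |z|^2).\<close>

definition kap :: real where "kap = k0 powr (1 / real (n+1))"

definition cN :: "nat \<Rightarrow> real" where "cN k = real ((n+1)*(k-1) + n choose n)"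

definition NN :: "nat \<Rightarrow> nat" where "NN k = (n+1) * k"

text \<open>The threshold comes from 8(n+1) >= 4(n+2); smaller k do not affect a limit.\<close>

lemma NN_ge: "8 \<le> k \<Longrightarrow> 4 * (n + 2) \<le> NN k"
proof -
  assume "8 \<le> k"
  then have "(n+1) * 8 \<le> (n+1) * k" by (rule mult_left_mono) simp
  then show ?thesis by (simp add: NN_def)
qed

lemma theta_setup_k: "8 \<le> k \<Longrightarrow> theta_setup n G F TT UU tau Mx (NN k)"
  by (rule theta_setup_lattice_geodesic[OF NN_ge])

abbreviation hk :: "nat \<Rightarrow> complex mat \<Rightarrow> real \<Rightarrow> (nat \<Rightarrow> complex) \<Rightarrow> complex" where
  "hk k \<equiv> theta_setup.hker n UU (NN k)"

text \<open>J^k cancels the stretching of the lift of A z. Replacing the lift of w by the unit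
  vector u(s) costs rho^(-N), which is exactly compensated by the rho^N in K(w, w)^(-k/2). Only
  powers of the Bergman constant remain.\<close>

lemma kernel_term:
  assumes A: "A \<in> G" and z: "z \<in> ball_n n" and s: "s \<in> {0<..<L}" and k: "8 \<le> k"
  shows "bergman n (mob n A z) (w (tanh (s/2))) ^ k * jac n A z ^ k
     * of_real (Re (bergman n (w (tanh (s/2))) (w (tanh (s/2)))) powr (- real k / 2))
     = of_real (k0 powr (real k / 2)) * hk k A s z"
proof -
  interpret th: theta_setup n G F TT UU tau Mx "NN k" by (rule theta_setup_k[OF k])
  let ?w = "w (tanh (s/2))" and ?r = "rho s" and ?d = "denom n A z"
  define m where "m = hform n (A *\<^sub>v lift n z) (u s)"
  have r: "0 < ?r" by (rule rho_pos)
  have dm: "?d * bip n (mob n A z) ?w = of_real ?r * m"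
  proof -
    have "hform n (A *\<^sub>v lift n z) (lift n ?w) = ?d * bip n (mob n A z) ?w"
      unfolding mult_lift[OF G_U_n1[OF A] z] hform_smult_left[OF lift_carrier(1)] hform_lift ..
    moreover have "hform n (A *\<^sub>v lift n z) (lift n ?w) = of_real ?r * m"
      unfolding lift_w_u m_def by (simp add: hform_smult_right)
    ultimately show ?thesis by simp
  qed
  have 1: "bergman n (mob n A z) ?w * jac n A z = of_real k0 * (inverse (of_real ?r) ^ (n+1) * inverse (- m) ^ (n+1))"
  proof -
    have "bergman n (mob n A z) ?w * jac n A z = of_real k0 * inverse (- (?d * bip n (mob n A z) ?w)) ^ (n+1)"
    proof -
      have "inverse (- b') * inverse d' = inverse (- (d' * b'))" for b' d' :: complex by (simp add: mult.commute)
      then show ?thesis unfolding bergman_form jac_def mult.assoc power_mult_distrib[symmetric] by (simp only:)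
    qed
    also have "inverse (- (?d * bip n (mob n A z) ?w)) = inverse (of_real ?r) * inverse (- m)"
      unfolding dm by simp
    finally show ?thesis unfolding power_mult_distrib .
  qed
  have 2: "Re (bergman n ?w ?w) powr (- real k / 2) = k0 powr (- real k / 2) * ?r ^ NN k"
  proof -
    have "Re (bergman n ?w ?w) = k0 * inverse (?r\<^sup>2) ^ (n+1)" by (simp only: bergman_self one_minus_nsq_w Re_complex_of_real)
    also have "inverse (?r\<^sup>2) ^ (n+1) = ?r powr (- real (2 * (n+1)))"
    proof -
      have "?r powr (- real (2 * (n+1))) = inverse (?r ^ (2 * (n+1)))"
        unfolding powr_minus powr_realpow[OF r] ..
      also have "\<dots> = inverse (?r\<^sup>2) ^ (n+1)" unfolding power_mult power_inverse ..
      finally show ?thesis ..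
    qed
    finally have e: "Re (bergman n ?w ?w) = k0 * ?r powr (- real (2 * (n+1)))" .
    have "- real (2 * (n+1)) * (- real k / 2) = real (NN k)" by (simp add: NN_def field_simps)
    then show ?thesis unfolding e using k0_pos r
      by (simp only: powr_mult powr_powr powr_realpow less_imp_le powr_ge_zero)
  qed
  have 3: "k0 ^ k * k0 powr (- real k / 2) = k0 powr (real k / 2)"
    unfolding powr_realpow[OF k0_pos, symmetric] powr_add[symmetric] by simp
  have hk: "hk k A s z = inverse (- m) ^ NN k"
    unfolding th.hker_def UU_def clip_id[OF s] m_def ..
  have "bergman n (mob n A z) ?w ^ k * jac n A z ^ k = (bergman n (mob n A z) ?w * jac n A z) ^ k"
    by (simp only: power_mult_distrib)
  also have "\<dots> = of_real (k0 ^ k) * (inverse (of_real ?r) ^ NN k * inverse (- m) ^ NN k)"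
    by (simp only: 1 NN_def power_mult power_mult_distrib of_real_power)
  finally have "bergman n (mob n A z) ?w ^ k * jac n A z ^ k * of_real (Re (bergman n ?w ?w) powr (- real k / 2))
    = of_real (k0 ^ k) * (inverse (of_real ?r) ^ NN k * inverse (- m) ^ NN k) * of_real (k0 powr (- real k / 2) * ?r ^ NN k)"
    unfolding 2 by simp
  also have "\<dots> = of_real (k0 ^ k * k0 powr (- real k / 2)) * ((inverse (of_real ?r) * of_real ?r) ^ NN k) * inverse (- m) ^ NN k"
    by (simp only: power_mult_distrib of_real_mult of_real_power mult_ac)
  also have "inverse (complex_of_real ?r) * of_real ?r = 1" using r by (intro left_inverse) simp
  finally show ?thesis unfolding 3 hk by simp
qed

lemma integrable_hk:
  assumes z: "z \<in> ball_n n" and k: "8 \<le> k"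
  shows "integrable (count_space G) (\<lambda>A. hk k A s z)"
proof -
  interpret th: theta_setup n G F TT UU tau Mx "NN k" by (rule theta_setup_k[OF k])
  show ?thesis
  proof (rule Bochner_Integration.integrable_bound)
    show "integrable (count_space G) (\<lambda>A. (th.Cb * inverse (sqrt (1 - nsq n z)) ^ (NN k + 2 * (n+2))) * inverse (cmod (A $$ (n,n))) ^ (2 * (n+2)))"
      by (rule integrable_mult_right) (rule integrable_inverse_nn)
    show "AE A in count_space G. norm (hk k A s z) \<le> norm ((th.Cb * inverse (sqrt (1 - nsq n z)) ^ (NN k + 2 * (n+2))) * inverse (cmod (A $$ (n,n))) ^ (2 * (n+2)))"
    proof (rule AE_I2)
      fix A assume "A \<in> space (count_space G)"
      then have "norm (hk k A s z) \<le> th.Cb * inverse (cmod (A $$ (n,n))) ^ (2 * (n+2)) * inverse (sqrt (1 - nsq n z)) ^ (NN k + 2 * (n+2))"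
        using th.hker_bound[OF _ z] by simp
      also have "\<dots> = (th.Cb * inverse (sqrt (1 - nsq n z)) ^ (NN k + 2 * (n+2))) * inverse (cmod (A $$ (n,n))) ^ (2 * (n+2))" by (simp only: ac_simps)
      also have "\<dots> \<le> \<bar>\<dots>\<bar>" by (rule abs_ge_self)
      finally show "norm (hk k A s z) \<le> norm ((th.Cb * inverse (sqrt (1 - nsq n z)) ^ (NN k + 2 * (n+2))) * inverse (cmod (A $$ (n,n))) ^ (2 * (n+2)))" by simp
    qed
  qed simp
qed

definition HH :: "nat \<Rightarrow> (nat \<Rightarrow> complex) \<Rightarrow> real \<Rightarrow> complex" where
  "HH k z s = (\<integral>A. hk k A s z \<partial>count_space G)"

lemma Theta_w_eq:
  assumes z: "z \<in> ball_n n" and s: "s \<in> {0<..<L}" and k: "8 \<le> k"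
  shows "Theta_w n G k (w (tanh (s/2))) z * of_real (Re (bergman n (w (tanh (s/2))) (w (tanh (s/2)))) powr (- real k / 2))
    = of_real (cN k * k0 powr (real k / 2)) * HH k z s"
proof -
  let ?w = "w (tanh (s/2))"
  let ?P = "complex_of_real (Re (bergman n ?w ?w) powr (- real k / 2))"
  have "infsum (\<lambda>A. bergman n (mob n A z) ?w ^ k * jac n A z ^ k) G * ?P
    = infsum (\<lambda>A. bergman n (mob n A z) ?w ^ k * jac n A z ^ k * ?P) G"
    by (rule infsum_cmult_left'[symmetric])
  also have "\<dots> = infsum (\<lambda>A. of_real (k0 powr (real k / 2)) * hk k A s z) G"
    by (rule infsum_cong) (rule kernel_term[OF _ z s k])
  also have "\<dots> = of_real (k0 powr (real k / 2)) * infsum (\<lambda>A. hk k A s z) G" by (rule infsum_cmult_right')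
  \<comment> \<open>Absolute convergence identifies the unordered sum with the integral over
    counting measure, the form needed for Fubini.\<close>
  also have "infsum (\<lambda>A. hk k A s z) G = HH k z s"
    using infsetsum_infsum[of "\<lambda>A. hk k A s z" G] integrable_hk[OF z k, of s]
    by (simp add: HH_def infsetsum_def Infinite_Set_Sum.abs_summable_on_def)
  finally show ?thesis unfolding Theta_w_def cN_def by (simp only: of_real_mult of_real_of_nat_eq mult.assoc)
qed

lemma phi_coeff_c0:
  assumes "-1 < t" "t < 1"
  shows "phi_coeff n (c0pt n t) = of_real (kap * inverse (1 - t\<^sup>2))"
proof -
  have t2: "0 < 1 - t\<^sup>2" using assms by (simp add: abs_square_less_1)
  have "nsq n (c0pt n t) = (\<Sum>j<n. if j = n - 1 then t\<^sup>2 else 0)"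
    unfolding nsq_def by (intro sum.cong) (auto simp: c0pt_def)
  also have "\<dots> = t\<^sup>2" using n by simp
  finally have nq: "nsq n (c0pt n t) = t\<^sup>2" .
  have e: "Re (bergman n (c0pt n t) (c0pt n t)) = k0 * inverse (1 - t\<^sup>2) ^ (n+1)"
    by (simp only: bergman_self Re_complex_of_real nq)
  have "inverse (1 - t\<^sup>2) ^ (n+1) = inverse (1 - t\<^sup>2) powr real (n+1)"
    using t2 by (subst powr_realpow) auto
  then have "(inverse (1 - t\<^sup>2) ^ (n+1)) powr (1 / real (n+1)) = inverse (1 - t\<^sup>2)"
    using t2 by (simp only: powr_powr) simp
  then show ?thesis unfolding phi_coeff_def e kap_def using k0_pos t2 by (simp add: powr_mult)
qed

lemma vector_derivative_Bg_w:
  assumes t: "-1 < t" "t < 1"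
  shows "vector_derivative (\<lambda>s. mob n Bg (w s) (n - 1)) (at t) = 1"
proof (rule vector_derivative_at)
  have d: "((\<lambda>s. complex_of_real s) has_vector_derivative 1) (at t)"
    using has_vector_derivative_of_real[OF DERIV_ident, of "at t"] by simp
  have eq: "complex_of_real s = mob n Bg (w s) (n - 1)" if "s \<in> {-1<..<1}" for s
    using that n by (simp add: mob_Bg_w c0pt_def)
  show "((\<lambda>s. mob n Bg (w s) (n - 1)) has_vector_derivative 1) (at t)"
    by (rule has_vector_derivative_transform_within_open[OF d, of "{-1<..<1}"]) (use t eq in auto)
qed

text \<open>The substitution t = tanh (s/2) has dt = (1 - t^2) ds / 2, and 1 - t^2 cancels the
  density.\<close>

lemma distr_TT_tanh:
  "distr TT borel (\<lambda>s. tanh (s/2)) = density lborel (\<lambda>t. ennreal (indicator {0<..<tanh (L/2)} t * inverse (1 - t\<^sup>2)))"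
proof (rule measure_eqI)
  let ?D = "density lborel (\<lambda>t. ennreal (indicator {0<..<tanh (L/2)} t * inverse (1 - t\<^sup>2)))"
  have mt: "(\<lambda>s::real. tanh (s/2)) \<in> borel_measurable borel"
    unfolding tanh_def sinh_def cosh_def by measurable
  fix S assume "S \<in> sets (distr TT borel (\<lambda>s. tanh (s/2)))"
  then have S[measurable]: "S \<in> sets borel" by simp
  have T0: "tanh 0 = (0::real)" by simp
  have Lp: "0 < L" by (rule lattice_geodesic.L[OF geodesic_data])
  let ?f = "\<lambda>t. indicator S t * indicator {0<..<tanh (L/2)} t * inverse (1 - t\<^sup>2) :: real"
  have "emeasure ?D S = (\<integral>\<^sup>+t. ennreal (indicator {0<..<tanh (L/2)} t * inverse (1 - t\<^sup>2)) * indicator S t \<partial>lborel)"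
    by (rule emeasure_density) auto
  also have "\<dots> = (\<integral>\<^sup>+t. ennreal (?f t * indicator {tanh (0/2)..tanh (L/2)} t) \<partial>lborel)"
    by (rule nn_integral_cong) (auto simp: indicator_def)
  also have "\<dots> = (\<integral>\<^sup>+s. ennreal (?f (tanh (s/2)) * ((1 - (tanh (s/2))\<^sup>2) / 2) * indicator {0..L} s) \<partial>lborel)"
  proof (rule nn_integral_substitution)
    show "set_borel_measurable borel {tanh (0/2)..tanh (L/2)} ?f"
      unfolding set_borel_measurable_def by measurable
    show "((\<lambda>s. tanh (s/2)) has_real_derivative (1 - (tanh (s/2))\<^sup>2) / 2) (at s)" for s :: real
    proof -
      have "cosh (s/2) \<noteq> 0" using cosh_real_pos[of "s/2"] by linarith
      then show ?thesis by (auto intro!: derivative_eq_intros)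
    qed
    have "cosh (s/2) \<noteq> 0" for s :: real using cosh_real_pos[of "s/2"] by linarith
    then show "continuous_on {0..L} (\<lambda>s. (1 - (tanh (s/2))\<^sup>2) / 2)"
      by (intro continuous_intros) auto
    show "0 \<le> (1 - (tanh (s/2))\<^sup>2) / 2" for s :: real
      using tanh_range[of s] by (simp add: abs_square_le_1)
  qed (use Lp in simp)
  also have "\<dots> = (\<integral>\<^sup>+s. ennreal (indicator {0<..<L} s / 2) * indicator S (tanh (s/2)) \<partial>lborel)"
  proof (rule nn_integral_cong)
    fix s :: real
    have p: "0 < 1 - (tanh (s/2))\<^sup>2" using tanh_range[of s] by (simp add: abs_square_less_1)
    have i: "tanh (s/2) \<in> {0<..<tanh (L/2)} \<longleftrightarrow> s \<in> {0<..<L}" by simp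
    show "ennreal (?f (tanh (s/2)) * ((1 - (tanh (s/2))\<^sup>2) / 2) * indicator {0..L} s)
      = ennreal (indicator {0<..<L} s / 2) * indicator S (tanh (s/2))"
    proof (cases "s \<in> {0<..<L} \<and> tanh (s/2) \<in> S")
      case True
      then show ?thesis using p i by (simp add: field_simps)
    next
      case False
      then show ?thesis using i by (auto simp: indicator_def)
    qed
  qed
  also have "\<dots> = (\<integral>\<^sup>+s. indicator S (tanh (s/2)) \<partial>TT)"
  proof -
    have "(\<lambda>s. indicator S (tanh (s/2)) :: ennreal) \<in> borel_measurable borel"
      by (rule measurable_compose[OF mt]) measurable
    then show ?thesis unfolding TT_def by (subst nn_integral_density) auto
  qed
  also have "\<dots> = (\<integral>\<^sup>+t. indicator S t \<partial>distr TT borel (\<lambda>s. tanh (s/2)))"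
    by (rule nn_integral_distr[symmetric]) (use mt in auto)
  finally show "emeasure (distr TT borel (\<lambda>s. tanh (s/2))) S = emeasure ?D S" by simp
qed simp

lemma HH_measurable:
  assumes z: "z \<in> ball_n n" and k: "8 \<le> k"
  shows "HH k z \<in> borel_measurable borel"
    and "(\<integral>s. HH k z s \<partial>TT) = theta_setup.Phi n G TT UU (NN k) z"
proof -
  interpret th: theta_setup n G F TT UU tau Mx "NN k" by (rule theta_setup_k[OF k])
  interpret cG: sigma_finite_measure "count_space G"
    by (rule sigma_finite_measure_count_space_countable[OF countable_G])
  interpret TTf: finite_measure TT by (rule finite_measure_TT)
  have sT: "sigma_finite_measure TT" by unfold_locales
  interpret P: pair_sigma_finite "count_space G" TT ..
  have zs: "z \<in> space (vol_e n)" using z by (simp add: ball_n_alt)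
  have m1: "(\<lambda>s. hk k B s z) \<in> borel_measurable TT" if "B \<in> G" for B
    using measurable_compose[OF measurable_Pair1'[OF zs, of TT] th.hker_measurable[OF that]] by simp
  have m: "(\<lambda>p. hk k (fst p) (snd p) z) \<in> borel_measurable (count_space G \<Otimes>\<^sub>M TT)"
    by (rule measurable_pair_measure_countable1[OF countable_G]) (use m1 in simp)
  have "(\<lambda>(s, A). hk k A s z) \<in> borel_measurable (TT \<Otimes>\<^sub>M count_space G)"
    using measurable_pair_swap[OF m] by simp
  then have "(\<lambda>s. \<integral>A. hk k A s z \<partial>count_space G) \<in> borel_measurable TT"
    by (rule cG.borel_measurable_lebesgue_integral)
  then show "HH k z \<in> borel_measurable borel" by (simp add: HH_def[abs_def])
  have i: "integrable (count_space G \<Otimes>\<^sub>M TT) (\<lambda>p. hk k (fst p) (snd p) z)"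
  proof (rule integrable_pair_bound[OF sT m _ finite_measure.integrable_const[OF finite_measure_TT, of 1]])
    show "integrable (count_space G) (\<lambda>A. (th.Cb * inverse (sqrt (1 - nsq n z)) ^ (NN k + 2 * (n+2))) * inverse (cmod (A $$ (n,n))) ^ (2 * (n+2)))"
      by (rule integrable_mult_right) (rule integrable_inverse_nn)
    show "cmod (hk k (fst (A, s)) (snd (A, s)) z) \<le> (th.Cb * inverse (sqrt (1 - nsq n z)) ^ (NN k + 2 * (n+2))) * inverse (cmod (A $$ (n,n))) ^ (2 * (n+2)) * 1"
      if "A \<in> space (count_space G)" for A s
    proof -
      have "cmod (hk k A s z) \<le> th.Cb * inverse (cmod (A $$ (n,n))) ^ (2 * (n+2)) * inverse (sqrt (1 - nsq n z)) ^ (NN k + 2 * (n+2))"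
        using that th.hker_bound[OF _ z] by simp
      then show ?thesis by (simp only: fst_conv snd_conv mult_1_right ac_simps)
    qed
  qed
  show "(\<integral>s. HH k z s \<partial>TT) = th.Phi z"
    unfolding HH_def th.Phi_def th.phi_def
    by (rule P.Fubini_integral) (use i in \<open>simp add: case_prod_beta'\<close>)
qed

text \<open>The line integral runs in the axis parameter t, where the form contributes kap dt / (1 -
  t^2). Carried to arc length this is kap times \<open>TT\<close>, and exchanging sum and integral
  gives the abstract theta integral.\<close>

lemma Theta_C_eq:
  assumes z: "z \<in> ball_n n" and k: "8 \<le> k"
  shows "Theta_C n G g Ag k z = of_real (cN k * k0 powr (real k / 2) * kap) * theta_setup.Phi n G TT UU (NN k) z"
proof -
  let ?t1 = "tanh (L/2)" and ?c = "complex_of_real (cN k * k0 powr (real k / 2) * kap)"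
  have Lp: "0 < L" by (rule lattice_geodesic.L[OF geodesic_data])
  have t1: "0 < ?t1" "?t1 < 1" using Lp tanh_range[of L] by auto
  define f where "f t = Theta_w n G k (w t) z * of_real (Re (bergman n (w t) (w t)) powr (- real k / 2))
      * phi_coeff n (mob n Bg (w t)) * vector_derivative (\<lambda>s. mob n Bg (w s) (n - 1)) (at t)" for t
  have ft: "f (tanh (s/2)) = ?c * (HH k z s * of_real (inverse (1 - (tanh (s/2))\<^sup>2)))" if s: "s \<in> {0<..<L}" for s
    unfolding f_def Theta_w_eq[OF z s k] mob_Bg_w[OF tanh_range] phi_coeff_c0[OF tanh_range] vector_derivative_Bg_w[OF tanh_range]
    by (simp only: of_real_mult mult_1_right mult_1_left ac_simps)
  \<comment> \<open>The integrand has been computed only at parameters tanh (s/2); continuity and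
    the intermediate value theorem show that these exhaust the open segment.\<close>
  have surj: "\<exists>s. s \<in> {0<..<L} \<and> t = tanh (s/2)" if "t \<in> {0<..<?t1}" for t
  proof -
    have "\<exists>s\<ge>0. s \<le> L \<and> tanh (s/2) = t"
    proof (rule IVT)
      have "cosh (s/2) \<noteq> 0" for s :: real using cosh_real_pos[of "s/2"] by linarith
      then show "\<forall>s. 0 \<le> s \<and> s \<le> L \<longrightarrow> isCont (\<lambda>s. tanh (s/2)) s" by (auto intro!: continuous_intros)
    qed (use that Lp in auto)
    then obtain s where "0 \<le> s" "s \<le> L" "tanh (s/2) = t" by blast
    then show ?thesis using that by (intro exI[of _ s]) auto
  qed
  have inv: "2 * artanh (tanh (s/2)) = s" for s :: real by (simp add: artanh_tanh_real)
  note [measurable] = HH_measurable(1)[OF z k]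
  have am: "(\<lambda>t::real. 2 * artanh t) \<in> borel_measurable borel"
    unfolding artanh_def by measurable
  have Hm: "(\<lambda>t. HH k z (2 * artanh t)) \<in> borel_measurable borel"
    by (rule measurable_compose[OF am HH_measurable(1)[OF z k]])
  have "Theta_C n G g Ag k z = interval_lebesgue_integral lborel (ereal 0) (ereal ?t1) f"
    unfolding Theta_C_def line_int_pullback_def seg_end_eq f_def w_def Bg_def ..
  also have "\<dots> = (\<integral>t. indicator {0<..<?t1} t *\<^sub>R f t \<partial>lborel)"
    using t1 by (simp add: interval_lebesgue_integral_def set_lebesgue_integral_def)
  also have "\<dots> = (\<integral>t. ?c * ((indicator {0<..<?t1} t * inverse (1 - t\<^sup>2)) *\<^sub>R HH k z (2 * artanh t)) \<partial>lborel)"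
  proof (rule Bochner_Integration.integral_cong[OF refl])
    fix t :: real
    show "indicator {0<..<?t1} t *\<^sub>R f t = ?c * ((indicator {0<..<?t1} t * inverse (1 - t\<^sup>2)) *\<^sub>R HH k z (2 * artanh t))"
    proof (cases "t \<in> {0<..<?t1}")
      case True
      then obtain s where s: "s \<in> {0<..<L}" "t = tanh (s/2)" using surj by blast
      have "f t = ?c * (HH k z s * of_real (inverse (1 - t\<^sup>2)))" unfolding s(2) by (rule ft[OF s(1)])
      moreover have "2 * artanh t = s" unfolding s(2) by (rule inv)
      ultimately show ?thesis using True by (simp add: scaleR_conv_of_real mult_ac)
    qed simp
  qed
  also have "\<dots> = ?c * (\<integral>t. (indicator {0<..<?t1} t * inverse (1 - t\<^sup>2)) *\<^sub>R HH k z (2 * artanh t) \<partial>lborel)"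
    by (rule integral_mult_right_zero)
  also have "(\<integral>t. (indicator {0<..<?t1} t * inverse (1 - t\<^sup>2)) *\<^sub>R HH k z (2 * artanh t) \<partial>lborel)
     = (\<integral>t. HH k z (2 * artanh t) \<partial>density lborel (\<lambda>t. ennreal (indicator {0<..<?t1} t * inverse (1 - t\<^sup>2))))"
  proof (rule integral_density[symmetric])
    show "AE t in lborel. 0 \<le> indicator {0<..<?t1} t * inverse (1 - t\<^sup>2)"
    proof (rule AE_I2)
      fix t :: real
      show "0 \<le> indicator {0<..<?t1} t * inverse (1 - t\<^sup>2)"
      proof (cases "t \<in> {0<..<?t1}")
        case True
        then have "\<bar>t\<bar> \<le> 1" using t1 by auto
        then have "t\<^sup>2 \<le> 1" by (simp add: abs_square_le_1)
        then show ?thesis by simp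
      qed simp
    qed
  qed (use Hm in auto)
  also have "\<dots> = (\<integral>t. HH k z (2 * artanh t) \<partial>distr TT borel (\<lambda>s. tanh (s/2)))"
    unfolding distr_TT_tanh ..
  also have "\<dots> = (\<integral>s. HH k z (2 * artanh (tanh (s/2))) \<partial>TT)"
  proof (rule integral_distr)
    show "(\<lambda>s::real. tanh (s/2)) \<in> TT \<rightarrow>\<^sub>M borel" unfolding tanh_def sinh_def cosh_def by measurable
  qed (use Hm in auto)
  also have "\<dots> = theta_setup.Phi n G TT UU (NN k) z"
    unfolding inv by (rule HH_measurable(2)[OF z k])
  finally show ?thesis .
qed

text \<open>The binomial c(B^n, k) is the normalisation that makes the weighted kernel reproducing;
  here the factorials cancel exactly.\<close>

lemma omega_cN:
  assumes "1 \<le> k"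
  shows "cN k * k0 * omega n (NN k) = 1"
proof -
  define a where "a = (n+1) * (k-1)"
  have N: "NN k = a + (n + 1)" using assms unfolding NN_def a_def by (cases k) auto
  have "cN k = fact (a + n) / (fact n * fact a)"
    unfolding cN_def a_def[symmetric] by (subst binomial_fact) auto
  then show ?thesis unfolding k0_def omega_def N by simp
qed

text \<open>The square of the prefactor contains c^2 and k0^k. The Petersson weight removes k0^k,
  and the volume constant together with omega removes one factor c.\<close>

lemma pet_ip_eq:
  assumes k: "8 \<le> k"
  shows "pet_ip n k F (Theta_C n G g Ag k) (Theta_C n G g Ag k) = of_real (cN k * kap\<^sup>2) * SS (NN k)"
proof -
  interpret th: theta_setup n G F TT UU tau Mx "NN k" by (rule theta_setup_k[OF k])
  let ?c = "cN k * k0 powr (real k / 2) * kap"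
  let ?Th = "Theta_C n G g Ag k"
  let ?h = "\<lambda>z. th.Phi z * cnj (th.Phi z) * complex_of_real (th.wt z)"
  have Phi_m: "th.Phi \<in> borel_measurable (vol_e n)"
  proof -
    interpret cG: sigma_finite_measure "count_space G"
      by (rule sigma_finite_measure_count_space_countable[OF countable_G])
    have "(\<lambda>p. th.phi (fst p) (snd p)) \<in> borel_measurable (count_space G \<Otimes>\<^sub>M vol_e n)"
      by (rule measurable_pair_measure_countable1[OF countable_G]) (use th.phi_measurable in simp)
    from measurable_pair_swap[OF this] have "(\<lambda>(z, A). th.phi A z) \<in> borel_measurable (vol_e n \<Otimes>\<^sub>M count_space G)" by simp
    then show ?thesis unfolding th.Phi_def[abs_def] by (rule cG.borel_measurable_lebesgue_integral)
  qed
  note [measurable] = Phi_m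
  have pt: "indicator F z *\<^sub>R (?Th z * cnj (?Th z) * (bergman n z z) powi (- int k) * bergman n z z)
    = of_real (?c\<^sup>2 * (k0 * inverse k0 ^ k)) * ((indicator (ball_n n) z * inverse (1 - nsq n z) ^ (n+1)) *\<^sub>R (indicator F z *\<^sub>R ?h z))" for z
  proof (cases "z \<in> F")
    case True
    then have z: "z \<in> ball_n n" using F_ball by auto
    define r where "r = 1 - nsq n z"
    have r: "0 < r" using z by (simp add: r_def ball_n_alt)
    define B where "B = k0 * inverse r ^ (n+1)"
    have Bz: "bergman n z z = of_real B" unfolding bergman_self r_def B_def ..
    have B0: "0 < B" unfolding B_def using k0_pos r by simp
    have "(bergman n z z) powi (- int k) * bergman n z z = of_real (inverse B ^ k * B)"
      unfolding Bz using B0 by (simp add: power_int_minus power_inverse)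
    also have "inverse B ^ k * B = (k0 * inverse k0 ^ k) * (inverse r ^ (n+1) * r ^ NN k)"
      unfolding B_def NN_def power_mult using r k0_pos by (simp add: power_mult_distrib power_inverse)
    finally have b1: "(bergman n z z) powi (- int k) * bergman n z z = of_real ((k0 * inverse k0 ^ k) * (inverse r ^ (n+1) * r ^ NN k))" .
    have wt: "th.wt z = r ^ NN k" using z by (simp add: th.wt_def r_def)
    have "?Th z * cnj (?Th z) * (bergman n z z) powi (- int k) * bergman n z z
      = (of_real ?c * th.Phi z) * cnj (of_real ?c * th.Phi z) * ((bergman n z z) powi (- int k) * bergman n z z)"
      unfolding Theta_C_eq[OF z k] by (simp only: mult.assoc)
    also have "\<dots> = of_real (?c\<^sup>2 * (k0 * inverse k0 ^ k)) * (of_real (inverse r ^ (n+1)) * (th.Phi z * cnj (th.Phi z) * of_real (r ^ NN k)))"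
      unfolding b1 complex_cnj_mult complex_cnj_complex_of_real power2_eq_square of_real_mult by (simp only: ac_simps)
    finally show ?thesis using True z unfolding wt r_def[symmetric] by (simp add: scaleR_conv_of_real)
  qed simp
  have "pet_ip n k F ?Th ?Th = (\<integral>z. of_real (?c\<^sup>2 * (k0 * inverse k0 ^ k)) * ((indicator (ball_n n) z * inverse (1 - nsq n z) ^ (n+1)) *\<^sub>R (indicator F z *\<^sub>R ?h z)) \<partial>vol_e n)"
    unfolding pet_ip_def set_lebesgue_integral_def pt ..
  also have "\<dots> = of_real (?c\<^sup>2 * (k0 * inverse k0 ^ k)) * (\<integral>z. (indicator (ball_n n) z * inverse (1 - nsq n z) ^ (n+1)) *\<^sub>R (indicator F z *\<^sub>R ?h z) \<partial>vol_e n)"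
    by (rule integral_mult_right_zero)
  also have "(\<integral>z. (indicator (ball_n n) z * inverse (1 - nsq n z) ^ (n+1)) *\<^sub>R (indicator F z *\<^sub>R ?h z) \<partial>vol_e n) = (\<integral>z. indicator F z *\<^sub>R ?h z \<partial>hyp_vol n)"
  proof -
    have "hyp_vol n = density (vol_e n) (\<lambda>z. ennreal (indicator (ball_n n) z * inverse (1 - nsq n z) ^ (n+1)))"
      unfolding hyp_vol_def by (rule density_cong) (auto simp: indicator_def)
    then show ?thesis
      by (simp only:) (rule integral_density[symmetric], auto simp: indicator_def ball_n_alt intro!: AE_I2)
  qed
  also have "\<dots> = (\<integral>z. ?h z \<partial>hypF)"
  proof -
    have "hypF = density (hyp_vol n) (\<lambda>z. ennreal (indicator F z))"
      unfolding hypF_def by (rule density_cong) (auto simp: indicator_def)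
    then show ?thesis by (simp only:) (rule integral_density[symmetric], auto)
  qed
  also have "\<dots> = of_real (omega n (NN k)) * SS (NN k)"
    unfolding th.inner_product_identity SS_def II_def th.EA_def EE_def ..
  finally have "pet_ip n k F ?Th ?Th = of_real (?c\<^sup>2 * (k0 * inverse k0 ^ k) * omega n (NN k)) * SS (NN k)" by simp
  also have "?c\<^sup>2 * (k0 * inverse k0 ^ k) * omega n (NN k) = cN k * kap\<^sup>2"
  proof -
    have e: "(k0 powr (real k / 2))\<^sup>2 * inverse k0 ^ k = 1"
    proof -
      have "(k0 powr (real k / 2))\<^sup>2 = k0 powr (real k)"
        unfolding power2_eq_square powr_add[symmetric] by simp
      also have "\<dots> = k0 ^ k" by (rule powr_realpow[OF k0_pos])
      finally show ?thesis using k0_pos by (simp add: power_mult_distrib[symmetric])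
    qed
    have "?c\<^sup>2 * (k0 * inverse k0 ^ k) * omega n (NN k)
      = cN k * kap\<^sup>2 * ((k0 powr (real k / 2))\<^sup>2 * inverse k0 ^ k) * (cN k * k0 * omega n (NN k))"
      by (simp only: power_mult_distrib power2_eq_square ac_simps)
    then show ?thesis using omega_cN[of k] k by (simp add: e)
  qed
  finally show ?thesis .
qed

text \<open>The upper entry of the binomial is N - 1, so n! c is the product (N-1)(N-2)...(N-n), and
  each factor divided by N tends to 1.\<close>

lemma cN_asymp: "(\<lambda>k. cN k / (real (NN k) ^ n / fact n)) \<longlonglongrightarrow> 1"
proof -
  have NNi: "filterlim (\<lambda>k. real (NN k)) at_top sequentially"
    unfolding NN_def
    by (rule filterlim_at_top_mono[OF filterlim_real_sequentially]) (auto intro!: always_eventually)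
  have "(\<lambda>k. \<Prod>i<n. (1 - real (Suc i) / real (NN k))) \<longlonglongrightarrow> (\<Prod>i<n. (1 - 0))"
    by (intro tendsto_prod tendsto_diff tendsto_const real_tendsto_divide_at_top[OF tendsto_const NNi])
  then have lim: "(\<lambda>k. \<Prod>i<n. (1 - real (Suc i) / real (NN k))) \<longlonglongrightarrow> 1" by simp
  have "eventually (\<lambda>k. cN k / (real (NN k) ^ n / fact n) = (\<Prod>i<n. (1 - real (Suc i) / real (NN k)))) sequentially"
    using eventually_ge_at_top[of 1]
  proof eventually_elim
    case (elim k)
    define a where "a = (n+1) * (k-1) + n"
    have N: "NN k = a + 1" using elim unfolding NN_def a_def by (cases k) auto
    have N0: "real (NN k) \<noteq> 0" by (simp add: N)
    have "cN k * fact n = (\<Prod>i<n. (real a - real i))"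
      unfolding cN_def a_def[symmetric] binomial_gbinomial gbinomial_prod_rev by (simp add: atLeast0LessThan)
    also have "\<dots> = (\<Prod>i<n. real (NN k) * (1 - real (Suc i) / real (NN k)))"
    proof (rule prod.cong[OF refl])
      fix i
      have "real (NN k) * (1 - real (Suc i) / real (NN k)) = real (NN k) - real (Suc i)" using N0 by (simp add: right_diff_distrib)
      then show "real a - real i = real (NN k) * (1 - real (Suc i) / real (NN k))" by (simp add: N)
    qed
    also have "\<dots> = real (NN k) ^ n * (\<Prod>i<n. (1 - real (Suc i) / real (NN k)))" by (simp add: prod.distrib)
    finally have e: "cN k * fact n = real (NN k) ^ n * (\<Prod>i<n. (1 - real (Suc i) / real (NN k)))" .
    have "cN k / (real (NN k) ^ n / fact n) = cN k * fact n / real (NN k) ^ n" by simp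
    also have "\<dots> = (\<Prod>i<n. (1 - real (Suc i) / real (NN k)))" unfolding e using N0 by simp
    finally show ?case .
  qed
  then show ?thesis using lim by (subst tendsto_cong)
qed

section \<open>The constant of the asymptotic formula\<close>

definition target :: "nat \<Rightarrow> real" where
  "target k = real k powr (real n - 1/2) * (real n + 1) powr (real n - 1/2)
     / (pi powr ((3 * real n - 1) / (2 * real n + 2)) * fact n powr ((real n - 1) / (real n + 1))) * L / sqrt 2"

text \<open>The factor \<open>kap\<^sup>2\<close> is (n! / pi^n)^(2/(n+1)). Combined with 1/n! it
  gives the exponent (n-1)/(n+1) of the factorial, and combined with the sqrt pi of the Gaussian
  integral it gives (3n-1)/(2n+2).\<close>

lemma target_eq:
  assumes k: "1 \<le> k"
  shows "target k = real (NN k) ^ n / fact n * kap\<^sup>2 / sqrt (real (NN k)) * (sqrt (8 * pi) / 2 * (L / 2))"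
proof -
  let ?N = "real (NN k)" and ?f = "fact n :: real"
  have N: "?N = real k * (real n + 1)" by (simp add: NN_def algebra_simps)
  have "0 < NN k" using k by (simp add: NN_def)
  then have Np: "0 < ?N" by simp
  have 1: "real k powr (real n - 1/2) * (real n + 1) powr (real n - 1/2) = ?N ^ n / sqrt ?N"
  proof -
    have "real k powr (real n - 1/2) * (real n + 1) powr (real n - 1/2) = ?N powr (real n - 1/2)"
      unfolding N by (rule powr_mult[symmetric])
    also have "\<dots> = ?N powr real n / ?N powr (1/2)" by (rule powr_diff)
    also have "\<dots> = ?N ^ n / sqrt ?N" using Np by (simp add: powr_realpow powr_half_sqrt)
    finally show ?thesis .
  qed
  have fp: "0 < ?f" by simp
  have n1: "real n + 1 \<noteq> 0" by (simp add: add_nonneg_eq_0_iff)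
  have 2: "kap\<^sup>2 = ?f powr (2 / (real n + 1)) * pi powr (- (2 * real n / (real n + 1)))"
  proof -
    have "kap\<^sup>2 = k0 powr (2 / (real n + 1))"
      unfolding kap_def power2_eq_square powr_add[symmetric] by (simp add: add.commute)
    also have "k0 = ?f * pi powr (- real n)"
      unfolding k0_def powr_minus by (simp add: powr_realpow inverse_eq_divide)
    also have "\<dots> powr (2 / (real n + 1)) = ?f powr (2 / (real n + 1)) * pi powr (- real n * (2 / (real n + 1)))"
      by (simp add: powr_mult powr_powr)
    also have "- real n * (2 / (real n + 1)) = - (2 * real n / (real n + 1))" by simp
    finally show ?thesis .
  qed
  have s8: "sqrt (8 * pi) / 4 = pi powr (1/2) / sqrt 2"
  proof -
    have "sqrt 8 = 2 * sqrt (2::real)" using real_sqrt_mult[of 4 2] by simp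
    then have "sqrt (8 * pi) / 4 = sqrt 2 * sqrt pi / 2" by (simp add: real_sqrt_mult)
    also have "\<dots> = sqrt pi / sqrt 2" by (simp add: field_simps)
    finally show ?thesis by (simp add: powr_half_sqrt)
  qed
  have ef: "?f powr (2 / (real n + 1)) / ?f = 1 / ?f powr ((real n - 1) / (real n + 1))"
  proof -
    have "2 / (real n + 1) + (real n - 1) / (real n + 1) = 1" using n1 by (simp add: add_divide_distrib[symmetric])
    then have "?f powr (2 / (real n + 1)) * ?f powr ((real n - 1) / (real n + 1)) = ?f"
      unfolding powr_add[symmetric] by simp
    then show ?thesis using fp by (simp add: field_simps)
  qed
  have ep: "pi powr (- (2 * real n / (real n + 1))) * pi powr (1/2) = 1 / pi powr ((3 * real n - 1) / (2 * real n + 2))"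
  proof -
    have "- (2 * real n / (real n + 1)) + 1/2 = - ((3 * real n - 1) / (2 * real n + 2))"
      using n1 by (simp add: field_simps)
    then have "pi powr (- (2 * real n / (real n + 1))) * pi powr (1/2) = pi powr (- ((3 * real n - 1) / (2 * real n + 2)))"
      unfolding powr_add[symmetric] by simp
    then show ?thesis by (simp add: powr_minus inverse_eq_divide)
  qed
  have "real (NN k) ^ n / ?f * kap\<^sup>2 / sqrt ?N * (sqrt (8 * pi) / 2 * (L / 2))
    = (?N ^ n / sqrt ?N) * (?f powr (2 / (real n + 1)) / ?f) * (pi powr (- (2 * real n / (real n + 1))) * (sqrt (8 * pi) / 4)) * L"
    unfolding 2 by (simp add: mult_ac)
  also have "\<dots> = (?N ^ n / sqrt ?N) * (?f powr (2 / (real n + 1)) / ?f) * (pi powr (- (2 * real n / (real n + 1))) * pi powr (1/2)) * L / sqrt 2"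
    unfolding s8 by simp
  also have "\<dots> = target k" unfolding target_def 1 ef ep by simp
  finally show ?thesis ..
qed

theorem pet_ip_asymptotics:
  "(\<lambda>k. pet_ip n k F (Theta_C n G g Ag k) (Theta_C n G g Ag k) / of_real (target k)) \<longlonglongrightarrow> 1"
proof -
  let ?l = "sqrt (8 * pi) / 2 * (L / 2)"
  have Lp: "0 < L" by (rule lattice_geodesic.L[OF geodesic_data])
  have l: "?l \<noteq> 0" using Lp by simp
  have "filterlim NN at_top sequentially"
    unfolding NN_def by (rule filterlim_at_top_mono[OF filterlim_ident]) (auto intro!: always_eventually)
  then have "(\<lambda>k. of_real (sqrt (real (NN k))) * SS (NN k)) \<longlonglongrightarrow> of_real ?l"
    using SS_limit filterlim_compose by blast
  then have "(\<lambda>k. of_real (cN k / (real (NN k) ^ n / fact n)) * (of_real (sqrt (real (NN k))) * SS (NN k)) / of_real ?l)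
     \<longlonglongrightarrow> of_real 1 * of_real ?l / of_real ?l"
    using l by (intro tendsto_divide tendsto_mult tendsto_of_real cN_asymp tendsto_const) (auto simp del: of_real_mult of_real_divide)
  moreover have "of_real 1 * complex_of_real ?l / of_real ?l = 1" using l by (simp only: of_real_1 mult_1_left of_real_eq_0_iff divide_self not_False_eq_True)
  moreover have "eventually (\<lambda>k. of_real (cN k / (real (NN k) ^ n / fact n)) * (of_real (sqrt (real (NN k))) * SS (NN k)) / of_real ?l
     = pet_ip n k F (Theta_C n G g Ag k) (Theta_C n G g Ag k) / of_real (target k)) sequentially"
    using eventually_ge_at_top[of 8]
  proof eventually_elim
    case (elim k)
    have "0 < NN k" using elim by (simp add: NN_def)
    then have N: "0 < real (NN k)" by simp
    have kp: "kap \<noteq> 0" using k0_pos by (simp add: kap_def)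
    have t: "target k = real (NN k) ^ n / fact n * kap\<^sup>2 / sqrt (real (NN k)) * ?l"
      by (rule target_eq) (use elim in simp)
    have "cN k * kap\<^sup>2 / target k = cN k / (real (NN k) ^ n / fact n) * sqrt (real (NN k)) / ?l"
      unfolding t using N kp l by (simp add: field_simps)
    then have e: "complex_of_real (cN k * kap\<^sup>2) / of_real (target k) = of_real (cN k / (real (NN k) ^ n / fact n)) * of_real (sqrt (real (NN k))) / of_real ?l"
      by (simp only: of_real_divide[symmetric] of_real_mult[symmetric])
    have gen: "p * (q * s) / l' = r * s / t'" if "r / t' = p * q / l'" for p q s l' r t' :: complex
    proof -
      have "p * (q * s) / l' = (p * q / l') * s" by (simp add: mult.assoc)
      also have "\<dots> = (r / t') * s" by (simp only: that)
      also have "\<dots> = r * s / t'" by simp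
      finally show ?thesis .
    qed
    show ?case unfolding pet_ip_eq[OF elim] by (rule gen[OF e])
  qed
  ultimately show ?thesis by (simp only: tendsto_cong)
qed

end

theorem theorem1:
  fixes n :: nat and G :: "complex mat set" and g :: "complex mat"
    and X Y :: "nat \<Rightarrow> complex" and lam :: real
    and v :: "nat \<Rightarrow> complex vec" and eps :: "nat \<Rightarrow> complex"
    and F :: "(nat \<Rightarrow> complex) set"
  assumes n: "n \<ge> 1"
    and G: "subgroup_SU n G" "discrete_mat n G" "acts_freely n G" "cocompact n G"
    and g: "g \<in> G" "hyperbolic_el n g" "primitive_in G g"
    and XY: "X \<in> sphere_n n" "Y \<in> sphere_n n" "\<forall>j<n. X j \<in> \<real> \<and> Y j \<in> \<real>"
    and eig: "eigenvector g (lift n X) (of_real lam)" "eigenvector g (lift n Y) (of_real (1 / lam))"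
    and lam: "lam\<^sup>2 > 1"
    and veig: "\<forall>i<n-1. eps i \<in> {-1, 1} \<and> eigenvector g (v i) (eps i)"
    and vord: "\<forall>i<n-1. \<forall>j<i. eps i = -1 \<longrightarrow> eps j = -1"
    and vorth: "\<forall>i<n-1. \<forall>j<n-1. eps i = eps j \<longrightarrow>
                   hform n (v i) (v j) = (if i = j then 1 else 0)"
    and F: "fund_domain n G F"
  shows "(\<lambda>k. pet_ip n k F (Theta_C n G g (A_gamma n v X Y) k) (Theta_C n G g (A_gamma n v X Y) k)
           / complex_of_real (real k powr (real n - 1/2) * (real n + 1) powr (real n - 1/2)
               / (pi powr ((3 * real n - 1) / (2 * real n + 2)) * fact n powr ((real n - 1) / (real n + 1)))
               * hdist n (mob n (A_gamma n v X Y) (c0pt n 0)) (mob n g (mob n (A_gamma n v X Y) (c0pt n 0)))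
               / sqrt 2))
         \<longlonglongrightarrow> 1"
proof -
  interpret hyperbolic_data n G g X Y lam v eps F
    by (rule hyperbolic_data.intro) (fact n G g XY eig lam veig vorth F)+
  show ?thesis
    using pet_ip_asymptotics hdist_eq unfolding target_def w_def by simp
qed

end
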